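(* Given a set $X$ of $n$ points in the plane and a positive integer $\tau$, each of the following tasks can be done by an algorithm running in $O(n^{\omega})$ time, where $\omega < 2.372$ is the exponent of the best algorithm for matrix multiplication: (1) deciding whether $X$ spans a $\tau$-ordinary triangle, and finding one if it does; (2) counting all $\tau$-ordinary triangles spanned by $X$.
   Context: Let $X$ be a finite set of points in the plane. A line spanned by $X$ is a line passing through at least two points of $X$. For a positive integer $\tau$, a line spanned by $X$ is called $\tau$-ordinary if it is incident to at most $\tau$ points of $X$. Three noncollinear points of $X$ form a $\tau$-ordinary triangle if each of the three lines determined by pairs of these points is $\tau$-ordinary (with respect to $X$). Counting means computing the number of unordered triples of points of $X$ that form a $\tau$-ordinary triangle. The exponent $\omega$ of matrix multiplication is the infimum of all values $s$ such that two $n \times n$ real matrices can be multiplied in $O(n^{s})$ time; it is known that $\omega < 2.372$. As usual, when writing running times $O(n^{\omega})$ one uses the convention that two $n \times n$ matrices can be multiplied in $O(n^{\omega})$ time (i.e. factors $n^{o(1)}$ arising from the infimum are suppressed). Running time is the number of elementary operations in the standard model of computational geometry (real RAM: points are given by real coordinates, and arithmetic operations, comparisons and memory accesses each take constant time). *)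

theory Defs
  imports
    "HOL-Analysis.Analysis"
    "HOL-Library.Landau_Symbols"
    "Jordan_Normal_Form.Matrix"
begin

section \<open>The real RAM\<close>

text \<open>
  A machine has arrays of natural numbers and arrays of real numbers, both named by natural
  numbers; a program mentions finitely many of them. Array cells are addressed by (computed)
  natural numbers. Real arithmetic is exact. There is no conversion from reals to naturals
  (no floor), no integer division, and the only constants are natural numbers, so that neither
  digits of a number can be extracted nor advice be hidden in a constant at unit cost.
\<close>

record ram_state =
  nmem :: "nat \<Rightarrow> nat \<Rightarrow> nat"
  rmem :: "nat \<Rightarrow> nat \<Rightarrow> real"

datatype nexp =
    NConst nat
  | NRead nat nexp
  | NAdd nexp nexp
  | NSub nexp nexp
  | NMul nexp nexp

datatype rexp =
    ROfNat nexp
  | RRead nat nexp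
  | RAdd rexp rexp
  | RSub rexp rexp
  | RMul rexp rexp
  | RDiv rexp rexp

datatype bexp =
    NLe nexp nexp
  | RLe rexp rexp
  | BNot bexp
  | BAnd bexp bexp

datatype com =
    Skip
  | NWrite nat nexp nexp
  | RWrite nat nexp rexp
  | Seq com com
  | Cond bexp com com
  | While bexp com

text \<open>Subtraction of naturals is truncated, and division by zero yields zero.\<close>

primrec nval :: "ram_state \<Rightarrow> nexp \<Rightarrow> nat" where
  "nval s (NConst k) = k"
| "nval s (NRead a i) = nmem s a (nval s i)"
| "nval s (NAdd e f) = nval s e + nval s f"
| "nval s (NSub e f) = nval s e - nval s f"
| "nval s (NMul e f) = nval s e * nval s f"

primrec rval :: "ram_state \<Rightarrow> rexp \<Rightarrow> real" where
  "rval s (ROfNat e) = real (nval s e)"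
| "rval s (RRead a i) = rmem s a (nval s i)"
| "rval s (RAdd e f) = rval s e + rval s f"
| "rval s (RSub e f) = rval s e - rval s f"
| "rval s (RMul e f) = rval s e * rval s f"
| "rval s (RDiv e f) = rval s e / rval s f"

primrec bval :: "ram_state \<Rightarrow> bexp \<Rightarrow> bool" where
  "bval s (NLe e f) \<longleftrightarrow> nval s e \<le> nval s f"
| "bval s (RLe e f) \<longleftrightarrow> rval s e \<le> rval s f"
| "bval s (BNot b) \<longleftrightarrow> \<not> bval s b"
| "bval s (BAnd b c) \<longleftrightarrow> bval s b \<and> bval s c"

text \<open>Every operation occurring in an expression costs one time unit.\<close>

primrec ncost :: "nexp \<Rightarrow> nat" where
  "ncost (NConst k) = 1"
| "ncost (NRead a i) = 1 + ncost i"
| "ncost (NAdd e f) = 1 + ncost e + ncost f"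
| "ncost (NSub e f) = 1 + ncost e + ncost f"
| "ncost (NMul e f) = 1 + ncost e + ncost f"

primrec rcost :: "rexp \<Rightarrow> nat" where
  "rcost (ROfNat e) = 1 + ncost e"
| "rcost (RRead a i) = 1 + ncost i"
| "rcost (RAdd e f) = 1 + rcost e + rcost f"
| "rcost (RSub e f) = 1 + rcost e + rcost f"
| "rcost (RMul e f) = 1 + rcost e + rcost f"
| "rcost (RDiv e f) = 1 + rcost e + rcost f"

primrec bcost :: "bexp \<Rightarrow> nat" where
  "bcost (NLe e f) = 1 + ncost e + ncost f"
| "bcost (RLe e f) = 1 + rcost e + rcost f"
| "bcost (BNot b) = 1 + bcost b"
| "bcost (BAnd b c) = 1 + bcost b + bcost c"

definition nwrite :: "nat \<Rightarrow> nat \<Rightarrow> nat \<Rightarrow> ram_state \<Rightarrow> ram_state" where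
  "nwrite a i v s = s\<lparr>nmem := (nmem s)(a := (nmem s a)(i := v))\<rparr>"

definition rwrite :: "nat \<Rightarrow> nat \<Rightarrow> real \<Rightarrow> ram_state \<Rightarrow> ram_state" where
  "rwrite a i v s = s\<lparr>rmem := (rmem s)(a := (rmem s a)(i := v))\<rparr>"

text \<open>\<open>exec c s t s'\<close>: started in \<open>s\<close>, the program \<open>c\<close> halts in \<open>s'\<close> after \<open>t\<close> time units.\<close>

inductive exec :: "com \<Rightarrow> ram_state \<Rightarrow> nat \<Rightarrow> ram_state \<Rightarrow> bool" where
  Skip: "exec Skip s 1 s"
| NWrite: "exec (NWrite a i e) s (1 + ncost i + ncost e) (nwrite a (nval s i) (nval s e) s)"
| RWrite: "exec (RWrite a i e) s (1 + ncost i + rcost e) (rwrite a (nval s i) (rval s e) s)"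
| Seq: "exec c s t s' \<Longrightarrow> exec d s' u s'' \<Longrightarrow> exec (Seq c d) s (t + u) s''"
| CondTrue: "bval s b \<Longrightarrow> exec c s t s' \<Longrightarrow> exec (Cond b c d) s (1 + bcost b + t) s'"
| CondFalse: "\<not> bval s b \<Longrightarrow> exec d s t s' \<Longrightarrow> exec (Cond b c d) s (1 + bcost b + t) s'"
| WhileFalse: "\<not> bval s b \<Longrightarrow> exec (While b c) s (1 + bcost b) s"
| WhileTrue: "bval s b \<Longrightarrow> exec c s t s' \<Longrightarrow> exec (While b c) s' u s'' \<Longrightarrow>
    exec (While b c) s (1 + bcost b + t + u) s''"

text \<open>
  One program solves all instances \<open>x \<in> I\<close>, presented in memory as \<open>enc x\<close>, with worst-case
  running time \<open>O(n\<^sup>s)\<close> in the size \<open>n = sz x\<close>; \<open>ok x s'\<close> says that the final state \<open>s'\<close>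
  contains a correct answer.
\<close>

definition solvable_in_time ::
  "'i set \<Rightarrow> ('i \<Rightarrow> nat) \<Rightarrow> ('i \<Rightarrow> ram_state) \<Rightarrow> ('i \<Rightarrow> ram_state \<Rightarrow> bool) \<Rightarrow> real \<Rightarrow> bool" where
  "solvable_in_time I sz enc ok s \<longleftrightarrow>
    (\<exists>c T :: nat \<Rightarrow> nat. (\<lambda>n. real (T n)) \<in> O(\<lambda>n. real n powr s) \<and>
      (\<forall>x\<in>I. \<exists>t s'. exec c (enc x) t s' \<and> t \<le> T (sz x) \<and> ok x s'))"


section \<open>The exponent of matrix multiplication\<close>

text \<open>
  The dimension is given in cell 0 of the natural array 0, the factors row by row in the real
  arrays 0 and 1; the product is returned row by row in the real array 2. All other cells are
  initially zero.
\<close>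

definition matmul_instances :: "(nat \<times> real mat \<times> real mat) set" where
  "matmul_instances = {(n, A, B). A \<in> carrier_mat n n \<and> B \<in> carrier_mat n n}"

definition matmul_input :: "nat \<times> real mat \<times> real mat \<Rightarrow> ram_state" where
  "matmul_input = (\<lambda>(n, A, B).
    \<lparr>nmem = (\<lambda>a i. if a = 0 \<and> i = 0 then n else 0),
     rmem = (\<lambda>a i. if a = 0 \<and> i < n * n then A $$ (i div n, i mod n)
                   else if a = 1 \<and> i < n * n then B $$ (i div n, i mod n) else 0)\<rparr>)"

definition matmul_output :: "nat \<times> real mat \<times> real mat \<Rightarrow> ram_state \<Rightarrow> bool" where
  "matmul_output = (\<lambda>(n, A, B) s'. mat n n (\<lambda>(i, j). rmem s' 2 (i * n + j)) = A * B)"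

definition matmul_in_time :: "real \<Rightarrow> bool" where
  "matmul_in_time = solvable_in_time matmul_instances fst matmul_input matmul_output"

definition omega :: real where
  "omega = Inf {s. matmul_in_time s}"


section \<open>Ordinary triangles\<close>

type_synonym point = "real \<times> real"

definition spanned_line :: "point set \<Rightarrow> point set \<Rightarrow> bool" where
  "spanned_line X L \<longleftrightarrow> affine L \<and> aff_dim L = 1 \<and> (\<exists>p\<in>X \<inter> L. \<exists>q\<in>X \<inter> L. p \<noteq> q)"

definition ordinary_line :: "point set \<Rightarrow> nat \<Rightarrow> point set \<Rightarrow> bool" where
  "ordinary_line X \<tau> L \<longleftrightarrow> spanned_line X L \<and> card (X \<inter> L) \<le> \<tau>"

definition ordinary_triangle :: "point set \<Rightarrow> nat \<Rightarrow> point set \<Rightarrow> bool" where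
  "ordinary_triangle X \<tau> T \<longleftrightarrow> T \<subseteq> X \<and> card T = 3 \<and> \<not> collinear T \<and>
    (\<forall>p\<in>T. \<forall>q\<in>T. p \<noteq> q \<longrightarrow> ordinary_line X \<tau> (affine hull {p, q}))"

text \<open>
  A point set is given to a program by an arbitrary enumeration without repetitions: its size and
  \<open>\<tau>\<close> in cells 0 and 1 of the natural array 0, the coordinates of the points in the real arrays
  0 and 1. All other cells are initially zero.
\<close>

definition triangle_instances :: "(point list \<times> nat) set" where
  "triangle_instances = {(ps, \<tau>). distinct ps \<and> \<tau> > 0}"

definition triangle_input :: "point list \<times> nat \<Rightarrow> ram_state" where
  "triangle_input = (\<lambda>(ps, \<tau>).
    \<lparr>nmem = (\<lambda>a i. if a = 0 \<and> i = 0 then length ps else if a = 0 \<and> i = 1 then \<tau> else 0),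
     rmem = (\<lambda>a i. if a = 0 \<and> i < length ps then fst (ps ! i)
                   else if a = 1 \<and> i < length ps then snd (ps ! i) else 0)\<rparr>)"

text \<open>
  The decision is returned in cell 0 of the natural array 1 (1 for yes, 0 for no), and in the
  positive case the indices of the vertices of some triangle in cells 1, 2 and 3.
\<close>

definition finding_output :: "point list \<times> nat \<Rightarrow> ram_state \<Rightarrow> bool" where
  "finding_output = (\<lambda>(ps, \<tau>) s'.
    if \<exists>T. ordinary_triangle (set ps) \<tau> T
    then nmem s' 1 0 = 1 \<and> (\<forall>m\<in>{1, 2, 3}. nmem s' 1 m < length ps) \<and>
      ordinary_triangle (set ps) \<tau> ((\<lambda>m. ps ! nmem s' 1 m) ` {1, 2, 3})
    else nmem s' 1 0 = 0)"

text \<open>The number of triangles is returned in cell 0 of the real array 2.\<close>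

definition counting_output :: "point list \<times> nat \<Rightarrow> ram_state \<Rightarrow> bool" where
  "counting_output = (\<lambda>(ps, \<tau>) s'.
    rmem s' 2 0 = real (card {T. ordinary_triangle (set ps) \<tau> T}))"

definition triangle_finding_in_time :: "real \<Rightarrow> bool" where
  "triangle_finding_in_time =
    solvable_in_time triangle_instances (\<lambda>(ps, \<tau>). length ps) triangle_input finding_output"

definition triangle_counting_in_time :: "real \<Rightarrow> bool" where
  "triangle_counting_in_time =
    solvable_in_time triangle_instances (\<lambda>(ps, \<tau>). length ps) triangle_input counting_output"

end

theory Submission imports Defs begin

text \<open>
  Join two points of \<open>X\<close> when their line is \<open>\<tau>\<close>-ordinary, and let \<open>A\<close> be the adjacency matrix of
  this graph. If \<open>p\<close> and \<open>q\<close> are joined, \<open>(A\<^sup>2)\<^sub>p\<^sub>q\<close> counts their common neighbours. A common neighbour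
  off the line \<open>pq\<close> completes an ordinary triangle; on the line, each of the \<open>d - 2\<close> further points is a
  common neighbour, where \<open>d\<close> is the number of points of \<open>X\<close> on the line. So
  \<open>(A\<^sup>2)\<^sub>p\<^sub>q - (d - 2)\<close> is the number of ordinary triangles with the edge \<open>pq\<close>
  (\<open>card_common_neighbours\<close>). The sum over all ordered joined pairs counts every triangle six times
  (\<open>card_triangle_indices\<close>), and a pair with a positive value is completed to a triangle by trying
  all points. Hence one matrix product suffices, apart from work that has to fit into \<open>O(n\<^sup>2)\<close>: no
  exponent below 2 is possible, because a program must write \<open>n\<^sup>2\<close> output cells
  (\<open>matmul_exponent_ge_2\<close>), but \<open>\<omega> = 2\<close> may be attained.

  The difficulty is therefore to find the number of points on all the lines \<open>pq\<close> in time \<open>O(n\<^sup>2)\<close>;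
  sorting the slopes at every point separately would cost a logarithm too much. In the dual plane,
  points are lines, and the other points in the order of their slopes at \<open>p\<close> are the vertices on the
  line dual to \<open>p\<close>. The arrangement is built by inserting line after line, each insertion walking
  along the new line from face to face. The points are inserted from right to left, so that the new
  line is always the flattest one. It then leaves every face through the lower boundary, and the walk
  needs only the part of each face below the new line. Its cost is linear because it moves on to a
  steeper line at most once for every line, in either direction: the vertex where this happens
  determines which lines have been crossed before (\<open>forward_event_unique\<close>, \<open>left_event_unique\<close>). This
  replaces the zone theorem of general arrangements.

  Of the geometry, the insertion uses only that the three slopes of three points in lexicographic
  order are increasing, equal or decreasing (\<open>slope_between\<close>). Equal slopes are ordered by the index
  of the point, and this perturbation turns every degenerate arrangement into a simple one
  (\<open>prec_flip\<close>); runs of equal slopes in the sorted lists then give the degrees.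

  The algorithm takes the time of the given multiplication program plus \<open>O(n\<^sup>2)\<close>
  (\<open>triangle_program_correct\<close>). For an exponent larger than \<open>\<omega>\<close>, such a program comes from the
  definition of \<open>\<omega>\<close> as an infimum, of a set that is nonempty by the school method
  (\<open>matmul_in_time_3\<close>).
\<close>

section \<open>Reasoning about programs\<close>

lemma nmem_nwrite [simp]: "nmem (nwrite a i v s) = (nmem s)(a := (nmem s a)(i := v))"
  by (simp add: nwrite_def)

lemma rmem_nwrite [simp]: "rmem (nwrite a i v s) = rmem s"
  by (simp add: nwrite_def)

lemma nmem_rwrite [simp]: "nmem (rwrite a i v s) = nmem s"
  by (simp add: rwrite_def)

lemma rmem_rwrite [simp]: "rmem (rwrite a i v s) = (rmem s)(a := (rmem s a)(i := v))"
  by (simp add: rwrite_def)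

text \<open>Loop-free programs are total functions on states; their running time is bounded by a
  constant that can be read off the text.\<close>

primrec loop_free :: "com \<Rightarrow> bool" where
  "loop_free Skip \<longleftrightarrow> True"
| "loop_free (NWrite a i e) \<longleftrightarrow> True"
| "loop_free (RWrite a i e) \<longleftrightarrow> True"
| "loop_free (Seq c d) \<longleftrightarrow> loop_free c \<and> loop_free d"
| "loop_free (Cond b c d) \<longleftrightarrow> loop_free c \<and> loop_free d"
| "loop_free (While b c) \<longleftrightarrow> False"

primrec run :: "com \<Rightarrow> ram_state \<Rightarrow> ram_state" where
  "run Skip s = s"
| "run (NWrite a i e) s = nwrite a (nval s i) (nval s e) s"
| "run (RWrite a i e) s = rwrite a (nval s i) (rval s e) s"
| "run (Seq c d) s = run d (run c s)"
| "run (Cond b c d) s = (if bval s b then run c s else run d s)"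
| "run (While b c) s = s"

primrec max_cost :: "com \<Rightarrow> nat" where
  "max_cost Skip = 1"
| "max_cost (NWrite a i e) = 1 + ncost i + ncost e"
| "max_cost (RWrite a i e) = 1 + ncost i + rcost e"
| "max_cost (Seq c d) = max_cost c + max_cost d"
| "max_cost (Cond b c d) = 1 + bcost b + max_cost c + max_cost d"
| "max_cost (While b c) = 0"

lemma exec_loop_free:
  "loop_free c \<Longrightarrow> \<exists>t\<le>max_cost c. exec c s t (run c s)"
proof (induction c arbitrary: s)
  case (Seq c d)
  then obtain t u where "t \<le> max_cost c" "exec c s t (run c s)"
    "u \<le> max_cost d" "exec d (run c s) u (run d (run c s))" by fastforce
  then show ?case by (intro exI[of _ "t + u"]) (auto intro: exec.Seq)
next
  case (Cond b c d)
  then obtain t u where "t \<le> max_cost c" "exec c s t (run c s)"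
    "u \<le> max_cost d" "exec d s u (run d s)" by fastforce
  then show ?case
    by (intro exI[of _ "1 + bcost b + (if bval s b then t else u)"])
      (auto intro: exec.CondTrue[simplified] exec.CondFalse[simplified])
qed (auto intro: exec.intros[simplified])

text \<open>Facts about an array survive every program that does not mention it as a target. This lets the
  phases of the algorithm be verified separately.\<close>

primrec nat_targets :: "com \<Rightarrow> nat set" where
  "nat_targets Skip = {}"
| "nat_targets (NWrite a i e) = {a}"
| "nat_targets (RWrite a i e) = {}"
| "nat_targets (Seq c d) = nat_targets c \<union> nat_targets d"
| "nat_targets (Cond b c d) = nat_targets c \<union> nat_targets d"
| "nat_targets (While b c) = nat_targets c"

primrec real_targets :: "com \<Rightarrow> nat set" where
  "real_targets Skip = {}"
| "real_targets (NWrite a i e) = {}"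
| "real_targets (RWrite a i e) = {a}"
| "real_targets (Seq c d) = real_targets c \<union> real_targets d"
| "real_targets (Cond b c d) = real_targets c \<union> real_targets d"
| "real_targets (While b c) = real_targets c"

lemma exec_nmem_frame: "exec c s t s' \<Longrightarrow> a \<notin> nat_targets c \<Longrightarrow> nmem s' a = nmem s a"
  by (induction rule: exec.induct) auto

lemma exec_rmem_frame: "exec c s t s' \<Longrightarrow> a \<notin> real_targets c \<Longrightarrow> rmem s' a = rmem s a"
  by (induction rule: exec.induct) auto

lemma run_nmem_frame: "a \<notin> nat_targets c \<Longrightarrow> nmem (run c s) a = nmem s a"
  by (induction c arbitrary: s) auto

lemma run_rmem_frame: "a \<notin> real_targets c \<Longrightarrow> rmem (run c s) a = rmem s a"
  by (induction c arbitrary: s) auto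

text \<open>Total correctness together with a bound on the running time. The numerical bounds below are generous;
  only their order of growth matters.\<close>

definition triple :: "(ram_state \<Rightarrow> bool) \<Rightarrow> com \<Rightarrow> nat \<Rightarrow> (ram_state \<Rightarrow> bool) \<Rightarrow> bool" where
  "triple P c T Q \<longleftrightarrow> (\<forall>s. P s \<longrightarrow> (\<exists>t s'. exec c s t s' \<and> t \<le> T \<and> Q s'))"

lemma tripleD:
  assumes "triple P c T Q" "P s"
  obtains t s' where "exec c s t s'" "t \<le> T" "Q s'"
  using assms unfolding triple_def by blast

lemma triple_conseq:
  assumes "triple P c T Q" "\<And>s. P' s \<Longrightarrow> P s" "\<And>s. Q s \<Longrightarrow> Q' s" "T \<le> T'"
  shows "triple P' c T' Q'"
  using assms unfolding triple_def by (meson le_trans)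

lemma triple_loop_free:
  assumes "loop_free c" "max_cost c \<le> T" "\<And>s. P s \<Longrightarrow> Q (run c s)"
  shows "triple P c T Q"
  unfolding triple_def using exec_loop_free[OF assms(1)] assms(2,3) by (meson le_trans)

lemma triple_Seq:
  assumes "triple P c T R" "triple R d U Q" "T + U \<le> V"
  shows "triple P (Seq c d) V Q"
  unfolding triple_def
proof (intro allI impI)
  fix s assume "P s"
  obtain t s1 where 1: "exec c s t s1" "t \<le> T" "R s1" by (rule tripleD[OF assms(1) \<open>P s\<close>])
  obtain u s2 where 2: "exec d s1 u s2" "u \<le> U" "Q s2" by (rule tripleD[OF assms(2) 1(3)])
  show "\<exists>t s'. exec (Seq c d) s t s' \<and> t \<le> V \<and> Q s'"
    using exec.Seq[OF 1(1) 2(1)] 1(2) 2(2,3) assms(3)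
    by (intro exI[of _ "t + u"] exI[of _ s2]) auto
qed

text \<open>The parameter of the invariant bounds the number of iterations still to come, which is how amortised
  bounds enter: it may be any potential that decreases in every iteration.\<close>

lemma triple_While:
  fixes I :: "nat \<Rightarrow> ram_state \<Rightarrow> bool"
  assumes body: "\<And>k. triple (\<lambda>s. I k s \<and> bval s b) c T (\<lambda>s. \<exists>l<k. I l s)"
    and T': "(k + 1) * (T + bcost b + 1) \<le> T'"
  shows "triple (I k) (While b c) T' (\<lambda>s. (\<exists>l. I l s) \<and> \<not> bval s b)"
proof -
  have "\<exists>t s'. exec (While b c) s t s' \<and> t \<le> (k + 1) * (T + bcost b + 1) \<and>
      (\<exists>l. I l s') \<and> \<not> bval s' b" if "I k s" for s
    using that
  proof (induction k arbitrary: s rule: less_induct)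
    case (less k)
    show ?case
    proof (cases "bval s b")
      case False
      then show ?thesis using less.prems exec.WhileFalse[OF False, of c]
        by (intro exI[of _ "1 + bcost b"] exI[of _ s]) auto
    next
      case True
      obtain t s1 l where 1: "exec c s t s1" "t \<le> T" "l < k" "I l s1"
        using tripleD[OF body, of k s] less.prems True by metis
      obtain u s2 where 2: "exec (While b c) s1 u s2" "u \<le> (l + 1) * (T + bcost b + 1)"
        "\<exists>l. I l s2" "\<not> bval s2 b" using less.IH[OF 1(3,4)] by blast
      have "1 + bcost b + t + u \<le> (l + 1 + 1) * (T + bcost b + 1)"
        using 1(2) 2(2) by (simp add: algebra_simps)
      also have "\<dots> \<le> (k + 1) * (T + bcost b + 1)"
        using 1(3) by (intro mult_right_mono) auto
      finally show ?thesis using exec.WhileTrue[OF True 1(1) 2(1)] 2(3,4) by blast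
    qed
  qed
  then show ?thesis unfolding triple_def using T' by (meson le_trans)
qed

text \<open>Scalar variables are cell 0 of an array of their own, so that the frame lemmas apply to them.\<close>

abbreviation Var :: "nat \<Rightarrow> nexp" where "Var a \<equiv> NRead a (NConst 0)"
abbreviation Assign :: "nat \<Rightarrow> nexp \<Rightarrow> com" where "Assign a e \<equiv> NWrite a (NConst 0) e"
abbreviation Less :: "nexp \<Rightarrow> nexp \<Rightarrow> bexp" where "Less e f \<equiv> BNot (NLe f e)"
abbreviation Equal :: "nexp \<Rightarrow> nexp \<Rightarrow> bexp" where "Equal e f \<equiv> BAnd (NLe e f) (NLe f e)"
abbreviation REqual :: "rexp \<Rightarrow> rexp \<Rightarrow> bexp" where "REqual e f \<equiv> BAnd (RLe e f) (RLe f e)"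

definition For :: "nat \<Rightarrow> nexp \<Rightarrow> com \<Rightarrow> com" where
  "For v e c = Seq (Assign v (NConst 0))
    (While (Less (Var v) e) (Seq c (Assign v (NAdd (Var v) (NConst 1)))))"

lemma nat_targets_For [simp]: "nat_targets (For v e c) = insert v (nat_targets c)"
  by (auto simp: For_def)

lemma real_targets_For [simp]: "real_targets (For v e c) = real_targets c"
  by (auto simp: For_def)

lemma triple_For:
  assumes v: "v \<notin> nat_targets c"
    and bound: "\<And>k s. I k s \<Longrightarrow> nval s e = N"
    and I: "\<And>k x s. I k s \<Longrightarrow> I k (nwrite v 0 x s)"
    and body: "\<And>k. k < N \<Longrightarrow> triple (\<lambda>s. I k s \<and> nmem s v 0 = k) c T (I (Suc k))"
    and T': "(N + 1) * (T + ncost e + 16) \<le> T'"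
  shows "triple (I 0) (For v e c) T' (I N)"
  unfolding For_def
proof (rule triple_Seq)
  define J where "J m s \<longleftrightarrow> (\<exists>k\<le>N. m = N - k \<and> nmem s v 0 = k \<and> I k s)" for m s
  let ?b = "Less (Var v) e"
  let ?inc = "Assign v (NAdd (Var v) (NConst 1))"
  show "triple (I 0) (Assign v (NConst 0)) 3 (J N)"
    by (rule triple_loop_free) (auto simp: J_def intro: I)
  have step: "triple (\<lambda>s. J m s \<and> bval s ?b) (Seq c ?inc) (T + 6) (\<lambda>s. \<exists>l<m. J l s)" for m
    unfolding triple_def
  proof (intro allI impI)
    fix s assume s: "J m s \<and> bval s ?b"
    then obtain k where k: "k \<le> N" "m = N - k" "nmem s v 0 = k" "I k s" by (auto simp: J_def)
    have "k < N" using s k bound[of k s] by auto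
    obtain t s1 where 1: "exec c s t s1" "t \<le> T" "I (Suc k) s1"
      using tripleD[OF body[OF \<open>k < N\<close>], of s] k by blast
    obtain u where 2: "u \<le> max_cost ?inc" "exec ?inc s1 u (run ?inc s1)"
      using exec_loop_free[of ?inc s1] by auto
    have "nmem s1 v 0 = k" using exec_nmem_frame[OF 1(1) v] k by simp
    then have "J (N - Suc k) (run ?inc s1)" using I[OF 1(3)] \<open>k < N\<close> by (auto simp: J_def)
    moreover have "N - Suc k < m" using k \<open>k < N\<close> by simp
    moreover have "t + u \<le> T + 6" using 1(2) 2(1) by simp
    ultimately show "\<exists>t s'. exec (Seq c ?inc) s t s' \<and> t \<le> T + 6 \<and> (\<exists>l<m. J l s')"
      using exec.Seq[OF 1(1) 2(2)] by blast
  qed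
  have "triple (J N) (While ?b (Seq c ?inc)) ((N + 1) * (T + 6 + bcost ?b + 1))
      (\<lambda>s. (\<exists>l. J l s) \<and> \<not> bval s ?b)"
    by (rule triple_While[OF step]) simp
  then show "triple (J N) (While ?b (Seq c ?inc)) ((N + 1) * (T + ncost e + 11)) (I N)"
  proof (rule triple_conseq)
    fix s assume "(\<exists>l. J l s) \<and> \<not> bval s ?b"
    then obtain k where "k \<le> N" "nmem s v 0 = k" "I k s" "nval s e \<le> k"
      by (auto simp: J_def)
    moreover then have "k = N" using bound[of k s] by simp
    ultimately show "I N s" by simp
  qed (auto simp: algebra_simps)
  show "3 + (N + 1) * (T + ncost e + 11) \<le> T'" using T' by (simp add: algebra_simps)
qed

lemma table_index_eq_iff:
  "j < w \<Longrightarrow> j' < w \<Longrightarrow> i * w + j = i' * w + j' \<longleftrightarrow> i = i' \<and> j = (j' :: nat)"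
  by (metis add.commute div_mult_self3 div_less add.right_neutral less_nat_zero_code mod_mult_self3 mod_less)

lemma table_index_less: "i < m \<Longrightarrow> j < w \<Longrightarrow> i * w + j < m * (w :: nat)"
  by (metis add.commute add_less_le_mono less_le_trans mult_Suc mult_le_mono1 Suc_leI nat_add_left_cancel_less)

text \<open>Rows of width \<open>w\<close> stored one after the other. Cutting off the columns from \<open>w\<close> on makes an update of a
  cell an update of the curried function, without a side condition on where the table is read.\<close>

definition table :: "nat \<Rightarrow> (nat \<Rightarrow> 'a :: zero) \<Rightarrow> nat \<Rightarrow> nat \<Rightarrow> 'a" where
  "table w f i j = (if j < w then f (i * w + j) else 0)"

lemma table_upd: "j < w \<Longrightarrow> table w (f(i * w + j := x)) = (table w f)(i := (table w f i)(j := x))"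
  by (auto simp: table_def fun_eq_iff table_index_eq_iff)

text \<open>Renaming all arrays of a program gives it a private part of the memory. The given matrix
  multiplication program, about which nothing but its specification is known, is run in this way.\<close>

primrec shift_nexp :: "nat \<Rightarrow> nexp \<Rightarrow> nexp" where
  "shift_nexp d (NConst k) = NConst k"
| "shift_nexp d (NRead a i) = NRead (d + a) (shift_nexp d i)"
| "shift_nexp d (NAdd e f) = NAdd (shift_nexp d e) (shift_nexp d f)"
| "shift_nexp d (NSub e f) = NSub (shift_nexp d e) (shift_nexp d f)"
| "shift_nexp d (NMul e f) = NMul (shift_nexp d e) (shift_nexp d f)"

primrec shift_rexp :: "nat \<Rightarrow> rexp \<Rightarrow> rexp" where
  "shift_rexp d (ROfNat e) = ROfNat (shift_nexp d e)"
| "shift_rexp d (RRead a i) = RRead (d + a) (shift_nexp d i)"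
| "shift_rexp d (RAdd e f) = RAdd (shift_rexp d e) (shift_rexp d f)"
| "shift_rexp d (RSub e f) = RSub (shift_rexp d e) (shift_rexp d f)"
| "shift_rexp d (RMul e f) = RMul (shift_rexp d e) (shift_rexp d f)"
| "shift_rexp d (RDiv e f) = RDiv (shift_rexp d e) (shift_rexp d f)"

primrec shift_bexp :: "nat \<Rightarrow> bexp \<Rightarrow> bexp" where
  "shift_bexp d (NLe e f) = NLe (shift_nexp d e) (shift_nexp d f)"
| "shift_bexp d (RLe e f) = RLe (shift_rexp d e) (shift_rexp d f)"
| "shift_bexp d (BNot b) = BNot (shift_bexp d b)"
| "shift_bexp d (BAnd b c) = BAnd (shift_bexp d b) (shift_bexp d c)"

primrec shift_com :: "nat \<Rightarrow> com \<Rightarrow> com" where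
  "shift_com d Skip = Skip"
| "shift_com d (NWrite a i e) = NWrite (d + a) (shift_nexp d i) (shift_nexp d e)"
| "shift_com d (RWrite a i e) = RWrite (d + a) (shift_nexp d i) (shift_rexp d e)"
| "shift_com d (Seq c c') = Seq (shift_com d c) (shift_com d c')"
| "shift_com d (Cond b c c') = Cond (shift_bexp d b) (shift_com d c) (shift_com d c')"
| "shift_com d (While b c) = While (shift_bexp d b) (shift_com d c)"

definition upper_part :: "nat \<Rightarrow> ram_state \<Rightarrow> ram_state" where
  "upper_part d s = \<lparr>nmem = (\<lambda>a. nmem s (d + a)), rmem = (\<lambda>a. rmem s (d + a))\<rparr>"

lemma nval_shift [simp]: "nval s (shift_nexp d e) = nval (upper_part d s) e"
  by (induction e) (auto simp: upper_part_def)

lemma rval_shift [simp]: "rval s (shift_rexp d e) = rval (upper_part d s) e"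
proof (induction e)
  case (RRead a i)
  then show ?case by (simp) (simp add: upper_part_def)
qed simp_all

lemma bval_shift [simp]: "bval s (shift_bexp d b) = bval (upper_part d s) b"
  by (induction b) auto

lemma ncost_shift [simp]: "ncost (shift_nexp d e) = ncost e"
  by (induction e) auto

lemma rcost_shift [simp]: "rcost (shift_rexp d e) = rcost e"
  by (induction e) auto

lemma bcost_shift [simp]: "bcost (shift_bexp d e) = bcost e"
  by (induction e) auto

lemma upper_part_nwrite [simp]: "upper_part d (nwrite (d + a) i v s) = nwrite a i v (upper_part d s)"
  by (auto simp: upper_part_def nwrite_def fun_eq_iff)

lemma upper_part_rwrite [simp]: "upper_part d (rwrite (d + a) i v s) = rwrite a i v (upper_part d s)"
  by (auto simp: upper_part_def rwrite_def fun_eq_iff)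

lemma exec_shift:
  "exec c s0 t s1 \<Longrightarrow> upper_part d s = s0 \<Longrightarrow>
    \<exists>s'. exec (shift_com d c) s t s' \<and> upper_part d s' = s1"
proof (induction arbitrary: s rule: exec.induct)
  case (Skip s0)
  then show ?case using exec.Skip[of s] by auto
next
  case (NWrite a i e s0)
  then show ?case
    using exec.NWrite[of "d + a" "shift_nexp d i" "shift_nexp d e" s] by auto
next
  case (RWrite a i e s0)
  then show ?case
    using exec.RWrite[of "d + a" "shift_nexp d i" "shift_rexp d e" s] by auto
next
  case (Seq c s0 t s1 c' u s2)
  then show ?case by (metis exec.Seq shift_com.simps(4))
next
  case (CondTrue s0 b c t s1 c')
  then show ?case using exec.CondTrue[of s "shift_bexp d b"] by fastforce
next
  case (CondFalse s0 b c' t s1 c)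
  then show ?case using exec.CondFalse[of s "shift_bexp d b"] by fastforce
next
  case (WhileFalse s0 b c)
  then show ?case using exec.WhileFalse[of s "shift_bexp d b"] by fastforce
next
  case (WhileTrue s0 b c t s1 u s2)
  then obtain s' where s': "exec (shift_com d c) s t s'" "upper_part d s' = s1" by blast
  then obtain s'' where "exec (shift_com d (While b c)) s' u s''" "upper_part d s'' = s2"
    using WhileTrue by blast
  then show ?case using exec.WhileTrue[of s "shift_bexp d b", OF _ s'(1)] WhileTrue by fastforce
qed

lemma nat_targets_shift: "a < d \<Longrightarrow> a \<notin> nat_targets (shift_com d c)"
  by (induction c) auto

lemma real_targets_shift: "a < d \<Longrightarrow> a \<notin> real_targets (shift_com d c)"
  by (induction c) auto

section \<open>Bounds for the exponent of matrix multiplication\<close>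

text \<open>A time unit changes at most one cell.\<close>

lemma card_changed_cells:
  "exec c s t s' \<Longrightarrow> finite {i. rmem s' a i \<noteq> rmem s a i} \<and> card {i. rmem s' a i \<noteq> rmem s a i} \<le> t"
proof (induction rule: exec.induct)
  case (RWrite b i e s)
  have "{j. rmem (rwrite b (nval s i) (rval s e) s) a j \<noteq> rmem s a j} \<subseteq> {nval s i}" by auto
  from finite_subset[OF this] card_mono[OF _ this] show ?case by simp
next
  case (Seq c s t s' d u s'')
  have sub: "{i. rmem s'' a i \<noteq> rmem s a i} \<subseteq>
      {i. rmem s' a i \<noteq> rmem s a i} \<union> {i. rmem s'' a i \<noteq> rmem s' a i}" by auto
  from card_mono[OF _ sub] card_Un_le[of "{i. rmem s' a i \<noteq> rmem s a i}" "{i. rmem s'' a i \<noteq> rmem s' a i}"]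
    finite_subset[OF sub] Seq.IH show ?case by fastforce
next
  case (WhileTrue s b c t s' u s'')
  have sub: "{i. rmem s'' a i \<noteq> rmem s a i} \<subseteq>
      {i. rmem s' a i \<noteq> rmem s a i} \<union> {i. rmem s'' a i \<noteq> rmem s' a i}" by auto
  from card_mono[OF _ sub] card_Un_le[of "{i. rmem s' a i \<noteq> rmem s a i}" "{i. rmem s'' a i \<noteq> rmem s' a i}"]
    finite_subset[OF sub] WhileTrue.IH show ?case by fastforce
qed auto

text \<open>The square of the all-ones matrix has no zero entry, whereas the output array is initially zero.\<close>

lemma matmul_exponent_ge_2:
  assumes "matmul_in_time s"
  shows "2 \<le> s"
proof -
  obtain c T where T: "(\<lambda>n. real (T n)) \<in> O(\<lambda>n. real n powr s)"
    and c: "\<forall>x\<in>matmul_instances. \<exists>t s'. exec c (matmul_input x) t s' \<and> t \<le> T (fst x) \<and> matmul_output x s'"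
    using assms by (auto simp: matmul_in_time_def solvable_in_time_def)
  have sq: "n * n \<le> T n" for n
  proof -
    define A :: "real mat" where "A = mat n n (\<lambda>_. 1)"
    have "(n, A, A) \<in> matmul_instances" by (simp add: matmul_instances_def A_def)
    with c obtain t s' where s': "exec c (matmul_input (n, A, A)) t s'" "t \<le> T n"
      "matmul_output (n, A, A) s'" by fastforce
    have "{..<n * n} \<subseteq> {i. rmem s' 2 i \<noteq> rmem (matmul_input (n, A, A)) 2 i}"
    proof
      fix x assume x: "x \<in> {..<n * n}"
      then have "0 < n" by (cases n) auto
      then have ij: "x div n < n" "x mod n < n" using x by (auto simp: less_mult_imp_div_less)
      have "mat n n (\<lambda>(i, j). rmem s' 2 (i * n + j)) = A * A"
        using s'(3) by (simp add: matmul_output_def)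
      then have "mat n n (\<lambda>(i, j). rmem s' 2 (i * n + j)) $$ (x div n, x mod n) =
          (A * A) $$ (x div n, x mod n)" by simp
      then have "rmem s' 2 x = real n"
        using ij by (simp add: A_def scalar_prod_def)
      then show "x \<in> {i. rmem s' 2 i \<noteq> rmem (matmul_input (n, A, A)) 2 i}"
        using \<open>0 < n\<close> by (simp add: matmul_input_def)
    qed
    from card_mono[OF _ this] card_changed_cells[OF s'(1), of 2] s'(2) show ?thesis by simp
  qed
  have "(\<lambda>n. real n powr 2) \<in> O(\<lambda>n. real (T n))"
  proof (rule bigoI)
    show "\<forall>\<^sub>F n in sequentially. norm (real n powr 2) \<le> 1 * norm (real (T n))"
    proof (rule always_eventually, rule allI)
      fix n
      have "real (n * n) \<le> real (T n)" using sq[of n] of_nat_le_iff by blast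
      then show "norm (real n powr 2) \<le> 1 * norm (real (T n))" by (simp add: power2_eq_square)
    qed
  qed
  then have "(\<lambda>n. real n powr 2) \<in> O(\<lambda>n. real n powr s)"
    using T by (rule landau_o.big_trans)
  then show ?thesis
    by (subst (asm) powr_bigo_iff) (auto simp: filterlim_real_sequentially)
qed

text \<open>The output array starts with zeros and serves as the accumulator.\<close>

definition school_inner :: com where
  "school_inner = RWrite 2 (NAdd (NMul (Var 1) (Var 0)) (Var 2))
    (RAdd (RRead 2 (NAdd (NMul (Var 1) (Var 0)) (Var 2)))
      (RMul (RRead 0 (NAdd (NMul (Var 1) (Var 0)) (Var 3)))
        (RRead 1 (NAdd (NMul (Var 3) (Var 0)) (Var 2)))))"

definition school_matmul :: com where
  "school_matmul = For 1 (Var 0) (For 2 (Var 0) (For 3 (Var 0) school_inner))"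

lemma school_matmul_correct:
  assumes "(n, A, B) \<in> matmul_instances"
  shows "triple (\<lambda>s. s = matmul_input (n, A, B)) school_matmul (500 * (n + 1) ^ 3) (matmul_output (n, A, B))"
proof -
  have AB: "A \<in> carrier_mat n n" "B \<in> carrier_mat n n" using assms by (auto simp: matmul_instances_def)
  define a where "a = rmem (matmul_input (n, A, B)) 0"
  define b where "b = rmem (matmul_input (n, A, B)) 1"
  have a: "a (i * n + l) = A $$ (i, l)" and b: "b (i * n + l) = B $$ (i, l)" if "i < n" "l < n" for i l
    using that table_index_less[OF that] by (auto simp: a_def b_def matmul_input_def)
  define part where "part m s \<longleftrightarrow> nmem s 0 0 = n \<and> rmem s 0 = a \<and> rmem s 1 = b \<and>
    (\<forall>i<n. \<forall>j<n. rmem s 2 (i * n + j) = (\<Sum>l<m i j. a (i * n + l) * b (l * n + j)))" for m and s :: ram_state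
  have frame: "part m (nwrite v 0 x s)" if "part m s" "v \<noteq> 0" for m v x s
    using that by (simp add: part_def)
  let ?m3 = "\<lambda>i j k i' j'. if i' < i \<or> i' = i \<and> j' < j then n else if i' = i \<and> j' = j then k else 0"
  let ?m2 = "\<lambda>i j i' j'. if i' < i \<or> i' = i \<and> j' < j then n else 0"
  let ?m1 = "\<lambda>i i' j'. if i' < i then n else 0"
  define I3 where "I3 i j k s \<longleftrightarrow> part (?m3 i j k) s \<and> nmem s 1 0 = i \<and> nmem s 2 0 = j" for i j k and s :: ram_state
  define I2 where "I2 i j s \<longleftrightarrow> part (?m2 i j) s \<and> nmem s 1 0 = i" for i j and s :: ram_state
  define I1 where "I1 i s \<longleftrightarrow> part (?m1 i) s" for i and s :: ram_state
  have inner: "triple (\<lambda>s. I3 i j k s \<and> nmem s 3 0 = k) school_inner 50 (I3 i j (Suc k))"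
    if "i < n" "j < n" "k < n" for i j k
    unfolding school_inner_def
    by (rule triple_loop_free)
      (use that in \<open>auto simp: I3_def part_def fun_upd_apply table_index_eq_iff[of _ n]\<close>)
  have loop3: "triple (I3 i j 0) (For 3 (Var 0) school_inner) (68 * (n + 1)) (I3 i j n)"
    if "i < n" "j < n" for i j
    by (rule triple_For[where T = 50 and N = n, OF _ _ _ inner[OF that]])
      (auto simp: school_inner_def I3_def frame part_def)
  have step2: "triple (\<lambda>s. I2 i j s \<and> nmem s 2 0 = j) (For 3 (Var 0) school_inner) (68 * (n + 1)) (I2 i (Suc j))"
    if "i < n" "j < n" for i j
    by (rule triple_conseq[OF loop3[OF that]])
      (auto simp: I2_def I3_def part_def less_Suc_eq)
  have loop2: "triple (I2 i 0) (For 2 (Var 0) (For 3 (Var 0) school_inner)) (86 * (n + 1) ^ 2) (I2 i n)"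
    if "i < n" for i
    by (rule triple_For[where T = "68 * (n + 1)" and N = n, OF _ _ _ step2[OF that]])
      (use that in \<open>auto simp: school_inner_def I2_def frame part_def power2_eq_square algebra_simps\<close>)
  have step1: "triple (\<lambda>s. I1 i s \<and> nmem s 1 0 = i) (For 2 (Var 0) (For 3 (Var 0) school_inner))
      (86 * (n + 1) ^ 2) (I1 (Suc i))" if "i < n" for i
    by (rule triple_conseq[OF loop2[OF that]])
      (auto simp: I2_def I1_def part_def less_Suc_eq)
  have loop1: "triple (I1 0) school_matmul (500 * (n + 1) ^ 3) (I1 n)"
    unfolding school_matmul_def
    by (rule triple_For[where T = "86 * (n + 1) ^ 2" and N = n, OF _ _ _ step1])
      (auto simp: school_inner_def I1_def frame part_def power2_eq_square power3_eq_cube algebra_simps)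
  show ?thesis
  proof (rule triple_conseq[OF loop1])
    show "I1 0 s" if "s = matmul_input (n, A, B)" for s
      using that by (simp add: I1_def part_def a_def b_def) (simp add: matmul_input_def)
    show "matmul_output (n, A, B) s" if "I1 n s" for s
    proof -
      have "mat n n (\<lambda>(i, j). rmem s 2 (i * n + j)) = A * B"
        using that AB
        by (intro eq_matI) (auto simp: I1_def part_def a b scalar_prod_def atLeast0LessThan intro!: sum.cong)
      then show ?thesis by (simp add: matmul_output_def)
    qed
  qed simp
qed

lemma polynomial_bigo: "(\<lambda>n. real (K * (n + 1) ^ d)) \<in> O(\<lambda>n. real n powr real d)"
proof (rule bigoI)
  show "\<forall>\<^sub>F n in sequentially. norm (real (K * (n + 1) ^ d)) \<le> real (K * 2 ^ d) * norm (real n powr real d)"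
    using eventually_ge_at_top[of 1]
  proof eventually_elim
    case (elim n)
    have "(n + 1) ^ d \<le> (2 * n) ^ d" using elim by (intro power_mono) auto
    then have "K * (n + 1) ^ d \<le> K * 2 ^ d * n ^ d" by (simp add: power_mult_distrib)
    then have "real (K * (n + 1) ^ d) \<le> real (K * 2 ^ d * n ^ d)" using of_nat_le_iff by blast
    then show ?case using elim by (simp add: powr_realpow)
  qed
qed

lemma matmul_in_time_3: "matmul_in_time 3"
  unfolding matmul_in_time_def solvable_in_time_def
proof (intro exI[of _ school_matmul] exI[of _ "\<lambda>n. 500 * (n + 1) ^ 3"] conjI ballI)
  show "(\<lambda>n. real (500 * (n + 1) ^ 3)) \<in> O(\<lambda>n. real n powr 3)" using polynomial_bigo[of 500 3] by simp
  fix x assume x: "x \<in> matmul_instances"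
  obtain n A B where "x = (n, A, B)" by (cases x)
  then show "\<exists>t s'. exec school_matmul (matmul_input x) t s' \<and> t \<le> 500 * (fst x + 1) ^ 3 \<and> matmul_output x s'"
    using school_matmul_correct[of n A B] x by (auto simp: triple_def)
qed

section \<open>Arrangements of lines\<close>

text \<open>\<open>\<sigma> i j\<close> stands for an increasing function of the slope of the line through the points \<open>i\<close> and \<open>j\<close> of a
  lexicographically sorted sequence. In the dual plane, the slope is the abscissa at which the lines \<open>i\<close> and
  \<open>j\<close> cross, and lines with a larger index are steeper; points with equal abscissas are thought of as
  slightly sheared.\<close>

locale slope_system =
  fixes n :: nat and \<sigma> :: "nat \<Rightarrow> nat \<Rightarrow> real"
  assumes slope_commute: "\<sigma> i j = \<sigma> j i"
    and slope_between: "i < j \<Longrightarrow> j < k \<Longrightarrow> k < n \<Longrightarrow>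
      \<sigma> i j < \<sigma> i k \<and> \<sigma> i k < \<sigma> j k \<or> \<sigma> i j = \<sigma> i k \<and> \<sigma> i k = \<sigma> j k \<or>
      \<sigma> j k < \<sigma> i k \<and> \<sigma> i k < \<sigma> i j"
begin

text \<open>The order of the vertices on line \<open>j\<close>, a vertex being named by the other line through it. The
  numbers \<open>n\<close> and \<open>n + 1\<close> are sentinels for the two infinite ends. Vertices that coincide are ordered by
  index.\<close>

definition prec :: "nat \<Rightarrow> nat \<Rightarrow> nat \<Rightarrow> bool" where
  "prec j x y \<longleftrightarrow> (x = n \<and> y \<noteq> n) \<or> (y = n + 1 \<and> x \<noteq> n + 1) \<or>
    (x < n \<and> y < n \<and> (\<sigma> j x < \<sigma> j y \<or> \<sigma> j x = \<sigma> j y \<and> x < y))"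

lemma prec_irrefl [simp]: "\<not> prec j x x"
  by (auto simp: prec_def)

lemma prec_trans: "prec j x y \<Longrightarrow> prec j y z \<Longrightarrow> prec j x z"
  unfolding prec_def by (elim disjE conjE) simp_all

lemma prec_asym: "prec j x y \<Longrightarrow> \<not> prec j y x"
  using prec_trans prec_irrefl by blast

lemma prec_total: "x \<le> n + 1 \<Longrightarrow> y \<le> n + 1 \<Longrightarrow> x = y \<or> prec j x y \<or> prec j y x"
  by (auto simp: prec_def)

lemma not_prec_start [simp]: "\<not> prec j x n"
  by (auto simp: prec_def)

lemma not_prec_end [simp]: "\<not> prec j (n + 1) x" "\<not> prec j (Suc n) x"
  by (auto simp: prec_def)

lemma prec_start [simp]: "prec j n x \<longleftrightarrow> x \<noteq> n"
  by (auto simp: prec_def)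

lemma prec_end [simp]: "prec j x (n + 1) \<longleftrightarrow> x \<noteq> n + 1" "prec j x (Suc n) \<longleftrightarrow> x \<noteq> Suc n"
  by (auto simp: prec_def)

text \<open>A triple of lines is oriented in one of two ways, and each of its three lines sees which. With ties
  broken by index this stays true for concurrent lines: they behave as a triple of increasing
  slopes.\<close>

lemma prec_flip:
  assumes "x < y" "y < z" "z < n"
  shows "prec x y z \<longleftrightarrow> prec y x z" "prec y x z \<longleftrightarrow> prec z x y"
proof -
  have "prec x y z \<longleftrightarrow> \<sigma> x y \<le> \<sigma> x z" "prec y x z \<longleftrightarrow> \<sigma> x y \<le> \<sigma> y z"
    "prec z x y \<longleftrightarrow> \<sigma> x z \<le> \<sigma> y z"
    using assms slope_commute[of x y] slope_commute[of x z] slope_commute[of y z]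
    by (simp_all add: prec_def le_less)
  then show "prec x y z \<longleftrightarrow> prec y x z" "prec y x z \<longleftrightarrow> prec z x y"
    using slope_between[OF assms] by linarith+
qed

subsection \<open>Linked lists\<close>

definition adjacent :: "nat set \<Rightarrow> nat \<Rightarrow> nat \<Rightarrow> nat \<Rightarrow> bool" where
  "adjacent Q j u w \<longleftrightarrow> u \<in> insert n Q \<and> w \<in> insert (n + 1) Q \<and> prec j u w \<and>
    (\<forall>x\<in>Q. \<not> (prec j u x \<and> prec j x w))"

definition linked :: "nat set \<Rightarrow> nat \<Rightarrow> (nat \<Rightarrow> nat) \<Rightarrow> (nat \<Rightarrow> nat) \<Rightarrow> bool" where
  "linked Q j f g \<longleftrightarrow> (\<forall>u\<in>insert n Q. adjacent Q j u (f u)) \<and>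
    (\<forall>w\<in>insert (n + 1) Q. adjacent Q j (g w) w)"

lemma adjacentD:
  assumes "adjacent Q j u w" "Q \<subseteq> {..<n}" "x \<in> Q"
  shows "x = u \<or> prec j x u \<longleftrightarrow> prec j x w"
proof -
  have "u \<le> n + 1" "w \<le> n + 1" "x \<le> n + 1" "prec j u w" "\<not> (prec j u x \<and> prec j x w)"
    using assms by (auto simp: adjacent_def)
  then show ?thesis using prec_total[of x u j] prec_trans by blast
qed

lemma adjacent_unique:
  assumes "adjacent Q j u w" "Q \<subseteq> {..<n}"
  shows "adjacent Q j u w' \<Longrightarrow> w' = w" "adjacent Q j u' w \<Longrightarrow> u' = u"
proof -
  have ends: "u \<in> insert n Q" "w \<in> insert (n + 1) Q" "prec j u w" using assms(1)
    unfolding adjacent_def by blast+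
  then have b: "u \<le> n + 1" "w \<le> n + 1" using assms(2) by fastforce+
  show "w' = w" if h: "adjacent Q j u w'"
  proof -
    have h': "w' \<in> insert (n + 1) Q" "prec j u w'" using h unfolding adjacent_def by blast+
    then have "w' \<le> n + 1" using assms(2) by fastforce
    moreover have "\<not> prec j w w'" using h ends h'(1) not_prec_end unfolding adjacent_def by blast
    moreover have "\<not> prec j w' w"
      using assms(1) h' not_prec_end unfolding adjacent_def by blast
    ultimately show ?thesis using prec_total[of w w' j] b by blast
  qed
  show "u' = u" if h: "adjacent Q j u' w"
  proof -
    have h': "u' \<in> insert n Q" "prec j u' w" using h unfolding adjacent_def by blast+
    then have "u' \<le> n + 1" using assms(2) by fastforce
    moreover have "\<not> prec j u' u" using h ends h'(1) not_prec_start unfolding adjacent_def by blast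
    moreover have "\<not> prec j u u'"
      using assms(1) h' not_prec_start unfolding adjacent_def by blast
    ultimately show ?thesis using prec_total[of u u' j] b by blast
  qed
qed

lemma linked_empty: "linked {} j (f(n := n + 1)) (g(n + 1 := n))"
  by (auto simp: linked_def adjacent_def)

text \<open>Insertion into a doubly linked list, given as its successor and predecessor functions.\<close>

lemma linked_insert:
  assumes l: "linked Q j f g" and a: "adjacent Q j v c" and x: "x \<notin> Q" "x < n"
    and vx: "prec j v x" and xc: "prec j x c" and Q: "Q \<subseteq> {..<n}"
  shows "linked (insert x Q) j (f(v := x, x := c)) (g(x := v, c := x))"
proof -
  have x': "x \<noteq> n" "x \<noteq> n + 1" using x by auto
  have vc: "v \<noteq> x" "c \<noteq> x" "v \<noteq> c" using vx xc prec_irrefl a by (auto simp: adjacent_def)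
  have between: "\<not> (prec j u x \<and> prec j x w)" if "adjacent Q j u w" "u \<noteq> v" for u w
  proof
    assume h: "prec j u x \<and> prec j x w"
    have "u = v \<or> prec j u v"
      using adjacentD[OF a Q, of u] that(1) h vx prec_trans[of j u x c] xc
      by (auto simp: adjacent_def)
    then have "prec j u v" using that by simp
    have "v \<in> Q" using a \<open>prec j u v\<close> by (auto simp: adjacent_def)
    moreover have "prec j v w" using vx h prec_trans by blast
    ultimately show False using that(1) \<open>prec j u v\<close> by (auto simp: adjacent_def)
  qed
  have av: "adjacent (insert x Q) j v x"
    using a vx xc prec_trans[of j _ x c] by (auto simp: adjacent_def)
  have ac: "adjacent (insert x Q) j x c"
    using a vx xc prec_trans[of j v x] by (auto simp: adjacent_def)
  have old: "adjacent (insert x Q) j u w" if "adjacent Q j u w" "u \<noteq> v" for u w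
    using that between[OF that] by (auto simp: adjacent_def)
  have fu: "adjacent Q j u (f u)" if "u \<in> insert n Q" for u using l that by (auto simp: linked_def)
  have gw: "adjacent Q j (g w) w" if "w \<in> insert (n+1) Q" for w using l that by (auto simp: linked_def)
  have gne: "g w \<noteq> v" if "w \<in> insert (n+1) Q" "w \<noteq> c" for w
    using gw[OF that(1)] adjacent_unique(1)[OF a Q] that by blast
  show ?thesis unfolding linked_def
  proof (intro conjI ballI)
    fix u assume u: "u \<in> insert n (insert x Q)"
    consider "u = x" | "u = v" | "u \<noteq> x" "u \<noteq> v" by blast
    then show "adjacent (insert x Q) j u ((f(v := x, x := c)) u)"
    proof cases
      case 3
      then have "adjacent Q j u (f u)" using u by (intro fu) blast
      then show ?thesis using old 3 by simp
    qed (use av ac vc in simp_all)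
  next
    fix w assume w: "w \<in> insert (n+1) (insert x Q)"
    consider "w = x" | "w = c" | "w \<noteq> x" "w \<noteq> c" by blast
    then show "adjacent (insert x Q) j ((g(x := v, c := x)) w) w"
    proof cases
      case 3
      then have w': "w \<in> insert (n+1) Q" using w by blast
      show ?thesis using old[OF gw[OF w'] gne[OF w' 3(2)]] 3 by simp
    qed (use av ac vc in simp_all)
  qed
qed

end

subsection \<open>The faces met by a new line\<close>

text \<open>The new line \<open>i\<close> is flatter than all lines of \<open>P\<close>. It starts, far to the left, above all of them, and
  crosses each from above to below. The set \<open>C\<close> contains the lines already crossed, so the current face
  of the arrangement of \<open>P\<close> lies below the lines of \<open>C\<close> and above the others.\<close>

locale line_insertion = slope_system +
  fixes i :: nat
  assumes i_less: "i < n"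
begin

abbreviation P :: "nat set" where "P \<equiv> {i<..<n}"

text \<open>An edge on line \<open>a\<close> bounds the current face iff it lies on the same side of every other line as the
  face. Since a steeper line is below \<open>a\<close> before its vertex and above \<open>a\<close> after it, and a flatter line the
  other way round, this says precisely which vertices of \<open>a\<close> lie to the left of the edge.\<close>

definition vertices_left :: "nat set \<Rightarrow> nat \<Rightarrow> nat set" where
  "vertices_left C a = {m \<in> P. m \<noteq> a \<and> (if a < m then m \<in> C else m \<notin> C)}"

definition prefix_to :: "nat \<Rightarrow> nat \<Rightarrow> nat set" where
  "prefix_to a v = {m \<in> P. m \<noteq> a \<and> (m = v \<or> prec a m v)}"

text \<open>The edge of line \<open>a\<close> that starts at the vertex with \<open>v\<close> bounds the current face. The last condition
  says that this vertex lies below the new line.\<close>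

definition on_face :: "nat set \<Rightarrow> nat \<Rightarrow> nat \<Rightarrow> bool" where
  "on_face C a v \<longleftrightarrow> a \<in> P \<and> v \<in> insert n P \<and> v \<noteq> a \<and> vertices_left C a = prefix_to a v \<and> prec a v i"

text \<open>The lines crossed at some moment are an initial segment of the vertices on the new line.\<close>

definition crossed :: "nat set \<Rightarrow> bool" where
  "crossed C \<longleftrightarrow> C \<subseteq> P \<and> (\<forall>x\<in>C. \<forall>y\<in>P. prec i y x \<longrightarrow> y \<in> C)"

lemma prefix_to_start [simp]: "prefix_to a n = {}"
  by (auto simp: prefix_to_def)

lemma on_faceD:
  "on_face C a v \<Longrightarrow> m \<in> P \<Longrightarrow> m \<noteq> a \<Longrightarrow> (if a < m then m \<in> C else m \<notin> C) \<longleftrightarrow> m = v \<or> prec a m v"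
  unfolding on_face_def vertices_left_def prefix_to_def by blast

lemma on_faceI:
  assumes "a \<in> P" "v \<in> insert n P" "v \<noteq> a" "prec a v i"
    "\<And>m. m \<in> P \<Longrightarrow> m \<noteq> a \<Longrightarrow> (if a < m then m \<in> C else m \<notin> C) \<longleftrightarrow> m = v \<or> prec a m v"
  shows "on_face C a v"
  unfolding on_face_def vertices_left_def prefix_to_def using assms by blast

lemma lines_less: "P - A \<subseteq> {..<n}"
  by auto

lemma not_prec_iff: "x < n \<Longrightarrow> y < n \<Longrightarrow> x \<noteq> y \<Longrightarrow> \<not> prec j x y \<longleftrightarrow> prec j y x"
  using prec_total[of x y j] prec_asym by auto

text \<open>The face is convex: where the new line meets an edge of its lower boundary, it leaves the face.
  Uncrossed lines steeper than \<open>a\<close> have their vertices on \<open>a\<close> to the right of the edge, flatter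
  ones to the left, and \<open>prec_flip\<close> carries this over to the order of the crossings.\<close>

lemma next_crossing_first:
  assumes C: "crossed C" and a: "a \<notin> C" and f: "on_face C a v"
    and c: "adjacent (P - {a}) a v c" "prec a i c" and m: "m \<in> P" "m \<notin> C" "m \<noteq> a"
  shows "prec i a m"
proof -
  have ia: "i < a" "a < n" using f by (auto simp: on_face_def)
  consider "a < m" | "m < a" using m by linarith
  then show ?thesis
  proof cases
    case 1
    then have "\<not> (m = v \<or> prec a m v)" using on_faceD[OF f, of m] m by auto
    then have "\<not> prec a m c" using adjacentD[OF c(1) lines_less, of m] m by auto
    moreover have "c \<le> n + 1" using c by (auto simp: adjacent_def)
    ultimately have "m = c \<or> prec a c m" using prec_total[of m c a] m by auto
    then have "prec a i m" using c(2) prec_trans by blast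
    then show ?thesis using prec_flip(1)[of i a m] ia 1 m by auto
  next
    case 2
    then have "m = v \<or> prec a m v" using on_faceD[OF f, of m] m by auto
    then have "prec a m i" using f prec_trans by (auto simp: on_face_def)
    then have "\<not> prec a i m" using prec_asym by blast
    then have "\<not> prec i m a" using prec_flip[of i m a] ia 2 m by auto
    then show ?thesis using not_prec_iff[of m a i] m ia by auto
  qed
qed

lemma crossed_insert:
  assumes C: "crossed C" and a: "a \<notin> C" and f: "on_face C a v"
    and c: "adjacent (P - {a}) a v c" "prec a i c"
  shows "crossed (insert a C)" "on_face (insert a C) a v"
proof -
  have "vertices_left (insert a C) a = vertices_left C a" unfolding vertices_left_def by (rule Collect_cong) auto
  then show "on_face (insert a C) a v" using f unfolding on_face_def by simp
  have "y \<in> insert a C" if "y \<in> P" "prec i y a" for y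
    using next_crossing_first[OF assms that(1)] that(2) prec_asym by blast
  then show "crossed (insert a C)" using C f by (auto simp: crossed_def on_face_def)
qed

lemma crossedD:
  assumes "crossed C" "x \<in> C" "y \<in> P" "y \<notin> C"
  shows "prec i x y"
proof -
  have "x \<in> P" "\<not> prec i y x" using assms by (auto simp: crossed_def)
  then show ?thesis using assms not_prec_iff[of y x i] by auto
qed

text \<open>This lets the walk change from one line to another at their crossing: it translates a position on the
  first line into one on the second. A line whose slope is between those of \<open>a\<close> and \<open>c\<close> passes the crossing on
  opposite sides as seen along \<open>a\<close> and along \<open>c\<close>, any other line on the same side.\<close>

lemma transfer_at_vertex:
  assumes "a < c" "c < n" "m < n" "m \<noteq> a" "m \<noteq> c"
  shows "prec a m c \<longleftrightarrow> (if a < m \<and> m < c then prec c a m else prec c m a)"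
proof -
  consider "m < a" | "a < m \<and> m < c" | "c < m" using assms by linarith
  then show ?thesis
  proof cases
    case 1
    then show ?thesis using prec_flip[of m a c] assms by auto
  next
    case 2
    then show ?thesis using prec_flip[of a m c] not_prec_iff[of m c a] assms by auto
  next
    case 3
    then show ?thesis
      using prec_flip[of a c m] not_prec_iff[of m c a] not_prec_iff[of m a c] assms by auto
  qed
qed

text \<open>If the new line misses the edge on \<open>a\<close>, the lower boundary continues after the next vertex on the line \<open>c\<close>
  through it. This line is steeper than \<open>a\<close>; a flatter one would have been crossed before \<open>a\<close>, and its
  vertex would lie beyond the crossing with the new line.\<close>

lemma step_forward:
  assumes C: "crossed C" and a: "a \<notin> C" and f: "on_face C a v"
    and c: "adjacent (P - {a}) a v c" "\<not> prec a i c"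
  shows "c \<in> P" "c \<notin> C" "a < c" "on_face C c a"
proof -
  have ia: "i < a" "a < n" using f by (auto simp: on_face_def)
  have cend: "c \<noteq> n + 1" using c(2) i_less by auto
  then show cP: "c \<in> P" using c(1) by (auto simp: adjacent_def)
  then have ac: "a \<noteq> c" using c(1) cend by (auto simp: adjacent_def)
  have ci: "prec a c i" using c(2) not_prec_iff[of i c a] cP i_less by auto
  have before_c: "m = v \<or> prec a m v \<longleftrightarrow> prec a m c" if "m \<in> P" "m \<noteq> a" for m
    using adjacentD[OF c(1) lines_less, of m] that by auto
  have "\<not> prec a c c" by simp
  then have c_side: "\<not> (if a < c then c \<in> C else c \<notin> C)"
    using on_faceD[OF f cP] before_c[OF cP] ac by auto
  show "a < c"
  proof (rule ccontr)
    assume "\<not> a < c"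
    then have "c < a" "c \<in> C" using ac c_side by auto
    then have "prec i c a" using crossedD[OF C, of c a] a ia by auto
    then have "prec a i c" using prec_flip[of i c a] \<open>c < a\<close> ia cP by auto
    then show False using c by simp
  qed
  then show "c \<notin> C" using c_side by auto
  show "on_face C c a"
  proof (rule on_faceI)
    have "\<not> prec c i a" using prec_flip[of i a c] \<open>a < c\<close> cP ia ci prec_asym by auto
    then show "prec c a i" using not_prec_iff[of i a c] ia i_less by auto
  next
    fix m assume m: "m \<in> P" "m \<noteq> c"
    show "(if c < m then m \<in> C else m \<notin> C) \<longleftrightarrow> m = a \<or> prec c m a"
    proof (cases "m = a")
      case True
      then show ?thesis using a \<open>a < c\<close> by auto
    next
      case False
      have "(if a < m then m \<in> C else m \<notin> C) \<longleftrightarrow> prec a m c"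
        using on_faceD[OF f m(1) False] before_c[OF m(1) False] by simp
      then show ?thesis
        using transfer_at_vertex[of a c m] \<open>a < c\<close> m False cP not_prec_iff[of m a c] ia
        by (auto split: if_splits)
    qed
  qed (use cP ia \<open>a < c\<close> in auto)
qed

text \<open>After a crossing, the walk goes back along the upper boundary of the new face. A steeper line \<open>w\<close> met
  there is another upper boundary line, and the walk continues on it (\<open>step_left\<close>). A flatter one turns
  the walk into the lower boundary (\<open>step_turn\<close>), and if there is none, the face is unbounded and its lower
  boundary begins with the next line in the order of slopes (\<open>step_infinity\<close>).\<close>

lemma step_left_crossed:
  assumes C: "crossed C" and q: "q \<in> C" and f: "on_face C q w" and qw: "q < w" "w \<noteq> n"
  shows "w \<in> P" "w \<in> C" "prec w q i"
proof -
  have iq: "i < q" "q < n" using f by (auto simp: on_face_def)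
  show wP: "w \<in> P" using f qw by (auto simp: on_face_def)
  show "w \<in> C" using on_faceD[OF f wP] qw by auto
  have "prec q w i" using f by (simp add: on_face_def)
  then have "\<not> prec w i q" using prec_flip[of i q w] qw wP iq prec_asym by auto
  then show wqi: "prec w q i" using not_prec_iff[of i q w] iq i_less by auto
qed

lemma step_left:
  assumes C: "crossed C" and q: "q \<in> C" and f: "on_face C q w" and qw: "q < w" "w \<noteq> n"
    and w': "adjacent (P - {w}) w w' q"
  shows "on_face C w w'"
proof -
  have iq: "i < q" "q < n" using f by (auto simp: on_face_def)
  note wP = step_left_crossed(1)[OF C q f qw] and wqi = step_left_crossed(3)[OF C q f qw]
  show "on_face C w w'"
  proof (rule on_faceI)
    show "prec w w' i" using w' wqi prec_trans by (auto simp: adjacent_def)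
  next
    fix m assume m: "m \<in> P" "m \<noteq> w"
    have *: "m = w' \<or> prec w m w' \<longleftrightarrow> prec w m q" using adjacentD[OF w' lines_less, of m] m by auto
    show "(if w < m then m \<in> C else m \<notin> C) \<longleftrightarrow> m = w' \<or> prec w m w'"
    proof (cases "m = q")
      case True
      then show ?thesis using q qw * by auto
    next
      case False
      have "(if q < m then m \<in> C else m \<notin> C) \<longleftrightarrow> prec q m w"
        using on_faceD[OF f m(1) False] m by simp
      then show ?thesis unfolding *
        using transfer_at_vertex[of q w m] qw m False wP not_prec_iff[of m q w] iq
        by (auto split: if_splits)
    qed
  qed (use w' wP in \<open>auto simp: adjacent_def\<close>)
qed

lemma step_turn:
  assumes C: "crossed C" and q: "q \<in> C" and f: "on_face C q w" and wq: "w < q"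
  shows "w \<notin> C" "on_face C w q" "w \<in> P"
proof -
  have iq: "i < q" "q < n" using f by (auto simp: on_face_def)
  show wP: "w \<in> P" using f wq iq by (auto simp: on_face_def)
  show wC: "w \<notin> C" using on_faceD[OF f wP] wq by auto
  show "on_face C w q"
  proof (rule on_faceI)
    have "prec i q w" using crossedD[OF C q wP wC] .
    then have "\<not> prec i w q" using prec_asym by blast
    then have "\<not> prec w i q" using prec_flip[of i w q] wq wP iq by auto
    then show "prec w q i" using not_prec_iff[of i q w] iq i_less by auto
  next
    fix m assume m: "m \<in> P" "m \<noteq> w"
    show "(if w < m then m \<in> C else m \<notin> C) \<longleftrightarrow> m = q \<or> prec w m q"
    proof (cases "m = q")
      case True
      then show ?thesis using q wq by auto
    next
      case False
      have "(if q < m then m \<in> C else m \<notin> C) \<longleftrightarrow> prec q m w"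
        using on_faceD[OF f m(1) False] m by simp
      then show ?thesis
        using transfer_at_vertex[of w q m] wq m False wP not_prec_iff[of m w q] iq
        by (auto split: if_splits)
    qed
  qed (use wP iq wq in auto)
qed

lemma step_infinity:
  assumes C: "crossed C" and q: "q \<in> C" and f: "on_face C q n" and ne: "C \<noteq> P"
  shows "q + 1 \<notin> C" "on_face C (q + 1) n" "q + 1 \<in> P"
proof -
  have iq: "i < q" "q < n" using f by (auto simp: on_face_def)
  have side: "\<not> (if q < m then m \<in> C else m \<notin> C)" if "m \<in> P" "m \<noteq> q" for m
    using on_faceD[OF f that] that by auto
  have Ceq: "C = {i<..q}"
  proof
    show "C \<subseteq> {i<..q}"
    proof
      fix m assume "m \<in> C"
      moreover then have "m \<in> P" using C by (auto simp: crossed_def)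
      ultimately show "m \<in> {i<..q}" using side[of m] by (cases "m = q") (auto split: if_splits)
    qed
    show "{i<..q} \<subseteq> C"
    proof
      fix m assume "m \<in> {i<..q}"
      then show "m \<in> C" using side[of m] q iq by (cases "m = q") (auto split: if_splits)
    qed
  qed
  have "q + 1 < n"
  proof (rule ccontr)
    assume "\<not> q + 1 < n"
    then have "C = P" using Ceq iq by auto
    then show False using ne by simp
  qed
  then show "q + 1 \<in> P" "q + 1 \<notin> C" using Ceq iq by auto
  then show "on_face C (q + 1) n"
    using Ceq i_less by (intro on_faceI) (auto split: if_splits)
qed

lemma start_on_face:
  assumes "i + 1 < n"
  shows "on_face {} (i + 1) n"
  using assms i_less by (intro on_faceI) auto

subsection \<open>Amortisation\<close>

text \<open>A forward event is the passage of the walk to line \<open>c\<close> along the lower boundary, a left event its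
  passage from line \<open>q\<close> to a steeper line along the upper boundary, when \<open>C\<close> has been crossed.\<close>

definition forward_event :: "nat set \<Rightarrow> nat \<Rightarrow> bool" where
  "forward_event C c \<longleftrightarrow> crossed C \<and> c \<notin> C \<and> (\<exists>a\<in>P. a < c \<and> a \<notin> C \<and> on_face C c a)"

definition left_event :: "nat set \<Rightarrow> nat \<Rightarrow> bool" where
  "left_event C q \<longleftrightarrow> crossed C \<and> q \<in> C \<and> (\<exists>w\<in>P. q < w \<and> on_face C q w)"

text \<open>The position of an edge on its line and the side of the line determine the face.\<close>

lemma vertices_left_determines:
  assumes "crossed C1" "crossed C2" "vertices_left C1 a = vertices_left C2 a" "a \<in> C1 \<longleftrightarrow> a \<in> C2"
  shows "C1 = C2"
proof -
  have "m \<in> C1 \<longleftrightarrow> m \<in> C2" if "m \<in> P" for m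
  proof (cases "m = a")
    case False
    have "m \<in> vertices_left C1 a \<longleftrightarrow> m \<in> vertices_left C2 a" using assms(3) by simp
    then show ?thesis unfolding vertices_left_def using that False by (cases "a < m") simp_all
  next
    case True
    show ?thesis unfolding True by (rule assms(4))
  qed
  then show ?thesis using assms(1,2) unfolding crossed_def by blast
qed

text \<open>The vertex of \<open>c\<close> with the flatter line \<open>a\<close> lies below the new line, so \<open>a\<close> is crossed after \<open>c\<close>. Hence
  all such lines are uncrossed whenever a forward event of \<open>c\<close> takes place, and \<open>a\<close> is the last of them
  on \<open>c\<close>, independently of the time.\<close>

lemma forward_event_unique:
  assumes "forward_event C1 c" "forward_event C2 c"
  shows "C1 = C2"
proof -
  from assms(1) obtain a1 where 1: "crossed C1" "c \<notin> C1" "a1 \<in> P" "a1 < c" "a1 \<notin> C1" "on_face C1 c a1"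
    by (auto simp: forward_event_def)
  from assms(2) obtain a2 where 2: "crossed C2" "c \<notin> C2" "a2 \<in> P" "a2 < c" "a2 \<notin> C2" "on_face C2 c a2"
    by (auto simp: forward_event_def)
  have cP: "c \<in> P" using 1 by (auto simp: on_face_def)
  have late: "a \<notin> D" if "a \<in> P" "a < c" "on_face C c a" "crossed D" "c \<notin> D" for a C D
  proof
    assume "a \<in> D"
    have "prec c a i" using that by (simp add: on_face_def)
    then have "\<not> prec i a c" using prec_flip[of i a c] that cP prec_asym by auto
    then have "prec i c a" using not_prec_iff[of a c i] that cP by auto
    then show False using that \<open>a \<in> D\<close> cP by (auto simp: crossed_def)
  qed
  have "a1 = a2 \<or> prec c a1 a2"
    using on_faceD[OF 2(6), of a1] 1 late[OF 1(3,4,6) 2(1,2)] by auto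
  moreover have "a2 = a1 \<or> prec c a2 a1"
    using on_faceD[OF 1(6), of a2] 2 late[OF 2(3,4,6) 1(1,2)] by auto
  ultimately have "a1 = a2" using prec_asym by blast
  then have "vertices_left C1 c = vertices_left C2 c" using 1(6) 2(6) by (simp add: on_face_def)
  then show ?thesis using vertices_left_determines 1 2 by blast
qed

text \<open>Symmetrically, a steeper line whose vertex with \<open>q\<close> lies below the new line is crossed before \<open>q\<close>, and \<open>w\<close>
  is the last of them on \<open>q\<close>.\<close>

lemma left_event_unique:
  assumes "left_event C1 q" "left_event C2 q"
  shows "C1 = C2"
proof -
  from assms(1) obtain w1 where 1: "crossed C1" "q \<in> C1" "w1 \<in> P" "q < w1" "on_face C1 q w1"
    by (auto simp: left_event_def)
  from assms(2) obtain w2 where 2: "crossed C2" "q \<in> C2" "w2 \<in> P" "q < w2" "on_face C2 q w2"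
    by (auto simp: left_event_def)
  have qP: "q \<in> P" using 1 by (auto simp: on_face_def)
  have early: "w \<in> D" if "w \<in> P" "q < w" "on_face C q w" "crossed D" "q \<in> D" for w C D
  proof -
    have "prec q w i" using that by (simp add: on_face_def)
    then have "\<not> prec i q w" using prec_flip[of i q w] that qP prec_asym by auto
    then have "prec i w q" using not_prec_iff[of q w i] that qP by auto
    then show ?thesis using that qP by (auto simp: crossed_def)
  qed
  have "w1 = w2 \<or> prec q w1 w2"
    using on_faceD[OF 2(5), of w1] 1 early[OF 1(3,4,5) 2(1,2)] by auto
  moreover have "w2 = w1 \<or> prec q w2 w1"
    using on_faceD[OF 1(5), of w2] 2 early[OF 2(3,4,5) 1(1,2)] by auto
  ultimately have "w1 = w2" using prec_asym by blast
  then have "vertices_left C1 q = vertices_left C2 q" using 1(5) 2(5) by (simp add: on_face_def)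
  then show ?thesis using vertices_left_determines 1 2 by blast
qed

text \<open>The lines for which an event may still happen: it belongs to a later face, or to the current face and
  a line that the walk has not passed yet. Indices increase along both kinds of steps within a face.\<close>

definition forward_left :: "nat set \<Rightarrow> nat \<Rightarrow> nat set" where
  "forward_left C a = {c\<in>P. \<exists>D. forward_event D c \<and> (C \<subset> D \<or> C = D \<and> a < c)}"

definition left_left :: "nat set \<Rightarrow> nat \<Rightarrow> nat set" where
  "left_left C a = {q\<in>P. \<exists>D. left_event D q \<and> (C \<subset> D \<or> C = D \<and> a \<le> q)}"

text \<open>Mode 1 is the walk back along the upper boundary, mode 0 the following walk along the lower boundary
  of the same face. In place of a line, \<open>0\<close> means that the second walk has not begun and \<open>n\<close> that the first
  is over. The factor 2 pays for the change of mode at each crossing.\<close>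

definition potential :: "nat set \<Rightarrow> nat \<Rightarrow> nat \<Rightarrow> nat" where
  "potential C mode a = 2 * card (P - C) + mode +
    (if mode = 0 then card (forward_left C a) + card (left_left C n)
     else card (forward_left C 0) + card (left_left C a))"

lemma finite_left [simp]: "finite (forward_left C a)" "finite (left_left C a)"
  by (auto simp: forward_left_def left_left_def)

lemma potential_le: "mode \<le> 1 \<Longrightarrow> potential C mode a \<le> 4 * n + 1"
proof -
  assume "mode \<le> 1"
  have *: "card X \<le> n" if "X \<subseteq> P" for X
    using card_mono[OF _ that] by simp
  have "card (P - C) \<le> n" "card (forward_left C a) \<le> n" "card (left_left C a) \<le> n" for C a
    by (rule *; auto simp: forward_left_def left_left_def)+
  from this(1)[of C] this(2)[of C a] this(2)[of C 0] this(3)[of C a] this(3)[of C n]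
  show ?thesis using \<open>mode \<le> 1\<close> by (auto simp: potential_def)
qed

lemma potential_cross:
  assumes "a \<in> P" "a \<notin> C"
  shows "potential (insert a C) 1 b < potential C 0 d"
proof -
  have "card (P - C) = Suc (card (P - insert a C))"
    using assms by (subst card.remove[of _ a]) (auto simp: Diff_insert2[symmetric] insert_Diff_if intro!: arg_cong[of _ _ card])
  moreover have "card (forward_left (insert a C) 0) \<le> card (forward_left C d)"
    using assms by (intro card_mono) (auto simp: forward_left_def)
  moreover have "card (left_left (insert a C) b) \<le> card (left_left C n)"
    using assms by (intro card_mono) (auto simp: left_left_def)
  ultimately show ?thesis by (simp add: potential_def)
qed

lemma potential_forward:
  assumes "forward_event C c" "a < c" "c \<in> P"
  shows "potential C 0 c < potential C 0 a"
proof -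
  have "c \<in> forward_left C a" using assms by (auto simp: forward_left_def)
  moreover have "c \<notin> forward_left C c"
    using forward_event_unique[OF assms(1)] by (auto simp: forward_left_def)
  moreover have "forward_left C c \<subseteq> forward_left C a" using assms by (auto simp: forward_left_def)
  ultimately have "forward_left C c \<subset> forward_left C a" by blast
  then have "card (forward_left C c) < card (forward_left C a)" by (intro psubset_card_mono) auto
  then show ?thesis by (simp add: potential_def)
qed

lemma potential_left:
  assumes "left_event C q" "q < w" "q \<in> P"
  shows "potential C 1 w < potential C 1 q"
proof -
  have "q \<in> left_left C q" using assms by (auto simp: left_left_def)
  moreover have "q \<notin> left_left C w"
    using left_event_unique[OF assms(1)] assms(2) by (auto simp: left_left_def)
  moreover have "left_left C w \<subseteq> left_left C q" using assms by (auto simp: left_left_def)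
  ultimately have "left_left C w \<subset> left_left C q" by blast
  then have "card (left_left C w) < card (left_left C q)" by (intro psubset_card_mono) auto
  then show ?thesis by (simp add: potential_def)
qed

lemma potential_turn: "potential C 0 b < potential C 1 a"
proof -
  have "card (forward_left C b) \<le> card (forward_left C 0)"
    by (intro card_mono) (auto simp: forward_left_def)
  moreover have "card (left_left C n) \<le> card (left_left C a)"
    by (intro card_mono) (auto simp: left_left_def)
  ultimately show ?thesis by (simp add: potential_def)
qed

subsection \<open>The walk along the new line\<close>

text \<open>The list of the new line is completed only at the end; until then it is correct when closed
  off after its last entry.\<close>

definition walk_inv ::
  "nat set \<Rightarrow> nat \<Rightarrow> nat \<Rightarrow> nat \<Rightarrow> nat \<Rightarrow> (nat \<Rightarrow> nat \<Rightarrow> nat) \<Rightarrow> (nat \<Rightarrow> nat \<Rightarrow> nat) \<Rightarrow> bool" where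
  "walk_inv C mode a v l nx pv \<longleftrightarrow> crossed C \<and> mode \<le> 1 \<and>
    (C \<noteq> P \<longrightarrow> on_face C a v \<and> (if mode = 0 then a \<notin> C else a \<in> C)) \<and>
    l \<in> insert n C \<and> linked C i ((nx i)(l := n + 1)) ((pv i)(n + 1 := l)) \<and>
    (\<forall>j\<in>P. linked (if j \<in> C then insert i (P - {j}) else P - {j}) j (nx j) (pv j))"

lemma walk_start:
  assumes "\<And>j. j \<in> P \<Longrightarrow> linked (P - {j}) j (nx j) (pv j)"
  shows "walk_inv {} 0 (i + 1) n n nx pv"
  unfolding walk_inv_def
  using assms start_on_face linked_empty[of i "nx i" "pv i"] i_less by (auto simp: crossed_def)

lemma walk_end:
  assumes "walk_inv P mode a v l nx pv"
  defines "nx' \<equiv> nx(i := (nx i)(l := n + 1))" and "pv' \<equiv> pv(i := (pv i)(n + 1 := l))"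
  assumes j: "j \<in> {i..<n}"
  shows "linked ({i..<n} - {j}) j (nx' j) (pv' j)"
proof (cases "j = i")
  case True
  then have "{i..<n} - {j} = P" using j by auto
  then show ?thesis using assms True by (simp add: walk_inv_def)
next
  case False
  then have "{i..<n} - {j} = insert i (P - {j})" "j \<in> P" using j by auto
  then show ?thesis using assms False by (simp add: walk_inv_def)
qed

lemma walk_faceD:
  assumes "walk_inv C mode a v l nx pv" "C \<noteq> P"
  shows "a \<in> P" "v \<in> insert n P" "v \<noteq> a" "l \<in> insert n C" "mode = 0 \<or> mode = 1"
    "on_face C a v" "mode = 0 \<Longrightarrow> a \<notin> C" "mode = 1 \<Longrightarrow> a \<in> C" "crossed C"
  using assms by (auto simp: walk_inv_def on_face_def split: if_splits)

lemma walk_listD: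
  "walk_inv C mode a v l nx pv \<Longrightarrow> j \<in> P \<Longrightarrow> linked (if j \<in> C then insert i (P - {j}) else P - {j}) j (nx j) (pv j)"
  unfolding walk_inv_def by blast

lemma walk_next:
  assumes "walk_inv C 0 a v l nx pv" "C \<noteq> P"
  shows "adjacent (P - {a}) a v (nx a v)"
proof -
  note w = walk_faceD[OF assms]
  have "linked (P - {a}) a (nx a) (pv a)" using walk_listD[OF assms(1) w(1)] w(7) by simp
  moreover have "v \<in> insert n (P - {a})" using w by auto
  ultimately show ?thesis by (auto simp: linked_def)
qed

lemma crossing_test:
  assumes "c \<in> insert (n + 1) P"
  shows "prec a i c \<longleftrightarrow> c = n + 1 \<or> \<sigma> a i \<le> \<sigma> a c"
  using assms i_less by (auto simp: prec_def)

lemma walk_cross: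
  assumes w: "walk_inv C 0 a v l nx pv" "C \<noteq> P" and c: "c = nx a v" "prec a i c"
  shows "walk_inv (insert a C) 1 a v a (nx(a := (nx a)(v := i, i := c), i := (nx i)(l := a)))
      (pv(a := (pv a)(i := v, c := i), i := (pv i)(a := l)))"
    and "card (insert a C) = card C + 1"
    and "potential (insert a C) 1 a < potential C 0 a"
proof -
  note f = walk_faceD[OF w]
  have adj: "adjacent (P - {a}) a v c" using walk_next[OF w] c by simp
  have aC: "a \<notin> C" using f by simp
  have fin: "finite C" using f(9) finite_subset[of C P] by (auto simp: crossed_def)
  show "card (insert a C) = card C + 1" using aC fin by simp
  show "potential (insert a C) 1 a < potential C 0 a" by (rule potential_cross[OF f(1) aC])
  have CP: "C \<subseteq> P" using f(9) by (auto simp: crossed_def)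
  have ia: "i \<noteq> a" using f(1) by auto
  have li: "linked C i ((nx i)(l := n + 1)) ((pv i)(n + 1 := l))" using w by (simp add: walk_inv_def)
  have "adjacent C i l (((nx i)(l := n + 1)) l)" using li f(4) unfolding linked_def by blast
  then have adjl: "adjacent C i l (n + 1)" by simp
  have "l = n \<or> prec i l a" using f(4) crossedD[OF f(9) _ f(1) aC] by auto
  then have la: "prec i l a" using f(1) by auto
  have "linked (insert a C) i (((nx i)(l := n + 1))(l := a, a := n + 1)) (((pv i)(n + 1 := l))(a := l, n + 1 := a))"
    by (rule linked_insert[OF li adjl aC _ la]) (use f(1) CP in auto)
  then have new: "linked (insert a C) i (((nx i)(l := a))(a := n + 1)) (((pv i)(a := l))(n + 1 := a))"
    using f(1) by (simp add: fun_upd_twist)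
  have la_old: "linked (P - {a}) a (nx a) (pv a)" using walk_listD[OF w(1) f(1)] aC by simp
  have "prec a v i" using f(6) by (simp add: on_face_def)
  then have "linked (insert i (P - {a})) a ((nx a)(v := i, i := c)) ((pv a)(i := v, c := i))"
    by (intro linked_insert[OF la_old adj _ i_less _ c(2)]) auto
  then have old: "linked (if j \<in> insert a C then insert i (P - {j}) else P - {j}) j
      ((nx(a := (nx a)(v := i, i := c), i := (nx i)(l := a))) j)
      ((pv(a := (pv a)(i := v, c := i), i := (pv i)(a := l))) j)" if "j \<in> P" for j
    using w(1) that by (auto simp: walk_inv_def)
  show "walk_inv (insert a C) 1 a v a (nx(a := (nx a)(v := i, i := c), i := (nx i)(l := a)))
      (pv(a := (pv a)(i := v, c := i), i := (pv i)(a := l)))"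
    unfolding walk_inv_def
    using crossed_insert[OF f(9) aC f(6) adj c(2)] new old by simp
qed

lemma walk_forward:
  assumes w: "walk_inv C 0 a v l nx pv" "C \<noteq> P" and c: "c = nx a v" "\<not> prec a i c"
  shows "walk_inv C 0 c a l nx pv" "potential C 0 c < potential C 0 a"
proof -
  note f = walk_faceD[OF w]
  have adj: "adjacent (P - {a}) a v c" using walk_next[OF w] c by simp
  have aC: "a \<notin> C" using f by simp
  note step = step_forward[OF f(9) aC f(6) adj c(2)]
  show "walk_inv C 0 c a l nx pv" using w step by (simp add: walk_inv_def)
  have "forward_event C c" using f step aC by (auto simp: forward_event_def)
  then show "potential C 0 c < potential C 0 a" using step by (intro potential_forward)
qed

lemma walk_infinity:
  assumes w: "walk_inv C 1 a n l nx pv" "C \<noteq> P"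
  shows "walk_inv C 0 (a + 1) n l nx pv" "potential C 0 b < potential C 1 a"
proof -
  note f = walk_faceD[OF w]
  show "walk_inv C 0 (a + 1) n l nx pv"
    using w step_infinity[OF f(9) f(8)[OF refl] f(6) w(2)] by (simp add: walk_inv_def)
qed (rule potential_turn)

lemma walk_left:
  assumes w: "walk_inv C 1 a v l nx pv" "C \<noteq> P" and av: "a < v" "v \<noteq> n"
  shows "walk_inv C 1 v (pv v a) l nx pv" "potential C 1 v < potential C 1 a"
proof -
  note f = walk_faceD[OF w]
  have aC: "a \<in> C" using f by simp
  note s = step_left_crossed[OF f(9) aC f(6) av]
  have "linked (insert i (P - {v})) v (nx v) (pv v)"
    using walk_listD[OF w(1) s(1)] s(2) by simp
  moreover have "a \<in> insert (n + 1) (insert i (P - {v}))" using f(1,3) by auto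
  ultimately have adj: "adjacent (insert i (P - {v})) v (pv v a) a" unfolding linked_def by blast
  then have "pv v a \<noteq> i" using s(3) prec_asym by (auto simp: adjacent_def)
  then have "adjacent (P - {v}) v (pv v a) a" using adj f(1,3) by (auto simp: adjacent_def)
  from step_left[OF f(9) aC f(6) av this]
  show "walk_inv C 1 v (pv v a) l nx pv" using w s by (simp add: walk_inv_def)
  have "left_event C a" using f s aC av by (auto simp: left_event_def)
  then show "potential C 1 v < potential C 1 a" using av f(1) by (intro potential_left)
qed

lemma walk_turn:
  assumes w: "walk_inv C 1 a v l nx pv" "C \<noteq> P" and va: "v < a"
  shows "walk_inv C 0 v a l nx pv" "potential C 0 b < potential C 1 a"
proof -
  note f = walk_faceD[OF w]
  show "walk_inv C 0 v a l nx pv"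
    using w step_turn[OF f(9) f(8)[OF refl] f(6) va] by (simp add: walk_inv_def)
qed (rule potential_turn)

end

section \<open>Slopes, lines and triangles of points\<close>

definition lex_less :: "point \<Rightarrow> point \<Rightarrow> bool" where
  "lex_less p q \<longleftrightarrow> fst p < fst q \<or> fst p = fst q \<and> snd p < snd q"

text \<open>For a lexicographically positive vector \<open>(x, y)\<close>, the quotient \<open>y / (x + |y|)\<close> is a strictly increasing
  function of the slope, with the value 1 for vertical vectors.\<close>

definition slope_key :: "point \<Rightarrow> point \<Rightarrow> real" where
  "slope_key p q = (snd q - snd p) / (fst q - fst p + \<bar>snd q - snd p\<bar>)"

definition cross :: "point \<Rightarrow> point \<Rightarrow> real" where
  "cross d e = fst d * snd e - snd d * fst e"

lemma slope_fraction_less_iff: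
  fixes a b c d :: real
  assumes "0 < a \<or> a = 0 \<and> 0 < b" "0 < c \<or> c = 0 \<and> 0 < d"
  shows "b / (a + \<bar>b\<bar>) < d / (c + \<bar>d\<bar>) \<longleftrightarrow> 0 < a * d - b * c"
proof -
  have pos: "0 < a + \<bar>b\<bar>" "0 < c + \<bar>d\<bar>" using assms by auto
  have "b / (a + \<bar>b\<bar>) < d / (c + \<bar>d\<bar>) \<longleftrightarrow> b * (c + \<bar>d\<bar>) < d * (a + \<bar>b\<bar>)"
    using pos by (simp add: divide_less_eq less_divide_eq field_simps)
  also have "\<dots> \<longleftrightarrow> 0 < a * d - b * c"
  proof -
    consider "0 \<le> b" "0 \<le> d" | "b \<le> 0" "d \<le> 0" | "0 < b" "d < 0" | "b < 0" "0 < d" by linarith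
    then show ?thesis
    proof cases
      case 1
      then show ?thesis by (simp add: algebra_simps)
    next
      case 2
      then show ?thesis by (simp add: algebra_simps)
    next
      case 3
      have "0 \<le> b * c" "a * d \<le> 0" "b * d < 0" using 3 assms
        by (auto simp: mult_nonneg_nonpos mult_pos_neg)
      then show ?thesis using 3 by (simp add: algebra_simps)
    next
      case 4
      have "b * c \<le> 0" "0 < a * d" "b * d < 0" using 4 assms
        by (auto simp: mult_nonpos_nonneg mult_neg_pos)
      then show ?thesis using 4 by (simp add: algebra_simps)
    qed
  qed
  finally show ?thesis .
qed

lemma slope_key_less_iff:
  "lex_less p q \<Longrightarrow> lex_less r s \<Longrightarrow> slope_key p q < slope_key r s \<longleftrightarrow> 0 < cross (q - p) (s - r)"
  unfolding slope_key_def cross_def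
  by (subst slope_fraction_less_iff) (auto simp: lex_less_def)

lemma cross_swap: "cross e d = - cross d e"
  by (simp add: cross_def)

lemma slope_key_eq_iff:
  assumes "lex_less p q" "lex_less r s"
  shows "slope_key p q = slope_key r s \<longleftrightarrow> cross (q - p) (s - r) = 0"
  using slope_key_less_iff[OF assms] slope_key_less_iff[OF assms(2,1)] cross_swap[of "s - r" "q - p"]
  by linarith

lemma in_line_iff_cross:
  fixes a b x :: point
  assumes "a \<noteq> b"
  shows "x \<in> affine hull {a, b} \<longleftrightarrow> cross (b - a) (x - a) = 0"
proof
  assume "x \<in> affine hull {a, b}"
  then obtain t where "x = a + t *\<^sub>R (b - a)" by (auto simp: affine_hull_2_alt)
  then show "cross (b - a) (x - a) = 0" by (simp add: cross_def)
next
  assume c: "cross (b - a) (x - a) = 0"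
  define d where "d = b - a"
  have d: "fst d \<noteq> 0 \<or> snd d \<noteq> 0" using assms by (auto simp: d_def prod_eq_iff)
  have eq: "fst d * snd (x - a) = snd d * fst (x - a)" using c by (simp add: cross_def d_def)
  define t where "t = (if fst d \<noteq> 0 then fst (x - a) / fst d else snd (x - a) / snd d)"
  have "x - a = t *\<^sub>R d"
    using d eq by (auto simp: t_def prod_eq_iff field_simps)
  then have "x = a + t *\<^sub>R (b - a)" by (simp add: d_def algebra_simps)
  then show "x \<in> affine hull {a, b}" by (auto simp: affine_hull_2_alt)
qed

lemma ordinary_line_iff:
  assumes "p \<in> X" "q \<in> X" "p \<noteq> q"
  shows "ordinary_line X \<tau> (affine hull {p, q}) \<longleftrightarrow> card (X \<inter> affine hull {p, q}) \<le> \<tau>"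
proof -
  have "spanned_line X (affine hull {p, q})"
    using assms hull_inc[of p "{p, q}"] hull_inc[of q "{p, q}"]
    by (auto simp: spanned_line_def aff_dim_2)
  then show ?thesis by (simp add: ordinary_line_def)
qed

text \<open>Each set of three elements has six orderings.\<close>

lemma card_ordered_triples:
  assumes "finite F" "\<And>T. T \<in> F \<Longrightarrow> card T = 3"
  shows "card {(x, y, z). x \<noteq> y \<and> x \<noteq> z \<and> y \<noteq> z \<and> {x, y, z} \<in> F} = 6 * card F"
proof -
  define O3 where "O3 T = {(x, y, z). x \<noteq> y \<and> x \<noteq> z \<and> y \<noteq> z \<and> {x, y, z} = T}" for T :: "'a set"
  have O3: "finite (O3 T) \<and> card (O3 T) = 6" if T: "T \<in> F" for T
  proof -
    obtain a b c where abc: "T = {a, b, c}" "a \<noteq> b" "a \<noteq> c" "b \<noteq> c"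
      using assms(2)[OF T] by (auto simp: card_3_iff)
    have "O3 T = {(a, b, c), (a, c, b), (b, a, c), (b, c, a), (c, a, b), (c, b, a)}"
    proof
      show "O3 T \<subseteq> {(a, b, c), (a, c, b), (b, a, c), (b, c, a), (c, a, b), (c, b, a)}"
      proof
        fix p assume p: "p \<in> O3 T"
        then obtain x y z where xyz: "p = (x, y, z)" "x \<noteq> y" "x \<noteq> z" "y \<noteq> z" "{x, y, z} = T"
          by (auto simp: O3_def)
        then have "x \<in> {a, b, c}" "y \<in> {a, b, c}" "z \<in> {a, b, c}" using abc by auto
        then show "p \<in> {(a, b, c), (a, c, b), (b, a, c), (b, c, a), (c, a, b), (c, b, a)}"
          using xyz by auto
      qed
    qed (use abc in \<open>auto simp: O3_def\<close>)
    then show ?thesis using abc by simp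
  qed
  have "{(x, y, z). x \<noteq> y \<and> x \<noteq> z \<and> y \<noteq> z \<and> {x, y, z} \<in> F} = (\<Union>T\<in>F. O3 T)"
    by (auto simp: O3_def)
  also have "card \<dots> = (\<Sum>T\<in>F. card (O3 T))"
    by (rule card_UN_disjoint) (use assms(1) O3 in \<open>auto simp: O3_def\<close>)
  also have "\<dots> = 6 * card F" using O3 by simp
  finally show ?thesis .
qed

context slope_system
begin

definition same_line :: "nat \<Rightarrow> nat \<Rightarrow> nat set" where
  "same_line i j = {m. m < n \<and> m \<noteq> i \<and> \<sigma> i m = \<sigma> i j}"

definition degree :: "nat \<Rightarrow> nat \<Rightarrow> nat" where
  "degree i j = card (same_line i j) + 1"

definition ordinary_pair :: "nat \<Rightarrow> nat \<Rightarrow> nat \<Rightarrow> bool" where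
  "ordinary_pair \<tau> i j \<longleftrightarrow> i \<noteq> j \<and> degree i j \<le> \<tau>"

definition triangle_indices :: "nat \<Rightarrow> nat \<Rightarrow> nat \<Rightarrow> nat \<Rightarrow> bool" where
  "triangle_indices \<tau> i j k \<longleftrightarrow> ordinary_pair \<tau> i j \<and> ordinary_pair \<tau> i k \<and> ordinary_pair \<tau> j k \<and>
    \<sigma> i k \<noteq> \<sigma> i j"

end

locale sorted_points =
  fixes n :: nat and q :: "nat \<Rightarrow> point"
  assumes sorted: "i < j \<Longrightarrow> j < n \<Longrightarrow> lex_less (q i) (q j)"
begin

definition slope :: "nat \<Rightarrow> nat \<Rightarrow> real" where
  "slope i j = (if i \<le> j then slope_key (q i) (q j) else slope_key (q j) (q i))"

sublocale slope_system n slope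
proof
  show "slope i j = slope j i" for i j by (simp add: slope_def)
  fix i j k assume ijk: "i < j" "j < k" "k < n"
  define d where "d = q j - q i"
  define e where "e = q k - q j"
  have de: "q k - q i = d + e" by (simp add: d_def e_def)
  have "cross d (d + e) = cross d e" "cross (d + e) e = cross d e"
    "cross (d + e) d = - cross d e" "cross e (d + e) = - cross d e"
    by (simp_all add: cross_def algebra_simps)
  then have "slope_key (q i) (q j) < slope_key (q i) (q k) \<longleftrightarrow> 0 < cross d e"
      "slope_key (q i) (q k) < slope_key (q j) (q k) \<longleftrightarrow> 0 < cross d e"
      "slope_key (q i) (q k) < slope_key (q i) (q j) \<longleftrightarrow> cross d e < 0"
      "slope_key (q j) (q k) < slope_key (q i) (q k) \<longleftrightarrow> cross d e < 0"
    using slope_key_less_iff sorted ijk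
    by (simp_all add: d_def[symmetric] e_def[symmetric] de)
  then show "slope i j < slope i k \<and> slope i k < slope j k \<or> slope i j = slope i k \<and> slope i k = slope j k \<or>
      slope j k < slope i k \<and> slope i k < slope i j"
    using ijk unfolding slope_def by auto
qed

definition points :: "point set" where
  "points = q ` {..<n}"

lemma q_eq_iff: "i < n \<Longrightarrow> j < n \<Longrightarrow> q i = q j \<longleftrightarrow> i = j"
  using sorted[of i j] sorted[of j i] by (cases i j rule: linorder_cases) (auto simp: lex_less_def)

lemma q_inj: "inj_on q {..<n}"
  by (auto simp: inj_on_def q_eq_iff)

lemma slope_eq_iff:
  assumes "i < n" "j < n" "m < n" "i \<noteq> j" "i \<noteq> m"
  shows "slope i m = slope i j \<longleftrightarrow> q m \<in> affine hull {q i, q j}"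
proof -
  have flip: "cross (a - b) d = - cross (b - a) d" "cross d (a - b) = - cross d (b - a)" for a b d
    by (simp_all add: cross_def algebra_simps)
  have "slope i m = slope i j \<longleftrightarrow> cross (q j - q i) (q m - q i) = 0"
    using assms sorted[of i m] sorted[of m i] sorted[of i j] sorted[of j i] cross_swap[of "q m - q i" "q j - q i"]
      flip(1)[of "q i" "q j"] flip(2)[of _ "q i" "q m"] flip(1)[of "q i" "q m"] flip(2)[of _ "q i" "q j"]
    unfolding slope_def by (cases i j rule: linorder_cases; cases i m rule: linorder_cases)
      (auto simp: slope_key_eq_iff)
  then show ?thesis using assms by (simp add: in_line_iff_cross q_eq_iff)
qed

text \<open>The points whose slope at \<open>i\<close> equals that of \<open>j\<close> are those of the line through \<open>i\<close> and \<open>j\<close>, except \<open>i\<close> itself.\<close>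

lemma degree_eq_card:
  assumes "i < n" "j < n" "i \<noteq> j"
  shows "degree i j = card (points \<inter> affine hull {q i, q j})"
proof -
  have "points \<inter> affine hull {q i, q j} = q ` (insert i (same_line i j))"
  proof (intro equalityI subsetI)
    fix x assume "x \<in> points \<inter> affine hull {q i, q j}"
    then obtain m where "m < n" "x = q m" "q m \<in> affine hull {q i, q j}" by (auto simp: points_def)
    then show "x \<in> q ` (insert i (same_line i j))"
      using slope_eq_iff[of i j m] assms by (cases "m = i") (auto simp: same_line_def)
  next
    fix x assume "x \<in> q ` (insert i (same_line i j))"
    then show "x \<in> points \<inter> affine hull {q i, q j}"
      using assms slope_eq_iff[of i j] hull_inc[of "q i" "{q i, q j}"]
      by (auto simp: points_def same_line_def)
  qed
  moreover have "inj_on q (insert i (same_line i j))"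
    by (rule inj_on_subset[OF q_inj]) (use assms in \<open>auto simp: same_line_def\<close>)
  moreover have "i \<notin> same_line i j" "finite (same_line i j)" by (auto simp: same_line_def)
  ultimately show ?thesis by (simp add: degree_def card_image)
qed

lemma degree_commute: "i < n \<Longrightarrow> j < n \<Longrightarrow> i \<noteq> j \<Longrightarrow> degree i j = degree j i"
  by (simp add: degree_eq_card insert_commute)

lemma slope_eq_rotate:
  assumes "i < n" "j < n" "m < n" "i \<noteq> j" "i \<noteq> m" "j \<noteq> m" "slope i m = slope i j"
  shows "slope j m = slope j i"
proof -
  have "q m \<in> affine hull {q j, q i}"
    using slope_eq_iff[of i j m] assms by (simp add: insert_commute)
  then show ?thesis using slope_eq_iff[of j i m] assms by simp
qed

lemma ordinary_pair_commute: "i < n \<Longrightarrow> j < n \<Longrightarrow> ordinary_pair \<tau> i j \<longleftrightarrow> ordinary_pair \<tau> j i"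
  unfolding ordinary_pair_def using degree_commute[of i j] by metis

lemma ordinary_triangle_iff:
  assumes "i < n" "j < n" "k < n"
  shows "triangle_indices \<tau> i j k \<longleftrightarrow>
    i \<noteq> j \<and> i \<noteq> k \<and> j \<noteq> k \<and> ordinary_triangle points \<tau> {q i, q j, q k}"
proof (cases "i \<noteq> j \<and> i \<noteq> k \<and> j \<noteq> k")
  case True
  have inX: "q i \<in> points" "q j \<in> points" "q k \<in> points" using assms by (auto simp: points_def)
  have ne: "q i \<noteq> q j" "q i \<noteq> q k" "q j \<noteq> q k" using True assms by (auto simp: q_eq_iff)
  have op: "ordinary_pair \<tau> x y \<longleftrightarrow> ordinary_line points \<tau> (affine hull {q x, q y})"
    if "x < n" "y < n" "x \<noteq> y" for x y
    using that ordinary_line_iff[of "q x" points "q y" \<tau>]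
    by (auto simp: ordinary_pair_def degree_eq_card q_eq_iff points_def)
  have "collinear {q i, q j, q k} \<longleftrightarrow> slope i k = slope i j"
    using slope_eq_iff[of i j k] True assms ne by (simp add: collinear_3_affine_hull)
  moreover have "card {q i, q j, q k} = 3" using ne by simp
  moreover have "affine hull {q j, q i} = affine hull {q i, q j}"
    "affine hull {q k, q i} = affine hull {q i, q k}" "affine hull {q k, q j} = affine hull {q j, q k}"
    by (simp_all add: insert_commute)
  ultimately have "ordinary_triangle points \<tau> {q i, q j, q k} \<longleftrightarrow> slope i k \<noteq> slope i j \<and>
      ordinary_line points \<tau> (affine hull {q i, q j}) \<and> ordinary_line points \<tau> (affine hull {q i, q k}) \<and>
      ordinary_line points \<tau> (affine hull {q j, q k})"
    using inX ne ne[symmetric] unfolding ordinary_triangle_def by simp argo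
  then show ?thesis
    using True assms op[of i j] op[of i k] op[of j k] by (simp add: triangle_indices_def) argo
qed (auto simp: triangle_indices_def ordinary_pair_def)

lemma card_triangle_indices:
  "card {(i, j, k). i < n \<and> j < n \<and> k < n \<and> triangle_indices \<tau> i j k} =
    6 * card {T. ordinary_triangle points \<tau> T}"
proof -
  let ?F = "{T. ordinary_triangle points \<tau> T}"
  let ?G = "{(i, j, k). i < n \<and> j < n \<and> k < n \<and> triangle_indices \<tau> i j k}"
  let ?H = "{(x, y, z). x \<noteq> y \<and> x \<noteq> z \<and> y \<noteq> z \<and> {x, y, z} \<in> ?F}"
  have "finite points" by (simp add: points_def)
  then have "finite ?F" by (rule finite_subset[rotated, OF finite_Pow_iff[THEN iffD2]])
      (auto simp: ordinary_triangle_def)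
  then have "card ?H = 6 * card ?F"
    by (rule card_ordered_triples) (auto simp: ordinary_triangle_def)
  moreover have "bij_betw (\<lambda>(i, j, k). (q i, q j, q k)) ?G ?H"
    unfolding bij_betw_def
  proof
    show "inj_on (\<lambda>(i, j, k). (q i, q j, q k)) ?G" by (auto simp: inj_on_def q_eq_iff)
    show "(\<lambda>(i, j, k). (q i, q j, q k)) ` ?G = ?H"
    proof
      show "(\<lambda>(i, j, k). (q i, q j, q k)) ` ?G \<subseteq> ?H"
      proof
        fix t assume "t \<in> (\<lambda>(i, j, k). (q i, q j, q k)) ` ?G"
        then obtain g where g: "g \<in> ?G" "t = (\<lambda>(i, j, k). (q i, q j, q k)) g" by (rule imageE)
        obtain i j k where "g = (i, j, k)" by (cases g)
        with g have t: "i < n" "j < n" "k < n" "triangle_indices \<tau> i j k" "t = (q i, q j, q k)"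
          by simp_all
        then have "i \<noteq> j \<and> i \<noteq> k \<and> j \<noteq> k \<and> ordinary_triangle points \<tau> {q i, q j, q k}"
          using ordinary_triangle_iff[OF t(1-3), of \<tau>] by blast
        then show "t \<in> ?H" using t(1-3,5) by (simp add: q_eq_iff)
      qed
      show "?H \<subseteq> (\<lambda>(i, j, k). (q i, q j, q k)) ` ?G"
      proof
        fix t assume "t \<in> ?H"
        moreover obtain x y z where xyz: "t = (x, y, z)" by (cases t)
        ultimately have t: "t = (x, y, z)" "x \<noteq> y" "x \<noteq> z" "y \<noteq> z"
          "ordinary_triangle points \<tau> {x, y, z}" by simp_all
        then have "x \<in> points" "y \<in> points" "z \<in> points" unfolding ordinary_triangle_def by blast+
        then obtain i j k where ijk: "i < n" "j < n" "k < n" "x = q i" "y = q j" "z = q k"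
          unfolding points_def by blast
        have "i \<noteq> j" "i \<noteq> k" "j \<noteq> k" using t(2-4) ijk(4-6) by blast+
        then have "triangle_indices \<tau> i j k"
          using t(5) ordinary_triangle_iff[OF ijk(1-3), of \<tau>] ijk(4-6) by simp
        then show "t \<in> (\<lambda>(i, j, k). (q i, q j, q k)) ` ?G"
          using t(1) ijk by (intro image_eqI[of _ _ "(i, j, k)"]) (simp_all only: mem_Collect_eq case_prod_conv)
      qed
    qed
  qed
  then have "card ?G = card ?H" by (rule bij_betw_same_card)
  ultimately show ?thesis by simp
qed

text \<open>All pairs of points on one line have the same degree, so every further point on the line of an ordinary
  pair is a common neighbour. Of the points of \<open>same_line i j\<close>, only \<open>j\<close> is not counted on the left.\<close>

lemma card_common_neighbours:
  assumes "i < n" "j < n" "ordinary_pair \<tau> i j"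
  shows "card {k. k < n \<and> ordinary_pair \<tau> i k \<and> ordinary_pair \<tau> k j} + 1 =
    card {k. k < n \<and> triangle_indices \<tau> i j k} + card (same_line i j)"
proof -
  let ?N = "{k. k < n \<and> ordinary_pair \<tau> i k \<and> ordinary_pair \<tau> k j}"
  let ?T = "{k. k < n \<and> triangle_indices \<tau> i j k}"
  have ij: "i \<noteq> j" using assms by (simp add: ordinary_pair_def)
  have line: "ordinary_pair \<tau> i k \<and> ordinary_pair \<tau> k j" if k: "k \<in> same_line i j" "k \<noteq> j" for k
  proof -
    have k': "k < n" "k \<noteq> i" "slope i k = slope i j" using k by (auto simp: same_line_def)
    then have "same_line i k = same_line i j" by (simp add: same_line_def)
    then have "degree i k = degree i j" by (simp add: degree_def)
    moreover have "slope j k = slope j i"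
      by (rule slope_eq_rotate[of i j k]) (use k(2) k' assms(1,2) ij in simp_all)
    then have "same_line j k = same_line j i" by (simp add: same_line_def)
    then have "degree j k = degree j i" by (simp add: degree_def)
    ultimately have "ordinary_pair \<tau> i k" "ordinary_pair \<tau> j k"
      using degree_commute[of i j] assms k k' unfolding ordinary_pair_def by auto
    then show ?thesis using ordinary_pair_commute[of j k \<tau>] assms k' by simp
  qed
  have "?N = ?T \<union> (same_line i j - {j})"
  proof (intro equalityI subsetI)
    fix k assume "k \<in> ?N"
    then have k: "k < n" "ordinary_pair \<tau> i k" "ordinary_pair \<tau> j k"
      using ordinary_pair_commute[of k j \<tau>] assms(2) by simp_all
    then have "k \<noteq> i" "k \<noteq> j" unfolding ordinary_pair_def by auto
    then show "k \<in> ?T \<union> (same_line i j - {j})"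
      using k assms(3) unfolding triangle_indices_def same_line_def by blast
  next
    fix k assume k: "k \<in> ?T \<union> (same_line i j - {j})"
    show "k \<in> ?N"
    proof (cases "k \<in> ?T")
      case True
      then have "k < n" "ordinary_pair \<tau> i k" "ordinary_pair \<tau> j k"
        unfolding triangle_indices_def by blast+
      then show ?thesis using ordinary_pair_commute[of k j \<tau>] assms(2) by simp
    next
      case False
      then have "k \<in> same_line i j" "k \<noteq> j" using k by blast+
      then show ?thesis using line[of k] by (simp add: same_line_def)
    qed
  qed
  moreover have "?T \<inter> (same_line i j - {j}) = {}" by (auto simp: triangle_indices_def same_line_def)
  moreover have fin: "finite (same_line i j)" by (auto simp: same_line_def)
  ultimately have "card ?N = card ?T + card (same_line i j - {j})" by (simp add: card_Un_disjoint)
  moreover have "j \<in> same_line i j" using assms ij by (simp add: same_line_def)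
  ultimately show ?thesis using fin card_Suc_Diff1[of "same_line i j" j] by simp
qed

end

section \<open>Memory layout\<close>

text \<open>The arrays of the program; all numbers are below 20, from where on the arrays of the multiplication
  program are placed. \<open>SLOPE\<close> and \<open>DIFF\<close> are arrays of real numbers, the others of natural numbers.\<close>

abbreviation (input) "PERM \<equiv> 2 :: nat"
abbreviation (input) "NXT \<equiv> 3 :: nat"
abbreviation (input) "PRV \<equiv> 4 :: nat"
abbreviation (input) "LEAD \<equiv> 5 :: nat"
abbreviation (input) "CNT \<equiv> 6 :: nat"
abbreviation (input) "I_VAR \<equiv> 7 :: nat"
abbreviation (input) "J_VAR \<equiv> 8 :: nat"
abbreviation (input) "R_VAR \<equiv> 9 :: nat"
abbreviation (input) "A_VAR \<equiv> 10 :: nat"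
abbreviation (input) "V_VAR \<equiv> 11 :: nat"
abbreviation (input) "C_VAR \<equiv> 12 :: nat"
abbreviation (input) "MODE \<equiv> 13 :: nat"
abbreviation (input) "LAST \<equiv> 14 :: nat"
abbreviation (input) "CROSSED \<equiv> 15 :: nat"
abbreviation (input) "WIDTH \<equiv> 16 :: nat"
abbreviation (input) "P_VAR \<equiv> 17 :: nat"
abbreviation (input) "Q_VAR \<equiv> 18 :: nat"
abbreviation (input) "SLOPE \<equiv> 3 :: nat"
abbreviation (input) "DIFF \<equiv> 4 :: nat"

abbreviation Size :: nexp where "Size \<equiv> Var 0"

abbreviation Entry :: "nexp \<Rightarrow> nexp \<Rightarrow> nexp" where
  "Entry i j \<equiv> NAdd (NMul i (Var WIDTH)) j"

text \<open>Rows have \<open>n + 2\<close> columns, so that tables of the same shape hold the lists with their two sentinels.\<close>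

definition slopes_loaded :: "nat \<Rightarrow> (nat \<Rightarrow> nat \<Rightarrow> real) \<Rightarrow> ram_state \<Rightarrow> bool" where
  "slopes_loaded n \<sigma> s \<longleftrightarrow> nmem s 0 0 = n \<and> nmem s WIDTH 0 = n + 2 \<and>
    (\<forall>i<n. \<forall>j<n. rmem s SLOPE (i * nmem s WIDTH 0 + j) = \<sigma> i j)"

lemma slopes_loaded_run:
  assumes "0 \<notin> nat_targets c" "WIDTH \<notin> nat_targets c" "SLOPE \<notin> real_targets c"
  shows "slopes_loaded n \<sigma> (run c s) = slopes_loaded n \<sigma> s"
  using assms by (simp add: slopes_loaded_def run_nmem_frame run_rmem_frame)

section \<open>Sorting\<close>

abbreviation RLess :: "rexp \<Rightarrow> rexp \<Rightarrow> bexp" where "RLess e f \<equiv> BNot (RLe f e)"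

lemma lex_less_irrefl: "\<not> lex_less p p"
  by (simp add: lex_less_def)

lemma lex_less_trans: "lex_less p q \<Longrightarrow> lex_less q r \<Longrightarrow> lex_less p r"
  by (auto simp: lex_less_def)

lemma lex_less_total: "p \<noteq> q \<Longrightarrow> lex_less p q \<or> lex_less q p"
  by (auto simp: lex_less_def prod_eq_iff)

text \<open>Counting the smaller points takes quadratic time, which is affordable, and gives the sorted position
  directly.\<close>

definition lex_rank :: "nat \<Rightarrow> (nat \<Rightarrow> point) \<Rightarrow> nat \<Rightarrow> nat" where
  "lex_rank n p i = card {j. j < n \<and> lex_less (p j) (p i)}"

lemma rank_less:
  assumes "lex_less (p i) (p j)" "i < n"
  shows "lex_rank n p i < lex_rank n p j"
  unfolding lex_rank_def
proof (rule psubset_card_mono)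
  have "{k. k < n \<and> lex_less (p k) (p i)} \<subseteq> {k. k < n \<and> lex_less (p k) (p j)}"
    using lex_less_trans[OF _ assms(1)] by blast
  moreover have "i \<notin> {k. k < n \<and> lex_less (p k) (p i)}" "i \<in> {k. k < n \<and> lex_less (p k) (p j)}"
    using assms lex_less_irrefl by simp_all
  ultimately show "{k. k < n \<and> lex_less (p k) (p i)} \<subset> {k. k < n \<and> lex_less (p k) (p j)}" by blast
qed simp

lemma rank_less_iff:
  assumes "inj_on p {..<n}" "i < n" "j < n"
  shows "lex_rank n p i < lex_rank n p j \<longleftrightarrow> lex_less (p i) (p j)"
proof (cases "i = j")
  case False
  then have "p i \<noteq> p j" using assms by (auto simp: inj_on_def)
  then show ?thesis using lex_less_total rank_less[of p i j n] rank_less[of p j i n] assms lex_less_trans lex_less_irrefl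
    by (meson less_asym)
qed (simp add: lex_less_irrefl)

lemma rank_bij:
  assumes "inj_on p {..<n}"
  shows "bij_betw (lex_rank n p) {..<n} {..<n}"
proof -
  have "lex_rank n p i < n" if "i < n" for i
  proof -
    have "i \<notin> {j. j < n \<and> lex_less (p j) (p i)}" "i \<in> {..<n}" using that lex_less_irrefl by simp_all
    moreover have "{j. j < n \<and> lex_less (p j) (p i)} \<subseteq> {..<n}" by auto
    ultimately have "{j. j < n \<and> lex_less (p j) (p i)} \<subset> {..<n}" by blast
    from psubset_card_mono[OF _ this] show ?thesis by (simp add: lex_rank_def)
  qed
  moreover have "inj_on (lex_rank n p) {..<n}"
  proof (rule inj_onI)
    fix i j assume ij: "i \<in> {..<n}" "j \<in> {..<n}" "lex_rank n p i = lex_rank n p j"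
    then have "\<not> lex_less (p i) (p j)" "\<not> lex_less (p j) (p i)"
      using rank_less[of p i j n] rank_less[of p j i n] by auto
    then have "p i = p j" using lex_less_total by blast
    then show "i = j" using assms ij by (auto simp: inj_on_def)
  qed
  ultimately show ?thesis
    by (simp add: bij_betw_def endo_inj_surj image_subset_iff)
qed

definition points_loaded :: "nat \<Rightarrow> (nat \<Rightarrow> point) \<Rightarrow> ram_state \<Rightarrow> bool" where
  "points_loaded n p s \<longleftrightarrow> nmem s 0 0 = n \<and> (\<forall>i<n. p i = (rmem s 0 i, rmem s 1 i))"

definition points_sorted :: "nat \<Rightarrow> (nat \<Rightarrow> point) \<Rightarrow> ram_state \<Rightarrow> bool" where
  "points_sorted n p s \<longleftrightarrow> points_loaded n p s \<and> bij_betw (nmem s PERM) {..<n} {..<n} \<and>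
    (\<forall>i<n. \<forall>j<n. i < j \<longrightarrow> lex_less (p (nmem s PERM i)) (p (nmem s PERM j)))"

definition precedes_test :: bexp where
  "precedes_test = BNot (BAnd (BNot (RLess (RRead 0 (Var J_VAR)) (RRead 0 (Var I_VAR))))
    (BNot (BAnd (REqual (RRead 0 (Var J_VAR)) (RRead 0 (Var I_VAR)))
                (RLess (RRead 1 (Var J_VAR)) (RRead 1 (Var I_VAR))))))"

definition rank_loop :: com where
  "rank_loop = For J_VAR Size (Cond precedes_test (Assign R_VAR (NAdd (Var R_VAR) (NConst 1))) Skip)"

definition sort_points :: com where
  "sort_points = For I_VAR Size
    (Seq (Assign R_VAR (NConst 0)) (Seq rank_loop (NWrite PERM (Var R_VAR) (Var I_VAR))))"

lemma precedes_test:
  assumes "points_loaded n p s" "nmem s I_VAR 0 < n" "nmem s J_VAR 0 < n"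
  shows "bval s precedes_test \<longleftrightarrow> lex_less (p (nmem s J_VAR 0)) (p (nmem s I_VAR 0))"
proof -
  have "p (nmem s J_VAR 0) = (rmem s 0 (nmem s J_VAR 0), rmem s 1 (nmem s J_VAR 0))"
    "p (nmem s I_VAR 0) = (rmem s 0 (nmem s I_VAR 0), rmem s 1 (nmem s I_VAR 0))"
    using assms unfolding points_loaded_def by blast+
  then show ?thesis by (auto simp: precedes_test_def lex_less_def)
qed

lemma sort_points_correct:
  assumes p: "inj_on p {..<n}"
  shows "triple (points_loaded n p) sort_points (200 * (n + 1) ^ 2) (points_sorted n p)"
proof -
  define placed where "placed i s \<longleftrightarrow> points_loaded n p s \<and> i \<le> n \<and> (\<forall>j<i. nmem s PERM (lex_rank n p j) = j)"
    for i and s :: ram_state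
  define K where "K i k s \<longleftrightarrow> placed i s \<and> nmem s I_VAR 0 = i \<and>
    nmem s R_VAR 0 = card {j. j < k \<and> lex_less (p j) (p i)}" for i k and s :: ram_state
  have count: "card {j. j < Suc k \<and> lex_less (p j) (p i)} =
      card {j. j < k \<and> lex_less (p j) (p i)} + (if lex_less (p k) (p i) then 1 else 0)" for i k
  proof -
    have "{j. j < Suc k \<and> lex_less (p j) (p i)} =
        {j. j < k \<and> lex_less (p j) (p i)} \<union> (if lex_less (p k) (p i) then {k} else {})"
      by (auto simp: less_Suc_eq)
    then show ?thesis by (simp add: card_Un_disjoint)
  qed
  have body: "triple (\<lambda>s. K i k s \<and> nmem s J_VAR 0 = k)
      (Cond precedes_test (Assign R_VAR (NAdd (Var R_VAR) (NConst 1))) Skip) 60 (K i (Suc k))"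
    if "i < n" "k < n" for i k
  proof (rule triple_loop_free)
    fix s assume s: "K i k s \<and> nmem s J_VAR 0 = k"
    then have "bval s precedes_test \<longleftrightarrow> lex_less (p k) (p i)"
      using precedes_test[of n p s] that by (simp add: K_def placed_def)
    then show "K i (Suc k) (run (Cond precedes_test (Assign R_VAR (NAdd (Var R_VAR) (NConst 1))) Skip) s)"
      using s by (simp add: K_def placed_def points_loaded_def count)
  qed (simp_all add: precedes_test_def)
  have ranks: "triple (K i 0) rank_loop (80 * (n + 1)) (K i n)" if "i < n" for i
    unfolding rank_loop_def
    by (rule triple_For[where T = 60 and N = n, OF _ _ _ body[OF that]])
      (auto simp: K_def placed_def points_loaded_def)
  have step: "triple (\<lambda>s. placed i s \<and> nmem s I_VAR 0 = i)
      (Seq (Assign R_VAR (NConst 0)) (Seq rank_loop (NWrite PERM (Var R_VAR) (Var I_VAR))))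
      (90 * (n + 1)) (placed (Suc i))" if "i < n" for i
  proof (rule triple_Seq[OF _ triple_Seq[OF ranks[OF that] _ order_refl]])
    show "triple (\<lambda>s. placed i s \<and> nmem s I_VAR 0 = i) (Assign R_VAR (NConst 0)) 3 (K i 0)"
      by (rule triple_loop_free) (auto simp: K_def placed_def points_loaded_def)
    show "triple (K i n) (NWrite PERM (Var R_VAR) (Var I_VAR)) 5 (placed (Suc i))"
    proof (rule triple_loop_free)
      fix s assume s: "K i n s"
      have "lex_rank n p j \<noteq> lex_rank n p i" if "j < i" for j
        using rank_bij[OF p] that \<open>i < n\<close> by (auto simp: bij_betw_def inj_on_def)
      then show "placed (Suc i) (run (NWrite PERM (Var R_VAR) (Var I_VAR)) s)"
        using s \<open>i < n\<close> by (auto simp: K_def placed_def points_loaded_def lex_rank_def[symmetric] less_Suc_eq)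
    qed simp_all
  qed simp
  have "triple (placed 0) sort_points (200 * (n + 1) ^ 2) (placed n)"
    unfolding sort_points_def
    by (rule triple_For[where T = "90 * (n + 1)" and N = n, OF _ _ _ step])
      (auto simp: placed_def points_loaded_def rank_loop_def power2_eq_square algebra_simps)
  then show ?thesis
  proof (rule triple_conseq)
    fix s assume s: "placed n s"
    have inv: "nmem s PERM (lex_rank n p j) = j" if "j < n" for j using s that by (simp add: placed_def)
    have "bij_betw (nmem s PERM \<circ> lex_rank n p) {..<n} {..<n}"
      by (rule bij_betw_cong[THEN iffD2, OF _ bij_betw_id]) (simp add: inv)
    then have bij: "bij_betw (nmem s PERM) {..<n} {..<n}"
      using bij_betw_comp_iff[OF rank_bij[OF p]] by blast
    moreover have "lex_less (p (nmem s PERM i)) (p (nmem s PERM j))" if "i < n" "j < n" "i < j" for i j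
    proof -
      have surj: "\<exists>k<n. i = lex_rank n p k" if "i < n" for i
      proof -
        have "i \<in> lex_rank n p ` {..<n}" using bij_betw_imp_surj_on[OF rank_bij[OF p]] that by simp
        then show ?thesis by blast
      qed
      obtain k l where "k < n" "i = lex_rank n p k" "l < n" "j = lex_rank n p l"
        using surj[OF \<open>i < n\<close>] surj[OF \<open>j < n\<close>] by blast
      then show ?thesis using rank_less_iff[OF p, of k l] \<open>i < j\<close> inv by simp
    qed
    ultimately show "points_sorted n p s" using s by (simp add: points_sorted_def placed_def)
  qed (simp_all add: placed_def)
qed

section \<open>The table of slopes\<close>

abbreviation Coord_diff :: "nat \<Rightarrow> nat \<Rightarrow> nat \<Rightarrow> rexp" where
  "Coord_diff c lo hi \<equiv> RSub (RRead c (NRead PERM (Var hi))) (RRead c (NRead PERM (Var lo)))"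

definition slope_cell :: "nat \<Rightarrow> nat \<Rightarrow> com" where
  "slope_cell lo hi =
    Cond (RLe (ROfNat (NConst 0)) (Coord_diff 1 lo hi))
      (RWrite SLOPE (Entry (Var I_VAR) (Var J_VAR))
        (RDiv (Coord_diff 1 lo hi) (RAdd (Coord_diff 0 lo hi) (Coord_diff 1 lo hi))))
      (RWrite SLOPE (Entry (Var I_VAR) (Var J_VAR))
        (RDiv (Coord_diff 1 lo hi) (RAdd (Coord_diff 0 lo hi) (Coord_diff 1 hi lo))))"

definition slope_cells :: com where
  "slope_cells = Cond (NLe (Var I_VAR) (Var J_VAR)) (slope_cell I_VAR J_VAR) (slope_cell J_VAR I_VAR)"

definition load_slopes :: com where
  "load_slopes = Seq (Assign WIDTH (NAdd Size (NConst 2))) (For I_VAR Size (For J_VAR Size slope_cells))"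

context sorted_points
begin

definition coords_loaded :: "ram_state \<Rightarrow> bool" where
  "coords_loaded s \<longleftrightarrow> nmem s 0 0 = n \<and> (\<forall>i<n. q i = (rmem s 0 (nmem s PERM i), rmem s 1 (nmem s PERM i)))"

lemma slope_cells:
  assumes s: "coords_loaded s" and ij: "nmem s I_VAR 0 = i" "nmem s J_VAR 0 = j" "i < n" "j < n"
    "nmem s WIDTH 0 = w"
  shows "run slope_cells s = rwrite SLOPE (i * w + j) (slope i j) s"
proof -
  have "q i = (rmem s 0 (nmem s PERM i), rmem s 1 (nmem s PERM i))"
    "q j = (rmem s 0 (nmem s PERM j), rmem s 1 (nmem s PERM j))"
    using s ij unfolding coords_loaded_def by blast+
  then show ?thesis
    using ij by (auto simp: slope_cells_def slope_cell_def slope_def slope_key_def abs_if)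
qed

lemma load_slopes_correct:
  "triple coords_loaded load_slopes (300 * (n + 1) ^ 2) (slopes_loaded n slope)"
proof -
  define filled where "filled D s \<longleftrightarrow> coords_loaded s \<and> nmem s WIDTH 0 = n + 2 \<and>
    (\<forall>i<n. \<forall>j<n. D i j \<longrightarrow> rmem s SLOPE (i * nmem s WIDTH 0 + j) = slope i j)" for D and s :: ram_state
  define I2 where "I2 i j s \<longleftrightarrow> filled (\<lambda>i' j'. i' < i \<or> i' = i \<and> j' < j) s \<and> nmem s I_VAR 0 = i"
    for i j and s :: ram_state
  define I1 where "I1 i s \<longleftrightarrow> filled (\<lambda>i' j'. i' < i) s" for i and s :: ram_state
  have body: "triple (\<lambda>s. I2 i j s \<and> nmem s J_VAR 0 = j) slope_cells 200 (I2 i (Suc j))"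
    if "i < n" "j < n" for i j
  proof (rule triple_loop_free)
    fix s assume s: "I2 i j s \<and> nmem s J_VAR 0 = j"
    define w where "w = nmem s WIDTH 0"
    have w: "j' < w" if "j' < n" for j' using s that by (simp add: I2_def filled_def w_def)
    have eq: "run slope_cells s = rwrite SLOPE (i * w + j) (slope i j) s"
      using s that by (intro slope_cells) (simp_all add: I2_def filled_def w_def)
    have "rmem (run slope_cells s) SLOPE (i' * w + j') = slope i' j'"
      if "i' < n" "j' < n" "i' < i \<or> i' = i \<and> j' < Suc j" for i' j'
      unfolding eq
      using s that \<open>j < n\<close> w table_index_eq_iff[of j' w j i' i]
      by (auto simp: I2_def filled_def w_def[symmetric] less_Suc_eq)
    moreover have "coords_loaded (run slope_cells s)" "nmem (run slope_cells s) = nmem s"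
      using s unfolding eq by (simp_all add: I2_def filled_def coords_loaded_def)
    ultimately show "I2 i (Suc j) (run slope_cells s)"
      using s unfolding I2_def filled_def w_def by simp
  qed (simp_all add: slope_cells_def slope_cell_def)
  have row: "triple (I2 i 0) (For J_VAR Size slope_cells) (220 * (n + 1)) (I2 i n)" if "i < n" for i
    by (rule triple_For[where T = 200 and N = n, OF _ _ _ body[OF that]])
      (auto simp: I2_def filled_def coords_loaded_def slope_cells_def slope_cell_def)
  have step: "triple (\<lambda>s. I1 i s \<and> nmem s I_VAR 0 = i) (For J_VAR Size slope_cells) (220 * (n + 1)) (I1 (Suc i))"
    if "i < n" for i
    by (rule triple_conseq[OF row[OF that]]) (auto simp: I1_def I2_def filled_def less_Suc_eq)
  have loop: "triple (I1 0) (For I_VAR Size (For J_VAR Size slope_cells)) (240 * (n + 1) ^ 2) (I1 n)"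
    by (rule triple_For[where T = "220 * (n + 1)" and N = n, OF _ _ _ step])
      (auto simp: I1_def filled_def coords_loaded_def slope_cells_def slope_cell_def power2_eq_square algebra_simps)
  have "triple coords_loaded (Assign WIDTH (NAdd Size (NConst 2))) 10 (I1 0)"
    by (rule triple_loop_free) (auto simp: I1_def filled_def coords_loaded_def)
  from triple_Seq[OF this loop] have "triple coords_loaded load_slopes (300 * (n + 1) ^ 2) (I1 n)"
    unfolding load_slopes_def by (simp add: power2_eq_square algebra_simps)
  then show ?thesis
    by (rule triple_conseq) (auto simp: I1_def filled_def coords_loaded_def slopes_loaded_def)
qed

end

section \<open>The insertion program\<close>

definition lists_at :: "nat \<Rightarrow> ram_state \<Rightarrow> nat \<Rightarrow> nat \<Rightarrow> nat" where
  "lists_at a s = table (nmem s WIDTH 0) (nmem s a)"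

text \<open>As \<open>i\<close> is smaller than all indices in the list, ties in slope are decided in its favour.\<close>

definition crosses_next :: bexp where
  "crosses_next = BNot (BAnd (BNot (Equal (Var C_VAR) (NAdd Size (NConst 1))))
    (BNot (RLe (RRead SLOPE (Entry (Var A_VAR) (Var J_VAR)))
               (RRead SLOPE (Entry (Var A_VAR) (Var C_VAR))))))"

definition walk_step :: com where
  "walk_step =
    Cond (Equal (Var MODE) (NConst 0))
      (Seq (Assign C_VAR (NRead NXT (Entry (Var A_VAR) (Var V_VAR))))
      (Cond crosses_next
        (Seq (NWrite NXT (Entry (Var A_VAR) (Var V_VAR)) (Var J_VAR))
        (Seq (NWrite NXT (Entry (Var A_VAR) (Var J_VAR)) (Var C_VAR))
        (Seq (NWrite PRV (Entry (Var A_VAR) (Var J_VAR)) (Var V_VAR))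
        (Seq (NWrite PRV (Entry (Var A_VAR) (Var C_VAR)) (Var J_VAR))
        (Seq (NWrite NXT (Entry (Var J_VAR) (Var LAST)) (Var A_VAR))
        (Seq (NWrite PRV (Entry (Var J_VAR) (Var A_VAR)) (Var LAST))
        (Seq (Assign LAST (Var A_VAR))
        (Seq (Assign CROSSED (NAdd (Var CROSSED) (NConst 1)))
             (Assign MODE (NConst 1))))))))))
        (Seq (Assign V_VAR (Var A_VAR)) (Assign A_VAR (Var C_VAR)))))
      (Cond (Equal (Var V_VAR) Size)
        (Seq (Assign A_VAR (NAdd (Var A_VAR) (NConst 1))) (Assign MODE (NConst 0)))
      (Seq (Assign C_VAR (Var V_VAR))
      (Cond (Less (Var A_VAR) (Var V_VAR))
        (Seq (Assign V_VAR (NRead PRV (Entry (Var V_VAR) (Var A_VAR))))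
             (Assign A_VAR (Var C_VAR)))
        (Seq (Assign V_VAR (Var A_VAR))
        (Seq (Assign A_VAR (Var C_VAR)) (Assign MODE (NConst 0)))))))"

text \<open>The line inserted in round \<open>k\<close> is \<open>n - 1 - k\<close>, which has \<open>k\<close> lines to cross.\<close>

definition insert_line_start :: com where
  "insert_line_start =
    Seq (Assign J_VAR (NSub (NSub Size (NConst 1)) (Var I_VAR)))
    (Seq (Assign A_VAR (NAdd (Var J_VAR) (NConst 1)))
    (Seq (Assign V_VAR Size)
    (Seq (Assign MODE (NConst 0))
    (Seq (Assign LAST Size)
         (Assign CROSSED (NConst 0))))))"

definition insert_line_end :: com where
  "insert_line_end =
    Seq (NWrite NXT (Entry (Var J_VAR) (Var LAST)) (NAdd Size (NConst 1)))
        (NWrite PRV (Entry (Var J_VAR) (NAdd Size (NConst 1))) (Var LAST))"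

definition insert_line :: com where
  "insert_line = Seq insert_line_start
    (Seq (While (Less (Var CROSSED) (Var I_VAR)) walk_step) insert_line_end)"

definition insert_all :: com where
  "insert_all = For I_VAR Size insert_line"

context slope_system
begin

definition lists_state :: "nat \<Rightarrow> ram_state \<Rightarrow> bool" where
  "lists_state m s \<longleftrightarrow> slopes_loaded n \<sigma> s \<and> (\<forall>j\<in>{m..<n}. linked ({m..<n} - {j}) j
    (lists_at NXT s j) (lists_at PRV s j))"

end

context line_insertion
begin

definition walk_state :: "nat set \<Rightarrow> ram_state \<Rightarrow> bool" where
  "walk_state C s \<longleftrightarrow> slopes_loaded n \<sigma> s \<and> nmem s I_VAR 0 = n - 1 - i \<and> nmem s J_VAR 0 = i \<and>
    nmem s CROSSED 0 = card C \<and>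
    walk_inv C (nmem s MODE 0) (nmem s A_VAR 0) (nmem s V_VAR 0) (nmem s LAST 0)
      (lists_at NXT s) (lists_at PRV s)"

lemma walk_step_correct:
  assumes s: "walk_state C s" and less: "card C < n - 1 - i"
  shows "\<exists>D. walk_state D (run walk_step s) \<and>
    potential D (nmem (run walk_step s) MODE 0) (nmem (run walk_step s) A_VAR 0) <
    potential C (nmem s MODE 0) (nmem s A_VAR 0)"
proof -
  define a where "a = nmem s A_VAR 0"
  define v where "v = nmem s V_VAR 0"
  define l where "l = nmem s LAST 0"
  define w where "w = nmem s WIDTH 0"
  define nx where "nx = table w (nmem s NXT)"
  define pv where "pv = table w (nmem s PRV)"
  note defs = a_def[symmetric] v_def[symmetric] l_def[symmetric] w_def[symmetric]
    nx_def[symmetric] pv_def[symmetric]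
  have regs: "nmem s 0 0 = n" "nmem s I_VAR 0 = n - 1 - i" "nmem s J_VAR 0 = i"
    "nmem s CROSSED 0 = card C"
    and w: "w = n + 2"
    and slope: "\<And>j k. j < n \<Longrightarrow> k < n \<Longrightarrow> rmem s SLOPE (j * w + k) = \<sigma> j k"
    using s by (auto simp: walk_state_def slopes_loaded_def w_def)
  have loaded: "slopes_loaded n \<sigma> (run walk_step s)"
    using s by (subst slopes_loaded_run) (simp_all add: walk_state_def walk_step_def)
  have inv: "walk_inv C (nmem s MODE 0) a v l nx pv"
    using s unfolding walk_state_def lists_at_def a_def v_def l_def nx_def pv_def w_def by blast
  have ne: "C \<noteq> P" using less by auto
  note f = walk_faceD[OF inv ne]
  have lines: "a < w" "v < w" "i < w" "l < w" "a < n"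
    using f i_less by (auto simp: crossed_def w)
  have rd: "nmem s NXT (a * w + v) = nx a v" "nmem s PRV (v * w + a) = pv v a"
    using lines by (simp_all add: nx_def pv_def table_def)
  (* Every branch except the crossing changes only the position. *)
  have moved: ?thesis
    if "walk_inv C m b u l nx pv" "potential C m b < potential C (nmem s MODE 0) a"
      and regs': "nmem (run walk_step s) MODE 0 = m" "nmem (run walk_step s) A_VAR 0 = b"
        "nmem (run walk_step s) V_VAR 0 = u"
      and same: "\<forall>x\<in>{LAST, CROSSED, I_VAR, J_VAR, NXT, PRV, WIDTH}. nmem (run walk_step s) x = nmem s x"
    for m b u
    using that loaded
    by (intro exI[of _ C]) (simp add: walk_state_def lists_at_def regs defs)
  show ?thesis
  proof (cases "nmem s MODE 0 = 0")
    case True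
    note mode = True
    then have w0: "walk_inv C 0 a v l nx pv" using inv by simp
    define c where "c = nx a v"
    have c: "c \<in> insert (n + 1) P" "c < w"
      using walk_next[OF w0 ne] by (auto simp: c_def adjacent_def w)
    have test: "bval (nwrite C_VAR 0 c s) crosses_next \<longleftrightarrow> prec a i c"
    proof -
      have "bval (nwrite C_VAR 0 c s) crosses_next \<longleftrightarrow>
          c = n + 1 \<or> rmem s SLOPE (a * w + i) \<le> rmem s SLOPE (a * w + c)"
        by (auto simp: crosses_next_def regs defs)
      also have "\<dots> \<longleftrightarrow> c = n + 1 \<or> \<sigma> a i \<le> \<sigma> a c"
        using slope[OF lines(5)] c(1) i_less by auto
      also have "\<dots> \<longleftrightarrow> prec a i c" using crossing_test[OF c(1)] by simp
      finally show ?thesis .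
    qed
    show ?thesis
    proof (cases "prec a i c")
      case True
      note step = walk_cross[OF w0 ne c_def True]
      have t: "bval (nwrite C_VAR 0 c s) crosses_next" using True test by simp
      note ev = walk_step_def mode regs defs rd c_def[symmetric] t
      have "nmem (run walk_step s) MODE 0 = 1" "nmem (run walk_step s) A_VAR 0 = a"
        "nmem (run walk_step s) V_VAR 0 = v" "nmem (run walk_step s) LAST 0 = a"
        "nmem (run walk_step s) CROSSED 0 = card C + 1"
        "nmem (run walk_step s) I_VAR 0 = n - 1 - i" "nmem (run walk_step s) J_VAR 0 = i"
        by (simp_all add: ev)
      moreover have "lists_at NXT (run walk_step s) = nx(a := (nx a)(v := i, i := c), i := (nx i)(l := a))"
        "lists_at PRV (run walk_step s) = pv(a := (pv a)(i := v, c := i), i := (pv i)(a := l))"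
        using lines c(2) f(1) by (simp_all add: ev lists_at_def table_upd)
      ultimately show ?thesis using step loaded mode
        by (intro exI[of _ "insert a C"]) (simp add: walk_state_def defs)
    next
      case False
      note step = walk_forward[OF w0 ne c_def False]
      have t: "\<not> bval (nwrite C_VAR 0 c s) crosses_next" using False test by simp
      show ?thesis
        by (rule moved[OF step(1)])
          (use step(2) in \<open>simp_all add: walk_step_def mode regs defs rd c_def[symmetric] t\<close>)
    qed
  next
    case False
    then have m: "nmem s MODE 0 = 1" and w1: "walk_inv C 1 a v l nx pv" using f(5) inv by auto
    consider "v = n" | "v \<noteq> n" "a < v" | "v < a" using f(3) by linarith
    then show ?thesis
    proof cases
      case 1
      note step = walk_infinity[OF w1[unfolded 1] ne]
      show ?thesis
        by (rule moved[OF step(1)]) (use step(2) 1 m in \<open>simp_all add: walk_step_def regs defs\<close>)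
    next
      case 2
      note step = walk_left[OF w1 ne 2(2,1)]
      show ?thesis
        by (rule moved[OF step(1)]) (use step(2) 2 m in \<open>simp_all add: walk_step_def regs defs rd\<close>)
    next
      case 3
      note step = walk_turn[OF w1 ne 3]
      have "v \<noteq> n" using 3 lines by simp
      then show ?thesis
        by (intro moved[OF step(1)]) (use step(2) 3 m in \<open>simp_all add: walk_step_def regs defs\<close>)
    qed
  qed
qed

lemma walk_loop:
  "triple (walk_state {}) (While (Less (Var CROSSED) (Var I_VAR)) walk_step) (2000 * (n + 1)) (walk_state P)"
proof -
  define K where "K k s \<longleftrightarrow> (\<exists>C. walk_state C s \<and> k = potential C (nmem s MODE 0) (nmem s A_VAR 0))" for k s
  let ?b = "Less (Var CROSSED) (Var I_VAR)"
  have "triple (\<lambda>s. K k s \<and> bval s ?b) walk_step 300 (\<lambda>s. \<exists>m<k. K m s)" for k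
  proof (rule triple_loop_free)
    fix s assume "K k s \<and> bval s ?b"
    then obtain C where C: "walk_state C s" "k = potential C (nmem s MODE 0) (nmem s A_VAR 0)"
      "card C < n - 1 - i" by (auto simp: K_def walk_state_def)
    from walk_step_correct[OF C(1,3)] show "\<exists>m<k. K m (run walk_step s)"
      unfolding K_def C(2) by blast
  qed (simp_all add: walk_step_def crosses_next_def)
  then have loop: "triple (K k) (While ?b walk_step) ((k + 1) * 310) (\<lambda>s. (\<exists>l. K l s) \<and> \<not> bval s ?b)" for k
    by (rule triple_While) simp
  show ?thesis
    unfolding triple_def
  proof (intro allI impI)
    fix s assume s: "walk_state {} s"
    define k where "k = potential {} (nmem s MODE 0) (nmem s A_VAR 0)"
    have "K k s" using s by (auto simp: K_def k_def)
    then obtain t s' where s': "exec (While ?b walk_step) s t s'" "t \<le> (k + 1) * 310"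
      "\<exists>l. K l s'" "\<not> bval s' ?b" using tripleD[OF loop] by metis
    have "k \<le> 4 * n + 1"
      using s unfolding k_def by (intro potential_le) (simp add: walk_state_def walk_inv_def)
    then have "(k + 1) * 310 \<le> (4 * n + 2) * 310" by simp
    also have "\<dots> \<le> 2000 * (n + 1)" by simp
    finally have "t \<le> 2000 * (n + 1)" using s'(2) by simp
    obtain C where C: "walk_state C s'" using s'(3) by (auto simp: K_def)
    then have "C \<subseteq> P" by (simp add: walk_state_def walk_inv_def crossed_def)
    moreover have "card P \<le> card C" using s'(4) C by (simp add: walk_state_def)
    ultimately have "C = P" by (simp add: card_seteq)
    then show "\<exists>t s'. exec (While ?b walk_step) s t s' \<and> t \<le> 2000 * (n + 1) \<and> walk_state P s'"
      using s'(1) C \<open>t \<le> 2000 * (n + 1)\<close> by blast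
  qed
qed

lemma insert_line_correct:
  "triple (\<lambda>s. lists_state (i + 1) s \<and> nmem s I_VAR 0 = n - 1 - i) insert_line (2200 * (n + 1)) (lists_state i)"
  unfolding insert_line_def
proof (rule triple_Seq[OF _ triple_Seq[OF walk_loop _ order_refl]])
  show "triple (\<lambda>s. lists_state (i + 1) s \<and> nmem s I_VAR 0 = n - 1 - i) insert_line_start 100 (walk_state {})"
  proof (rule triple_loop_free)
    fix s assume s: "lists_state (i + 1) s \<and> nmem s I_VAR 0 = n - 1 - i"
    have "{i + 1..<n} = P" by auto
    with s have "walk_inv {} 0 (i + 1) n n (lists_at NXT s) (lists_at PRV s)"
      by (intro walk_start) (simp add: lists_state_def)
    moreover have "slopes_loaded n \<sigma> (run insert_line_start s)"
      using s by (subst slopes_loaded_run) (simp_all add: lists_state_def insert_line_start_def)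
    moreover have "nmem s 0 0 = n" using s by (simp add: lists_state_def slopes_loaded_def)
    ultimately show "walk_state {} (run insert_line_start s)"
      using s i_less by (simp add: walk_state_def insert_line_start_def lists_at_def)
  qed (simp_all add: insert_line_start_def)
  show "triple (walk_state P) insert_line_end 100 (lists_state i)"
  proof (rule triple_loop_free)
    fix s assume s: "walk_state P s"
    then have w: "walk_inv P (nmem s MODE 0) (nmem s A_VAR 0) (nmem s V_VAR 0) (nmem s LAST 0)
      (lists_at NXT s) (lists_at PRV s)" by (simp add: walk_state_def)
    then have l: "nmem s LAST 0 < n + 2" by (auto simp: walk_inv_def)
    have loaded: "slopes_loaded n \<sigma> s" and j: "nmem s J_VAR 0 = i" using s by (auto simp: walk_state_def)
    obtain k e where k: "nmem s WIDTH 0 = k" and n: "nmem s 0 0 = n" and e: "n + 1 = e"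
      and less: "nmem s LAST 0 < k" "e < k"
      using loaded l by (auto simp: slopes_loaded_def)
    have "lists_at NXT (run insert_line_end s) = (lists_at NXT s)(i := (lists_at NXT s i)(nmem s LAST 0 := e))"
      "lists_at PRV (run insert_line_end s) = (lists_at PRV s)(i := (lists_at PRV s i)(e := nmem s LAST 0))"
      using less e by (simp_all add: insert_line_end_def lists_at_def j k n table_upd)
    moreover have "slopes_loaded n \<sigma> (run insert_line_end s)"
      using loaded by (subst slopes_loaded_run) (simp_all add: insert_line_end_def)
    ultimately show "lists_state i (run insert_line_end s)"
      using walk_end[OF w, unfolded e] by (simp add: lists_state_def)
  qed (simp_all add: insert_line_end_def)
qed simp

end

context slope_system
begin

lemma insert_all_correct:
  "triple (slopes_loaded n \<sigma>) insert_all (2300 * (n + 1) ^ 2) (lists_state 0)"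
proof -
  define K where "K k s \<longleftrightarrow> k \<le> n \<and> lists_state (n - k) s" for k s
  have step: "triple (\<lambda>s. K k s \<and> nmem s I_VAR 0 = k) insert_line (2200 * (n + 1)) (K (Suc k))"
    if "k < n" for k
  proof -
    interpret line_insertion n \<sigma> "n - 1 - k" by unfold_locales (use that in simp)
    show ?thesis
      by (rule triple_conseq[OF insert_line_correct])
        (use that in \<open>auto simp: K_def lists_state_def Suc_diff_Suc\<close>)
  qed
  have "triple (K 0) insert_all (2300 * (n + 1) ^ 2) (K n)"
    unfolding insert_all_def
    by (rule triple_For[where T = "2200 * (n + 1)" and N = n, OF _ _ _ step])
      (auto simp: insert_line_def insert_line_start_def insert_line_end_def walk_step_def
        K_def lists_state_def slopes_loaded_def lists_at_def power2_eq_square algebra_simps)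
  then show ?thesis
    by (rule triple_conseq) (auto simp: K_def lists_state_def)
qed

end

section \<open>Degrees\<close>

context slope_system
begin

definition seen :: "nat \<Rightarrow> nat \<Rightarrow> nat set" where
  "seen j m = {x. x < n \<and> x \<noteq> j \<and> prec j x m}"

text \<open>The list of line \<open>j\<close> is traversed, and each element is labelled with the first element of its run of equal
  slopes, the leader \<open>v\<close> of the current run being known. The counter of a leader is the size of its run.
  The invariant describes the vertices before \<open>m\<close>.\<close>

definition grouped :: "nat \<Rightarrow> nat \<Rightarrow> nat \<Rightarrow> (nat \<Rightarrow> nat) \<Rightarrow> (nat \<Rightarrow> nat) \<Rightarrow> bool" where
  "grouped j m v ld ct \<longleftrightarrow>
    (\<forall>x\<in>seen j m. ld x \<in> seen j m \<and> \<sigma> j (ld x) = \<sigma> j x) \<and>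
    (\<forall>x\<in>seen j m. \<forall>y\<in>seen j m. \<sigma> j x = \<sigma> j y \<longrightarrow> ld x = ld y) \<and>
    (\<forall>l<n. ct l = card {x\<in>seen j m. ld x = l}) \<and>
    (if v = n then seen j m = {} else v \<in> seen j m \<and> ld v = v \<and> (\<forall>x\<in>seen j m. \<sigma> j x \<le> \<sigma> j v))"

lemma grouped_start:
  assumes "adjacent ({..<n} - {j}) j n m" "\<And>l. l < n \<Longrightarrow> ct l = 0"
  shows "grouped j m n ld ct"
proof -
  have "seen j m = {}" using assms(1) by (auto simp: seen_def adjacent_def)
  then show ?thesis using assms(2) by (simp add: grouped_def)
qed

lemma seen_step:
  assumes "adjacent ({..<n} - {j}) j m m'" "m < n"
  shows "seen j m' = insert m (seen j m)" "m \<notin> seen j m"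
  using assms adjacentD[OF assms(1)] by (auto simp: seen_def adjacent_def)

lemma grouped_step:
  assumes g: "grouped j m v ld ct" and a: "adjacent ({..<n} - {j}) j m m'" "m < n"
  defines "u \<equiv> (if v = n \<or> \<sigma> j m \<noteq> \<sigma> j v then m else v)"
  shows "grouped j m' u (ld(m := u)) (ct(u := ct u + 1))"
proof -
  define S where "S = seen j m"
  have S': "seen j m' = insert m S" "m \<notin> S" using seen_step[OF a] by (simp_all add: S_def)
  have fin: "finite S" by (simp add: S_def seen_def)
  have ld: "\<And>x. x \<in> S \<Longrightarrow> ld x \<in> S \<and> \<sigma> j (ld x) = \<sigma> j x"
    "\<And>x y. x \<in> S \<Longrightarrow> y \<in> S \<Longrightarrow> \<sigma> j x = \<sigma> j y \<Longrightarrow> ld x = ld y"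
    and ct: "\<And>l. l < n \<Longrightarrow> ct l = card {x\<in>S. ld x = l}"
    and v: "if v = n then S = {} else v \<in> S \<and> ld v = v \<and> (\<forall>x\<in>S. \<sigma> j x \<le> \<sigma> j v)"
    using g unfolding grouped_def S_def by blast+
  have le: "\<sigma> j x \<le> \<sigma> j m" if "x \<in> S" for x
    using that a(2) by (auto simp: S_def seen_def prec_def)
  have u: "u \<in> insert m S" "\<sigma> j u = \<sigma> j m" "u = m \<or> u \<in> S \<and> ld u = u"
    using v by (auto simp: u_def)
  have same: "ld x = u" if "x \<in> S" "\<sigma> j x = \<sigma> j m" for x
  proof (cases "v = n \<or> \<sigma> j m \<noteq> \<sigma> j v")
    case True
    have "v \<noteq> n" using that v by auto
    then have "\<sigma> j x \<le> \<sigma> j v" "\<sigma> j v \<le> \<sigma> j m" "\<sigma> j m \<noteq> \<sigma> j v" using v True that le[of v] by auto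
    then show ?thesis using that by simp
  next
    case False
    then show ?thesis using ld(2)[of x v] v that by (simp add: u_def)
  qed
  have "{x \<in> insert m S. (ld(m := u)) x = l} = {x \<in> S. ld x = l} \<union> (if l = u then {m} else {})" for l
    using S'(2) by auto
  then have card: "card {x \<in> insert m S. (ld(m := u)) x = l} = card {x \<in> S. ld x = l} + (if l = u then 1 else 0)" for l
    using S'(2) fin by (simp add: card_Un_disjoint)
  show ?thesis
    unfolding grouped_def S'(1)
  proof (intro conjI ballI allI impI)
    fix x assume "x \<in> insert m S"
    then show "(ld(m := u)) x \<in> insert m S" "\<sigma> j ((ld(m := u)) x) = \<sigma> j x"
      using u ld(1) S'(2) by auto
  next
    fix x y assume "x \<in> insert m S" "y \<in> insert m S" "\<sigma> j x = \<sigma> j y"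
    then show "(ld(m := u)) x = (ld(m := u)) y"
      using same[of x] same[of y] ld(2)[of x y] S'(2) by auto
  next
    fix l assume "l < n"
    then show "(ct(u := ct u + 1)) l = card {x \<in> insert m S. (ld(m := u)) x = l}"
      unfolding card using ct[of l] by (cases "l = u") simp_all
  next
    have "u \<noteq> n" using v a(2) by (auto simp: u_def)
    moreover have "(ld(m := u)) u = u" using u(3) by auto
    ultimately show "if u = n then insert m S = {}
        else u \<in> insert m S \<and> (ld(m := u)) u = u \<and> (\<forall>x\<in>insert m S. \<sigma> j x \<le> \<sigma> j u)"
      using u le by simp
  qed
qed

lemma grouped_end:
  assumes "grouped j (n + 1) v ld ct" "x < n" "x \<noteq> j"
  shows "ct (ld x) + 1 = degree j x" "ld x < n"
proof -
  have all: "seen j (n + 1) = {x. x < n \<and> x \<noteq> j}" by (auto simp: seen_def)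
  have g: "\<forall>x\<in>{x. x < n \<and> x \<noteq> j}. ld x \<in> {x. x < n \<and> x \<noteq> j} \<and> \<sigma> j (ld x) = \<sigma> j x"
    "\<forall>x\<in>{x. x < n \<and> x \<noteq> j}. \<forall>y\<in>{x. x < n \<and> x \<noteq> j}. \<sigma> j x = \<sigma> j y \<longrightarrow> ld x = ld y"
    and g3: "\<forall>l<n. ct l = card {x\<in>{x. x < n \<and> x \<noteq> j}. ld x = l}"
    using assms(1) unfolding grouped_def all by blast+
  have g1: "ld y < n" "\<sigma> j (ld y) = \<sigma> j y" if "y < n" "y \<noteq> j" for y using g(1) that by simp_all
  have g2: "ld y = ld z" if "y < n" "y \<noteq> j" "z < n" "z \<noteq> j" "\<sigma> j y = \<sigma> j z" for y z
    using g(2) that by blast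
  show "ld x < n" using g1 assms by simp
  have "ld y = ld x \<longleftrightarrow> \<sigma> j y = \<sigma> j x" if "y < n" "y \<noteq> j" for y
    using g1(2)[OF that] g1(2)[OF assms(2,3)] g2[OF that assms(2,3)] by metis
  then have "{y\<in>{x. x < n \<and> x \<noteq> j}. ld y = ld x} = same_line j x"
    unfolding same_line_def by blast
  then show "ct (ld x) + 1 = degree j x" using g3 \<open>ld x < n\<close> by (simp add: degree_def)
qed

end

definition count_step :: com where
  "count_step =
    Seq (Cond (BAnd (BNot (Equal (Var V_VAR) Size))
            (REqual (RRead SLOPE (Entry (Var I_VAR) (Var A_VAR))) (RRead SLOPE (Entry (Var I_VAR) (Var V_VAR)))))
          Skip (Assign V_VAR (Var A_VAR)))
    (Seq (NWrite LEAD (Entry (Var I_VAR) (Var A_VAR)) (Var V_VAR))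
    (Seq (NWrite CNT (Entry (Var I_VAR) (Var V_VAR))
          (NAdd (NRead CNT (Entry (Var I_VAR) (Var V_VAR))) (NConst 1)))
      (Assign A_VAR (NRead NXT (Entry (Var I_VAR) (Var A_VAR))))))"

definition count_line_start :: com where
  "count_line_start = Seq (Assign A_VAR (NRead NXT (Entry (Var I_VAR) Size))) (Assign V_VAR Size)"

definition count_line :: com where
  "count_line = Seq count_line_start (While (Less (Var A_VAR) Size) count_step)"

definition count_degrees :: com where
  "count_degrees = For I_VAR Size count_line"

context slope_system
begin

lemma slopes_loadedD:
  assumes "slopes_loaded n \<sigma> s"
  shows "nmem s 0 0 = n" "nmem s WIDTH 0 = n + 2"
    and "i < n \<Longrightarrow> j < n \<Longrightarrow> rmem s SLOPE (i * nmem s WIDTH 0 + j) = \<sigma> i j"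
  using assms unfolding slopes_loaded_def by blast+

lemma slopes_loaded_nwrite:
  "b \<noteq> 0 \<Longrightarrow> b \<noteq> WIDTH \<Longrightarrow> slopes_loaded n \<sigma> (nwrite b i x s) = slopes_loaded n \<sigma> s"
  by (simp add: slopes_loaded_def)

lemma lists_at_nwrite: "b \<noteq> a \<Longrightarrow> b \<noteq> WIDTH \<Longrightarrow> lists_at a (nwrite b i x s) = lists_at a s"
  by (simp add: lists_at_def)

definition lists_done :: "ram_state \<Rightarrow> bool" where
  "lists_done s \<longleftrightarrow> slopes_loaded n \<sigma> s \<and>
    (\<forall>j<n. \<forall>u\<in>insert n ({..<n} - {j}). adjacent ({..<n} - {j}) j u (lists_at NXT s j u))"

definition degrees_loaded :: "ram_state \<Rightarrow> bool" where
  "degrees_loaded s \<longleftrightarrow> slopes_loaded n \<sigma> s \<and> (\<forall>i<n. \<forall>j<n. i \<noteq> j \<longrightarrow>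
    nmem s CNT (i * nmem s WIDTH 0 + nmem s LEAD (i * nmem s WIDTH 0 + j)) + 1 = degree i j)"

definition counted :: "nat \<Rightarrow> ram_state \<Rightarrow> bool" where
  "counted k s \<longleftrightarrow> lists_done s \<and>
    (\<forall>j<n. (j < k \<longrightarrow> (\<exists>v. grouped j (n + 1) v (lists_at LEAD s j) (lists_at CNT s j))) \<and>
      (k \<le> j \<longrightarrow> (\<forall>l<n. lists_at CNT s j l = 0)))"

definition counting :: "nat \<Rightarrow> nat \<Rightarrow> ram_state \<Rightarrow> bool" where
  "counting j k s \<longleftrightarrow> lists_done s \<and> nmem s I_VAR 0 = j \<and> j < n \<and>
    nmem s A_VAR 0 \<in> insert (n + 1) ({..<n} - {j}) \<and> nmem s V_VAR 0 \<le> n \<and>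
    k = n - card (seen j (nmem s A_VAR 0)) \<and>
    grouped j (nmem s A_VAR 0) (nmem s V_VAR 0) (lists_at LEAD s j) (lists_at CNT s j) \<and>
    (\<forall>i<n. (i < j \<longrightarrow> (\<exists>v. grouped i (n + 1) v (lists_at LEAD s i) (lists_at CNT s i))) \<and>
      (j < i \<longrightarrow> (\<forall>l<n. lists_at CNT s i l = 0)))"

lemma count_step_correct:
  assumes s: "counting j k s" and less: "nmem s A_VAR 0 < n"
  shows "\<exists>l<k. counting j l (run count_step s)"
proof -
  define m where "m = nmem s A_VAR 0"
  define v where "v = nmem s V_VAR 0"
  define w where "w = nmem s WIDTH 0"
  define ld where "ld = lists_at LEAD s"
  define ct where "ct = lists_at CNT s"
  note defs = m_def[symmetric] v_def[symmetric] w_def[symmetric]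
  have j: "nmem s I_VAR 0 = j" "j < n" and size: "nmem s 0 0 = n" and m: "m < n" "m \<noteq> j"
    and v: "v \<le> n" and k: "k = n - card (seen j m)"
    and g: "grouped j m v (ld j) (ct j)"
    using s less by (auto simp: counting_def m_def v_def ld_def ct_def lists_done_def slopes_loaded_def)
  have w: "x < w" if "x \<le> n" for x
    using s that by (simp add: counting_def lists_done_def slopes_loaded_def w_def)
  have slope: "rmem s SLOPE (j * w + x) = \<sigma> j x" if "x < n" for x
    using slopes_loadedD(3)[of s j x] s that j unfolding counting_def lists_done_def w_def by blast
  define m' where "m' = lists_at NXT s j m"
  have adj: "adjacent ({..<n} - {j}) j m m'"
    using s j m by (simp add: counting_def lists_done_def m'_def)
  have nxt: "nmem s NXT (j * w + m) = m'"
    using w[of m] m by (simp add: m'_def lists_at_def table_def w_def)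
  define u where "u = (if v = n \<or> \<sigma> j m \<noteq> \<sigma> j v then m else v)"
  have u: "u \<le> n" using v m by (simp add: u_def)
  have cell: "nmem s CNT (j * w + u) = ct j u"
    using w[OF u] by (simp add: ct_def lists_at_def table_def w_def)
  have test: "run (Cond (BAnd (BNot (Equal (Var V_VAR) Size))
            (REqual (RRead SLOPE (Entry (Var I_VAR) (Var A_VAR))) (RRead SLOPE (Entry (Var I_VAR) (Var V_VAR)))))
          Skip (Assign V_VAR (Var A_VAR))) s = (if u = v then s else nwrite V_VAR 0 u s)"
    using slope[OF m(1)] slope[of v] v m by (auto simp: j size defs u_def)
  have e: "run count_step s = nwrite A_VAR 0 m' (nwrite CNT (j * w + u) (ct j u + 1)
      (nwrite LEAD (j * w + m) u (if u = v then s else nwrite V_VAR 0 u s)))"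
    unfolding count_step_def run.simps(4) test using cell by (cases "u = v") (simp_all add: j size defs nxt)
  have lists: "lists_at LEAD (run count_step s) = ld(j := (ld j)(m := u))"
    "lists_at CNT (run count_step s) = ct(j := (ct j)(u := ct j u + 1))"
    "lists_at NXT (run count_step s) = lists_at NXT s"
    using w[of m] w[OF u] m by (simp_all add: e lists_at_def defs table_upd ld_def ct_def)
  have regs: "nmem (run count_step s) A_VAR 0 = m'" "nmem (run count_step s) V_VAR 0 = u"
    "nmem (run count_step s) I_VAR 0 = j"
    using j by (simp_all add: e v_def)
  have "slopes_loaded n \<sigma> (run count_step s)"
    using s by (subst slopes_loaded_run) (simp_all add: count_step_def counting_def lists_done_def)
  then have lists_kept: "lists_done (run count_step s)"
    using s by (simp add: lists_done_def counting_def lists)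
  have g': "grouped j m' u ((ld j)(m := u)) ((ct j)(u := ct j u + 1))"
    using grouped_step[OF g adj m(1)] unfolding u_def .
  have sm: "seen j m' = insert m (seen j m)" "m \<notin> seen j m" using seen_step[OF adj m(1)] by blast+
  have fin: "finite (seen j m)" by (simp add: seen_def)
  have "seen j m' \<subseteq> {..<n}" by (auto simp: seen_def)
  then have "card (seen j m') \<le> n" using card_mono[of "{..<n}" "seen j m'"] by simp
  then have decr: "n - card (seen j m') < k" using k sm fin by simp
  have m': "m' \<in> insert (n + 1) ({..<n} - {j})" using adj by (simp add: adjacent_def)
  have rows: "(i < j \<longrightarrow> (\<exists>v. grouped i (n + 1) v (lists_at LEAD (run count_step s) i) (lists_at CNT (run count_step s) i))) \<and>
      (j < i \<longrightarrow> (\<forall>l<n. lists_at CNT (run count_step s) i l = 0))" if "i < n" for i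
    using s that unfolding lists by (simp add: counting_def ld_def ct_def)
  have current: "grouped j m' u (lists_at LEAD (run count_step s) j) (lists_at CNT (run count_step s) j)"
    using g' by (simp add: lists)
  have "counting j (n - card (seen j m')) (run count_step s)"
    unfolding counting_def regs using lists_kept j m' u rows current by blast
  then show ?thesis using decr by blast
qed

lemma count_line_correct:
  assumes "j < n"
  shows "triple (\<lambda>s. counted j s \<and> nmem s I_VAR 0 = j) count_line (300 * (n + 1)) (counted (Suc j))"
  unfolding count_line_def
proof (rule triple_Seq)
  show "triple (\<lambda>s. counted j s \<and> nmem s I_VAR 0 = j) count_line_start 50 (counting j n)"
  proof (rule triple_loop_free)
    fix s assume s: "counted j s \<and> nmem s I_VAR 0 = j"
    define w where "w = nmem s WIDTH 0"
    define m where "m = lists_at NXT s j n"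
    have size: "nmem s 0 0 = n" and w: "n < w"
      using s by (auto simp: counted_def lists_done_def slopes_loaded_def w_def)
    have adj: "adjacent ({..<n} - {j}) j n m"
      using s assms by (simp add: counted_def lists_done_def m_def)
    have e: "run count_line_start s = nwrite V_VAR 0 n (nwrite A_VAR 0 m s)"
      using s w by (simp add: count_line_start_def size m_def lists_at_def table_def w_def[symmetric])
    have lists: "lists_at a (run count_line_start s) = lists_at a s" if "a \<in> {LEAD, CNT, NXT}" for a
      using that by (auto simp: e lists_at_def)
    have regs: "nmem (run count_line_start s) A_VAR 0 = m" "nmem (run count_line_start s) V_VAR 0 = n"
      "nmem (run count_line_start s) I_VAR 0 = j"
      using s by (simp_all add: e)
    have "slopes_loaded n \<sigma> (run count_line_start s)"
      using s by (subst slopes_loaded_run) (simp_all add: count_line_start_def counted_def lists_done_def)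
    then have lists_kept: "lists_done (run count_line_start s)"
      using s by (simp add: lists_done_def counted_def lists)
    have g: "grouped j m n (lists_at LEAD s j) (lists_at CNT s j)"
      using s assms by (intro grouped_start[OF adj]) (simp add: counted_def)
    have "seen j m = {}" using g by (simp add: grouped_def)
    moreover have "m \<in> insert (n + 1) ({..<n} - {j})" using adj by (simp add: adjacent_def)
    moreover have "(i < j \<longrightarrow> (\<exists>v. grouped i (n + 1) v (lists_at LEAD s i) (lists_at CNT s i))) \<and>
        (j < i \<longrightarrow> (\<forall>l<n. lists_at CNT s i l = 0))" if "i < n" for i
      using s that by (simp add: counted_def)
    ultimately show "counting j n (run count_line_start s)"
      unfolding counting_def regs using lists_kept assms g by (simp add: lists)
  qed (simp_all add: count_line_start_def)
  have size: "nmem s 0 0 = n" if "counting j k s" for k s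
    using that slopes_loadedD(1) unfolding counting_def lists_done_def by blast
  have "triple (\<lambda>s. counting j k s \<and> bval s (Less (Var A_VAR) Size)) count_step 100 (\<lambda>s. \<exists>l<k. counting j l s)" for k
  proof (rule triple_loop_free)
    fix s assume s: "counting j k s \<and> bval s (Less (Var A_VAR) Size)"
    then have "nmem s A_VAR 0 < n" using size[of k s] by simp
    then show "\<exists>l<k. counting j l (run count_step s)" using count_step_correct s by blast
  qed (simp_all add: count_step_def)
  from triple_While[OF this order_refl]
  show "triple (counting j n) (While (Less (Var A_VAR) Size) count_step) (200 * (n + 1)) (counted (Suc j))"
  proof (rule triple_conseq)
    fix s assume *: "(\<exists>l. counting j l s) \<and> \<not> bval s (Less (Var A_VAR) Size)"
    then obtain l where s: "counting j l s" by blast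
    then have "n \<le> nmem s A_VAR 0" using size[OF s] * by simp
    moreover have "nmem s A_VAR 0 \<in> insert (n + 1) ({..<n} - {j})" using s unfolding counting_def by blast
    ultimately have a: "nmem s A_VAR 0 = n + 1" by simp
    have "\<exists>v. grouped j (n + 1) v (lists_at LEAD s j) (lists_at CNT s j)"
      using s a unfolding counting_def by metis
    then show "counted (Suc j) s"
      using s unfolding counted_def counting_def by (simp add: less_Suc_eq)
  qed (simp_all, linarith)
qed simp

lemma count_degrees_correct:
  "triple (\<lambda>s. lists_state 0 s \<and> nmem s CNT = (\<lambda>_. 0)) count_degrees (400 * (n + 1) ^ 2) degrees_loaded"
proof -
  have frame: "counted k (nwrite I_VAR 0 x s)" if "counted k s" for k x s
    using that by (simp add: counted_def lists_done_def slopes_loaded_nwrite lists_at_nwrite)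
  have size: "nmem s 0 0 = n" if "counted k s" for k s
    using that slopes_loadedD(1) unfolding counted_def lists_done_def by blast
  have "triple (counted 0) count_degrees (400 * (n + 1) ^ 2) (counted n)"
    unfolding count_degrees_def
    by (rule triple_For[where T = "300 * (n + 1)" and N = n, OF _ _ _ count_line_correct])
      (simp_all add: frame size count_line_def count_line_start_def count_step_def
        power2_eq_square algebra_simps)
  then show ?thesis
  proof (rule triple_conseq)
    fix s assume s: "lists_state 0 s \<and> nmem s CNT = (\<lambda>_. 0)"
    have "{0..<n} = {..<n}" by auto
    then show "counted 0 s"
      using s by (simp add: counted_def lists_done_def lists_state_def linked_def lists_at_def table_def)
  next
    fix s assume s: "counted n s"
    show "degrees_loaded s"
      unfolding degrees_loaded_def
    proof (intro conjI allI impI)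
      show "slopes_loaded n \<sigma> s" using s by (simp add: counted_def lists_done_def)
      fix i j assume ij: "i < n" "j < n" "i \<noteq> j"
      have w: "x < nmem s WIDTH 0" if "x < n" for x
        using s that by (simp add: counted_def lists_done_def slopes_loaded_def)
      obtain v where g: "grouped i (n + 1) v (lists_at LEAD s i) (lists_at CNT s i)"
        using s ij by (auto simp: counted_def)
      have "lists_at LEAD s i j < n" using grouped_end(2)[OF g ij(2)] ij(3) by simp
      then show "nmem s CNT (i * nmem s WIDTH 0 + nmem s LEAD (i * nmem s WIDTH 0 + j)) + 1 = degree i j"
        using grouped_end(1)[OF g ij(2)] ij w by (simp add: lists_at_def table_def)
    qed
  qed simp
qed

end

section \<open>The adjacency matrix of ordinary pairs\<close>

abbreviation Cnt :: "nat \<Rightarrow> nat \<Rightarrow> nexp" where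
  "Cnt i j \<equiv> NRead CNT (Entry (Var i) (NRead LEAD (Entry (Var i) (Var j))))"

text \<open>The counter counts the points on the line other than the first one, hence the added 1.\<close>

definition ordinary_test :: "nat \<Rightarrow> nat \<Rightarrow> bexp" where
  "ordinary_test i j = BAnd (BNot (Equal (Var i) (Var j))) (NLe (NAdd (Cnt i j) (NConst 1)) (NRead 0 (NConst 1)))"

definition adjacency_cell :: com where
  "adjacency_cell = Cond (ordinary_test I_VAR J_VAR)
    (Seq (RWrite 20 (NAdd (NMul (Var I_VAR) Size) (Var J_VAR)) (ROfNat (NConst 1)))
         (RWrite 21 (NAdd (NMul (Var I_VAR) Size) (Var J_VAR)) (ROfNat (NConst 1)))) Skip"

text \<open>Both factors of the product are the adjacency matrix. Only its nonzero entries are written.\<close>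

definition load_adjacency :: com where
  "load_adjacency = Seq (Assign 20 Size) (For I_VAR Size (For J_VAR Size adjacency_cell))"

context slope_system
begin

definition prepared :: "nat \<Rightarrow> ram_state \<Rightarrow> bool" where
  "prepared \<tau> s \<longleftrightarrow> degrees_loaded s \<and> nmem s 0 1 = \<tau>"

lemma ordinary_test:
  assumes "prepared \<tau> s" "nmem s a 0 = i" "nmem s b 0 = j" "i < n" "j < n"
  shows "bval s (ordinary_test a b) \<longleftrightarrow> ordinary_pair \<tau> i j"
    and "i \<noteq> j \<Longrightarrow> nval s (Cnt a b) = card (same_line i j)"
proof -
  have cnt: "nval s (Cnt a b) + 1 = degree i j" if "i \<noteq> j"
    using assms that by (simp add: prepared_def degrees_loaded_def)
  then show "i \<noteq> j \<Longrightarrow> nval s (Cnt a b) = card (same_line i j)" by (simp add: degree_def)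
  have "bval s (ordinary_test a b) \<longleftrightarrow> i \<noteq> j \<and> nval s (Cnt a b) + 1 \<le> \<tau>"
    using assms by (auto simp: ordinary_test_def prepared_def)
  then show "bval s (ordinary_test a b) \<longleftrightarrow> ordinary_pair \<tau> i j"
    using cnt by (auto simp: ordinary_pair_def)
qed

lemma prepared_cong:
  assumes "nmem s' 0 = nmem s 0" "nmem s' WIDTH = nmem s WIDTH" "nmem s' CNT = nmem s CNT"
    "nmem s' LEAD = nmem s LEAD" "rmem s' SLOPE = rmem s SLOPE"
  shows "prepared \<tau> s' = prepared \<tau> s"
  using assms by (simp add: prepared_def degrees_loaded_def slopes_loaded_def)

definition adjacency :: "nat \<Rightarrow> real mat" where
  "adjacency \<tau> = mat n n (\<lambda>(i, j). if ordinary_pair \<tau> i j then 1 else 0)"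

lemma load_adjacency_correct:
  "triple (\<lambda>s. prepared \<tau> s \<and> upper_part 20 s = \<lparr>nmem = (\<lambda>_ _. 0), rmem = (\<lambda>_ _. 0)\<rparr>)
    load_adjacency (300 * (n + 1) ^ 2)
    (\<lambda>s. prepared \<tau> s \<and> upper_part 20 s = matmul_input (n, adjacency \<tau>, adjacency \<tau>))"
proof -
  define input where "input D = \<lparr>nmem = (\<lambda>a i. if a = 0 \<and> i = 0 then n else 0),
    rmem = (\<lambda>a i. if (a = 0 \<or> a = 1) \<and> i < n * n \<and> D (i div n) (i mod n) \<and> ordinary_pair \<tau> (i div n) (i mod n)
      then 1 else 0)\<rparr>" for D :: "nat \<Rightarrow> nat \<Rightarrow> bool"
  define filled where "filled D s \<longleftrightarrow> prepared \<tau> s \<and> upper_part 20 s = input D" for D and s :: ram_state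
  have size: "nmem s 0 0 = n" if "filled D s" for D and s :: ram_state
    using that by (simp add: filled_def prepared_def degrees_loaded_def slopes_loaded_def)
  have low: "filled D (nwrite a i x s)" if "filled D s" "a = I_VAR \<or> a = J_VAR" for D a i x s
  proof -
    have "prepared \<tau> (nwrite a i x s) = prepared \<tau> s" using that(2) by (intro prepared_cong) auto
    moreover have "upper_part 20 (nwrite a i x s) = upper_part 20 s"
      using that(2) by (auto simp: upper_part_def)
    ultimately show ?thesis using that(1) by (simp add: filled_def)
  qed
  have up: "upper_part 20 (rwrite 20 k x (s :: ram_state)) = rwrite 0 k x (upper_part 20 s)"
    "upper_part 20 (rwrite 21 k x s) = rwrite 1 k x (upper_part 20 s)"
    "upper_part 20 (nwrite 20 k y s) = nwrite 0 k y (upper_part 20 s)" for k x y and s :: ram_state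
    using upper_part_rwrite[of 20 0 k x s] upper_part_rwrite[of 20 1 k x s] upper_part_nwrite[of 20 0 k y s]
    by simp_all
  have cell: "input (\<lambda>i' j'. i' < i \<or> i' = i \<and> j' < Suc j) =
      (if ordinary_pair \<tau> i j then rwrite 1 (i * n + j) 1 (rwrite 0 (i * n + j) 1 (input (\<lambda>i' j'. i' < i \<or> i' = i \<and> j' < j)))
       else input (\<lambda>i' j'. i' < i \<or> i' = i \<and> j' < j))" if "i < n" "j < n" for i j
  proof -
    have *: "k div n = i \<and> k mod n = j \<longleftrightarrow> k = i * n + j" for k
      using that by (auto simp: div_mult_mod_eq)
    have "i * n + j < n * n" using table_index_less that by blast
    then show ?thesis
      using that *
      by (auto simp: input_def rwrite_def fun_eq_iff less_Suc_eq)
  qed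
  define I2 where "I2 i j s \<longleftrightarrow> filled (\<lambda>i' j'. i' < i \<or> i' = i \<and> j' < j) s \<and> nmem s I_VAR 0 = i"
    for i j and s :: ram_state
  define I1 where "I1 i s \<longleftrightarrow> filled (\<lambda>i' j'. i' < i) s" for i and s :: ram_state
  have body: "triple (\<lambda>s. I2 i j s \<and> nmem s J_VAR 0 = j) adjacency_cell 100 (I2 i (Suc j))"
    if "i < n" "j < n" for i j
  proof (rule triple_loop_free)
    fix s assume s: "I2 i j s \<and> nmem s J_VAR 0 = j"
    then have p: "prepared \<tau> s" and sz: "nmem s 0 0 = n"
      and u: "upper_part 20 s = input (\<lambda>i' j'. i' < i \<or> i' = i \<and> j' < j)"
      using size by (auto simp: I2_def filled_def)
    have t: "bval s (ordinary_test I_VAR J_VAR) \<longleftrightarrow> ordinary_pair \<tau> i j"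
      using s that by (intro ordinary_test[OF p]) (simp_all add: I2_def)
    have "run adjacency_cell s = (if ordinary_pair \<tau> i j
        then rwrite 21 (i * n + j) 1 (rwrite 20 (i * n + j) 1 s) else s)"
      using s t by (simp add: adjacency_cell_def I2_def sz)
    moreover have "prepared \<tau> (rwrite 21 (i * n + j) 1 (rwrite 20 (i * n + j) 1 s)) = prepared \<tau> s"
      by (intro prepared_cong) auto
    ultimately show "I2 i (Suc j) (run adjacency_cell s)"
      using s by (simp add: I2_def filled_def up cell[OF that])
  qed (simp_all add: adjacency_cell_def ordinary_test_def)
  have row: "triple (I2 i 0) (For J_VAR Size adjacency_cell) (120 * (n + 1)) (I2 i n)" if "i < n" for i
    by (rule triple_For[where T = 100 and N = n, OF _ _ _ body[OF that]])
      (use low size in \<open>auto simp: I2_def adjacency_cell_def\<close>)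
  have input_cong: "input D = input D'" if "\<And>i j. i < n \<Longrightarrow> j < n \<Longrightarrow> D i j = D' i j" for D D'
  proof -
    have "k < n * n \<Longrightarrow> D (k div n) (k mod n) = D' (k div n) (k mod n)" for k
      using that[of "k div n" "k mod n"] by (cases n) (auto simp: less_mult_imp_div_less)
    then show ?thesis unfolding input_def by (auto simp: fun_eq_iff)
  qed
  have row_end: "input (\<lambda>i' j'. i' < i \<or> i' = i \<and> j' < n) = input (\<lambda>i' j'. i' < Suc i)" for i
    by (rule input_cong) auto
  have step: "triple (\<lambda>s. I1 i s \<and> nmem s I_VAR 0 = i) (For J_VAR Size adjacency_cell) (120 * (n + 1)) (I1 (Suc i))"
    if "i < n" for i
    by (rule triple_conseq[OF row[OF that]]) (auto simp: I1_def I2_def filled_def row_end)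
  have loop: "triple (I1 0) (For I_VAR Size (For J_VAR Size adjacency_cell)) (150 * (n + 1) ^ 2) (I1 n)"
    by (rule triple_For[where T = "120 * (n + 1)" and N = n, OF _ _ _ step])
      (use low size in \<open>auto simp: I1_def adjacency_cell_def power2_eq_square algebra_simps\<close>)
  have start: "triple (\<lambda>s. prepared \<tau> s \<and> upper_part 20 s = \<lparr>nmem = (\<lambda>_ _. 0), rmem = (\<lambda>_ _. 0)\<rparr>)
      (Assign 20 Size) 10 (I1 0)"
  proof (rule triple_loop_free)
    fix s :: ram_state assume s: "prepared \<tau> s \<and> upper_part 20 s = \<lparr>nmem = (\<lambda>_ _. 0), rmem = (\<lambda>_ _. 0)\<rparr>"
    then have "nmem s 0 0 = n" by (simp add: prepared_def degrees_loaded_def slopes_loaded_def)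
    then have "run (Assign 20 Size) s = nwrite 20 0 n s" by simp
    moreover have "prepared \<tau> (nwrite 20 0 n s) = prepared \<tau> s" by (intro prepared_cong) auto
    moreover have "nwrite 0 0 n \<lparr>nmem = (\<lambda>_ _. 0), rmem = (\<lambda>_ _. 0)\<rparr> = input (\<lambda>i' j'. i' < 0)"
      by (auto simp: input_def nwrite_def fun_eq_iff)
    ultimately show "I1 0 (run (Assign 20 Size) s)"
      using s by (simp add: I1_def filled_def up)
  qed simp_all
  have "input (\<lambda>i' j'. i' < n) = matmul_input (n, adjacency \<tau>, adjacency \<tau>)"
  proof -
    have "k div n < n" "k mod n < n" if "k < n * n" for k
      using that by (cases n; auto simp: less_mult_imp_div_less)+
    then show ?thesis by (auto simp: input_def matmul_input_def adjacency_def fun_eq_iff)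
  qed
  then have filled_end: "I1 n s \<Longrightarrow> prepared \<tau> s \<and> upper_part 20 s = matmul_input (n, adjacency \<tau>, adjacency \<tau>)" for s
    by (simp add: I1_def filled_def)
  have "triple (\<lambda>s. prepared \<tau> s \<and> upper_part 20 s = \<lparr>nmem = (\<lambda>_ _. 0), rmem = (\<lambda>_ _. 0)\<rparr>)
      load_adjacency (300 * (n + 1) ^ 2) (I1 n)"
    unfolding load_adjacency_def by (rule triple_Seq[OF start loop]) (simp add: power2_eq_square algebra_simps)
  then show ?thesis by (rule triple_conseq) (use filled_end in auto)
qed

end

section \<open>Counting and finding triangles\<close>

text \<open>The real cell 2 accumulates the sum over all ordered pairs; the last pair with a
  positive summand is remembered. One less than the number of other points on the line is subtracted.\<close>

definition sum_cell :: com where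
  "sum_cell = Cond (ordinary_test I_VAR J_VAR)
    (Seq (RWrite DIFF (NConst 0) (RSub
        (RAdd (RRead 22 (NAdd (NMul (Var I_VAR) Size) (Var J_VAR))) (ROfNat (NConst 1)))
        (ROfNat (Cnt I_VAR J_VAR))))
    (Seq (RWrite 2 (NConst 0) (RAdd (RRead 2 (NConst 0)) (RRead DIFF (NConst 0))))
    (Cond (RLess (ROfNat (NConst 0)) (RRead DIFF (NConst 0)))
      (Seq (Assign P_VAR (Var I_VAR)) (Seq (Assign Q_VAR (Var J_VAR)) (Assign 1 (NConst 1)))) Skip))) Skip"

definition sum_cells :: com where
  "sum_cells = For I_VAR Size (For J_VAR Size sum_cell)"

text \<open>For a pair \<open>P\<close>, \<open>Q\<close> with a positive summand, the last third vertex is kept.\<close>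

definition search_step :: com where
  "search_step = Cond (BAnd (ordinary_test P_VAR I_VAR) (BAnd (ordinary_test Q_VAR I_VAR)
      (BNot (REqual (RRead SLOPE (Entry (Var P_VAR) (Var I_VAR))) (RRead SLOPE (Entry (Var P_VAR) (Var Q_VAR)))))))
    (Assign R_VAR (Var I_VAR)) Skip"

definition report :: com where
  "report = Seq (RWrite 2 (NConst 0) (RDiv (RRead 2 (NConst 0)) (ROfNat (NConst 6))))
    (Seq (NWrite 1 (NConst 1) (NRead PERM (Var P_VAR)))
    (Seq (NWrite 1 (NConst 2) (NRead PERM (Var Q_VAR)))
         (NWrite 1 (NConst 3) (NRead PERM (Var R_VAR)))))"

definition search :: com where
  "search = For I_VAR Size search_step"

context slope_system
begin

definition third_points :: "nat \<Rightarrow> nat \<Rightarrow> nat \<Rightarrow> nat set" where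
  "third_points \<tau> i j = {k. k < n \<and> triangle_indices \<tau> i j k}"

text \<open>The matrix product is found in array 22, the shifted output array 2.\<close>

definition product_loaded :: "nat \<Rightarrow> ram_state \<Rightarrow> bool" where
  "product_loaded \<tau> s \<longleftrightarrow> prepared \<tau> s \<and> (\<forall>i<n. \<forall>j<n. rmem s 22 (i * n + j) =
    real (card {k. k < n \<and> ordinary_pair \<tau> i k \<and> ordinary_pair \<tau> k j}))"

definition found :: "nat \<Rightarrow> ram_state \<Rightarrow> bool" where
  "found \<tau> s \<longleftrightarrow> nmem s 1 0 = 1 \<and> nmem s P_VAR 0 < n \<and> nmem s Q_VAR 0 < n \<and>
    third_points \<tau> (nmem s P_VAR 0) (nmem s Q_VAR 0) \<noteq> {}"

definition summed :: "nat \<Rightarrow> ram_state \<Rightarrow> bool" where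
  "summed \<tau> s \<longleftrightarrow> prepared \<tau> s \<and> rmem s 2 0 = real (\<Sum>i<n. \<Sum>j<n. card (third_points \<tau> i j)) \<and>
    (found \<tau> s \<or> nmem s 1 0 = 0 \<and> (\<forall>i<n. \<forall>j<n. third_points \<tau> i j = {}))"

lemma product_eq:
  assumes "i < n" "j < n"
  shows "(adjacency \<tau> * adjacency \<tau>) $$ (i, j) =
    real (card {k. k < n \<and> ordinary_pair \<tau> i k \<and> ordinary_pair \<tau> k j})"
proof -
  have "(adjacency \<tau> * adjacency \<tau>) $$ (i, j) =
      (\<Sum>k<n. if ordinary_pair \<tau> i k \<and> ordinary_pair \<tau> k j then 1 else 0)"
    using assms by (simp add: adjacency_def scalar_prod_def atLeast0LessThan) (rule sum.cong, auto)
  also have "\<dots> = real (card {k \<in> {..<n}. ordinary_pair \<tau> i k \<and> ordinary_pair \<tau> k j})"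
    by (simp add: sum.If_cases Int_def)
  also have "{k \<in> {..<n}. ordinary_pair \<tau> i k \<and> ordinary_pair \<tau> k j} =
      {k. k < n \<and> ordinary_pair \<tau> i k \<and> ordinary_pair \<tau> k j}" by auto
  finally show ?thesis .
qed

text \<open>Only joined pairs contribute, so the sum may be taken over all pairs.\<close>

lemma third_points_empty: "\<not> ordinary_pair \<tau> i j \<Longrightarrow> third_points \<tau> i j = {}"
  by (auto simp: third_points_def triangle_indices_def)

lemma finite_third_points [simp]: "finite (third_points \<tau> i j)"
  by (simp add: third_points_def)

end

context sorted_points
begin

lemma sum_cell_run:
  assumes p: "product_loaded \<tau> s" and ij: "nmem s I_VAR 0 = i" "nmem s J_VAR 0 = j" "i < n" "j < n"
  shows "run sum_cell s = (if ordinary_pair \<tau> i j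
    then (let d = real (card (third_points \<tau> i j));
              s' = rwrite 2 0 (rmem s 2 0 + d) (rwrite DIFF 0 d s)
          in if third_points \<tau> i j = {} then s' else nwrite 1 0 1 (nwrite Q_VAR 0 j (nwrite P_VAR 0 i s')))
    else s)"
proof (cases "ordinary_pair \<tau> i j")
  case True
  have prep: "prepared \<tau> s" and size: "nmem s 0 0 = n"
    using p by (auto simp: product_loaded_def prepared_def degrees_loaded_def slopes_loaded_def)
  have test: "bval s (ordinary_test I_VAR J_VAR)"
    using ordinary_test(1)[OF prep ij] True by simp
  have cnt: "nval s (Cnt I_VAR J_VAR) = card (same_line i j)"
    using ordinary_test(2)[OF prep ij] True by (simp add: ordinary_pair_def)
  have "rmem s 22 (i * n + j) = real (card {k. k < n \<and> ordinary_pair \<tau> i k \<and> ordinary_pair \<tau> k j})"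
    using p ij by (simp add: product_loaded_def)
  moreover have "card {k. k < n \<and> ordinary_pair \<tau> i k \<and> ordinary_pair \<tau> k j} + 1 =
      card (third_points \<tau> i j) + card (same_line i j)"
    using card_common_neighbours[OF ij(3,4) True] by (simp add: third_points_def)
  ultimately have d: "rmem s 22 (i * n + j) + 1 - real (nval s (Cnt I_VAR J_VAR)) = real (card (third_points \<tau> i j))"
    unfolding cnt by linarith
  show ?thesis
    using True test d by (simp add: sum_cell_def ij size Let_def card_gt_0_iff)
next
  case False
  have "prepared \<tau> s" using p by (simp add: product_loaded_def)
  then show ?thesis using ordinary_test(1)[of \<tau> s, OF _ ij] False by (simp add: sum_cell_def)
qed

lemma sum_cells_correct:
  "triple (\<lambda>s. product_loaded \<tau> s \<and> rmem s 2 0 = 0 \<and> nmem s 1 0 = 0) sum_cells (300 * (n + 1) ^ 2) (summed \<tau>)"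
proof -
  define K where "K A D s \<longleftrightarrow> product_loaded \<tau> s \<and> rmem s 2 0 = real A \<and>
    (found \<tau> s \<or> nmem s 1 0 = 0 \<and> (\<forall>i<n. \<forall>j<n. D i j \<longrightarrow> third_points \<tau> i j = {}))"
    for A D and s :: ram_state
  have size: "nmem s 0 0 = n" if "K A D s" for A D s
    using that unfolding K_def product_loaded_def prepared_def degrees_loaded_def slopes_loaded_def by blast
  have prep: "prepared \<tau> (nwrite b i x s) = prepared \<tau> s" if "b \<in> {I_VAR, J_VAR, P_VAR, Q_VAR, 1}" for b i x s
    using that by (intro prepared_cong) auto
  have prep_r: "prepared \<tau> (rwrite b i x s) = prepared \<tau> s" if "b \<in> {2, DIFF}" for b i x s
    using that by (intro prepared_cong) auto
  have frame: "K A D (nwrite b 0 x s)" if "K A D s" "b \<in> {I_VAR, J_VAR}" for A D b x s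
    using that by (auto simp: K_def product_loaded_def found_def prep)
  let ?f = "\<lambda>i j. card (third_points \<tau> i j)"
  let ?D = "\<lambda>i j i' j'. i' < i \<or> i' = i \<and> j' < j"
  define I2 where "I2 i j s \<longleftrightarrow> K ((\<Sum>i'<i. \<Sum>j'<n. ?f i' j') + (\<Sum>j'<j. ?f i j')) (?D i j) s \<and> nmem s I_VAR 0 = i"
    for i j and s :: ram_state
  define I1 where "I1 i s \<longleftrightarrow> K (\<Sum>i'<i. \<Sum>j'<n. ?f i' j') (\<lambda>i' j'. i' < i) s" for i and s :: ram_state
  have body: "triple (\<lambda>s. I2 i j s \<and> nmem s J_VAR 0 = j) sum_cell 200 (I2 i (Suc j))"
    if "i < n" "j < n" for i j
  proof (rule triple_loop_free)
    fix s assume s: "I2 i j s \<and> nmem s J_VAR 0 = j"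
    then have p: "product_loaded \<tau> s" by (simp add: I2_def K_def)
    have run: "run sum_cell s = (if ordinary_pair \<tau> i j
        then (let d = real (?f i j); s' = rwrite 2 0 (rmem s 2 0 + d) (rwrite DIFF 0 d s)
          in if third_points \<tau> i j = {} then s' else nwrite 1 0 1 (nwrite Q_VAR 0 j (nwrite P_VAR 0 i s')))
        else s)"
      using s that by (intro sum_cell_run[OF p]) (simp_all add: I2_def)
    have D: "?D i (Suc j) i' j' \<longleftrightarrow> ?D i j i' j' \<or> i' = i \<and> j' = j" for i' j' by auto
    consider "\<not> ordinary_pair \<tau> i j" | "ordinary_pair \<tau> i j" "third_points \<tau> i j = {}"
      | "ordinary_pair \<tau> i j" "third_points \<tau> i j \<noteq> {}" by blast
    then show "I2 i (Suc j) (run sum_cell s)"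
    proof cases
      case 1
      then show ?thesis
        using s run third_points_empty[OF 1] unfolding I2_def K_def D by auto
    next
      case 2
      then have e: "run sum_cell s = rwrite 2 0 (rmem s 2 0 + 0) (rwrite DIFF 0 0 s)" using run by (simp add: Let_def)
      have "product_loaded \<tau> (run sum_cell s)"
        using p unfolding e by (simp add: product_loaded_def prep_r)
      moreover have "found \<tau> (run sum_cell s) = found \<tau> s" by (simp add: e found_def)
      moreover have "nmem (run sum_cell s) = nmem s" "rmem (run sum_cell s) 2 0 = rmem s 2 0" by (simp_all add: e)
      ultimately show ?thesis
        using s 2 unfolding I2_def K_def D by auto
    next
      case 3
      then have e: "run sum_cell s = nwrite 1 0 1 (nwrite Q_VAR 0 j (nwrite P_VAR 0 i
          (rwrite 2 0 (rmem s 2 0 + real (?f i j)) (rwrite DIFF 0 (real (?f i j)) s))))"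
        using run by (simp add: Let_def)
      have "product_loaded \<tau> (run sum_cell s)"
        using p unfolding e by (simp add: product_loaded_def prep prep_r)
      moreover have "found \<tau> (run sum_cell s)" using 3 that by (simp add: e found_def)
      moreover have "rmem (run sum_cell s) 2 0 = rmem s 2 0 + real (?f i j)" "nmem (run sum_cell s) I_VAR 0 = nmem s I_VAR 0"
        by (simp_all add: e)
      ultimately show ?thesis
        using s unfolding I2_def K_def by simp
    qed
  qed (simp_all add: sum_cell_def ordinary_test_def)
  have size2: "nval s Size = n" if "I2 i j s" for i j s
    using that size unfolding I2_def by auto
  have frame2: "I2 i j (nwrite J_VAR 0 x s)" if "I2 i j s" for i j x s
    using that by (simp add: I2_def frame)
  have row: "triple (I2 i 0) (For J_VAR Size sum_cell) (220 * (n + 1)) (I2 i n)" if "i < n" for i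
    by (rule triple_For[where T = 200 and N = n, OF _ size2 frame2 body[OF that]])
      (simp_all add: sum_cell_def)
  have step: "triple (\<lambda>s. I1 i s \<and> nmem s I_VAR 0 = i) (For J_VAR Size sum_cell) (220 * (n + 1)) (I1 (Suc i))"
    if "i < n" for i
  proof (rule triple_conseq[OF row[OF that]])
    show "I2 i 0 s" if "I1 i s \<and> nmem s I_VAR 0 = i" for s
      using that by (simp add: I1_def I2_def)
    show "I1 (Suc i) s" if "I2 i n s" for s
    proof -
      have "?D i n i' j' \<longleftrightarrow> i' < Suc i" if "j' < n" for i' j' using that by auto
      then show ?thesis using that unfolding I1_def I2_def K_def by simp
    qed
  qed simp
  have size1: "nval s Size = n" if "I1 i s" for i s
    using that size unfolding I1_def by auto
  have frame1: "I1 i (nwrite I_VAR 0 x s)" if "I1 i s" for i x s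
    using that by (simp add: I1_def frame)
  have "triple (I1 0) sum_cells (300 * (n + 1) ^ 2) (I1 n)"
    unfolding sum_cells_def
    by (rule triple_For[where T = "220 * (n + 1)" and N = n, OF _ size1 frame1 step])
      (simp_all add: sum_cell_def power2_eq_square algebra_simps)
  then show ?thesis
    by (rule triple_conseq) (simp_all add: I1_def K_def summed_def product_loaded_def)
qed

lemma search_correct:
  "triple (summed \<tau>) search (300 * (n + 1))
    (\<lambda>s. summed \<tau> s \<and> (found \<tau> s \<longrightarrow> nmem s R_VAR 0 \<in> third_points \<tau> (nmem s P_VAR 0) (nmem s Q_VAR 0)))"
proof -
  define K where "K k s \<longleftrightarrow> summed \<tau> s \<and> (found \<tau> s \<longrightarrow>
    (\<exists>l<k. l \<in> third_points \<tau> (nmem s P_VAR 0) (nmem s Q_VAR 0)) \<longrightarrow>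
    nmem s R_VAR 0 \<in> third_points \<tau> (nmem s P_VAR 0) (nmem s Q_VAR 0))" for k s
  have prep: "prepared \<tau> (nwrite b i x s) = prepared \<tau> s" if "b \<in> {I_VAR, R_VAR}" for b i x s
    using that by (intro prepared_cong) auto
  have fnd: "found \<tau> (nwrite b i x s) = found \<tau> s" if "b \<in> {I_VAR, R_VAR}" for b i x s
    using that by (auto simp: found_def)
  have smd: "summed \<tau> (nwrite b i x s) = summed \<tau> s" if "b \<in> {I_VAR, R_VAR}" for b i x s
    using that fnd[OF that] by (auto simp: summed_def prep)
  have frame: "K k (nwrite I_VAR 0 x s)" if "K k s" for k x s
    using that by (simp add: K_def smd fnd)
  have size: "nmem s 0 0 = n" if "K k s" for k s
    using that unfolding K_def summed_def prepared_def degrees_loaded_def slopes_loaded_def by blast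
  have body: "triple (\<lambda>s. K k s \<and> nmem s I_VAR 0 = k) search_step 250 (K (Suc k))" if "k < n" for k
  proof (rule triple_loop_free)
    fix s assume s: "K k s \<and> nmem s I_VAR 0 = k"
    let ?P = "nmem s P_VAR 0" and ?Q = "nmem s Q_VAR 0"
    have run: "run search_step s = s \<or> run search_step s = nwrite R_VAR 0 k s"
      using s by (simp add: search_step_def)
    then have same: "summed \<tau> (run search_step s) = summed \<tau> s" "found \<tau> (run search_step s) = found \<tau> s"
      "nmem (run search_step s) P_VAR 0 = ?P" "nmem (run search_step s) Q_VAR 0 = ?Q"
      by (auto simp: smd fnd)
    have "nmem (run search_step s) R_VAR 0 \<in> third_points \<tau> ?P ?Q"
      if f: "found \<tau> s" and l: "l < Suc k" "l \<in> third_points \<tau> ?P ?Q" for l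
    proof -
      have prep: "prepared \<tau> s" using s by (simp add: K_def summed_def)
      then have loaded: "slopes_loaded n slope s" by (simp add: prepared_def degrees_loaded_def)
      have pq: "?P < n" "?Q < n" using f by (auto simp: found_def)
      have k: "nmem s I_VAR 0 = k" using s by simp
      have ord: "ordinary_pair \<tau> ?P ?Q"
        using f third_points_empty[of \<tau> ?P ?Q] unfolding found_def by blast
      have "bval s (BAnd (ordinary_test P_VAR I_VAR) (BAnd (ordinary_test Q_VAR I_VAR)
          (BNot (REqual (RRead SLOPE (Entry (Var P_VAR) (Var I_VAR))) (RRead SLOPE (Entry (Var P_VAR) (Var Q_VAR))))))) \<longleftrightarrow>
          k \<in> third_points \<tau> ?P ?Q"
        using ordinary_test(1)[OF prep refl k pq(1) \<open>k < n\<close>] ordinary_test(1)[OF prep refl k pq(2) \<open>k < n\<close>]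
          slopes_loadedD(3)[OF loaded pq(1) \<open>k < n\<close>] slopes_loadedD(3)[OF loaded pq] k ord \<open>k < n\<close>
        by (auto simp: third_points_def triangle_indices_def)
      then have "nmem (run search_step s) R_VAR 0 = (if k \<in> third_points \<tau> ?P ?Q then k else nmem s R_VAR 0)"
        unfolding search_step_def run.simps(5) using k by simp
      then show ?thesis
        using s f l unfolding K_def by (auto simp: less_Suc_eq)
    qed
    then show "K (Suc k) (run search_step s)"
      using s unfolding K_def same by blast
  qed (simp_all add: search_step_def ordinary_test_def)
  have "triple (K 0) search (300 * (n + 1)) (K n)"
    unfolding search_def
    by (rule triple_For[where T = 250 and N = n, OF _ _ _ body])
      (simp_all add: frame size search_step_def algebra_simps)
  then show ?thesis
  proof (rule triple_conseq)
    show "K 0 s" if "summed \<tau> s" for s using that by (simp add: K_def)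
    show "summed \<tau> s \<and> (found \<tau> s \<longrightarrow> nmem s R_VAR 0 \<in> third_points \<tau> (nmem s P_VAR 0) (nmem s Q_VAR 0))"
      if "K n s" for s
    proof -
      have "\<exists>l<n. l \<in> third_points \<tau> (nmem s P_VAR 0) (nmem s Q_VAR 0)" if "found \<tau> s"
        using that unfolding found_def third_points_def by blast
      then show ?thesis using that unfolding K_def by blast
    qed
  qed simp
qed

lemma card_all_third_points:
  "(\<Sum>i<n. \<Sum>j<n. card (third_points \<tau> i j)) = 6 * card {T. ordinary_triangle points \<tau> T}"
proof -
  have "{(i, j, k). i < n \<and> j < n \<and> k < n \<and> triangle_indices \<tau> i j k} =
      (SIGMA i:{..<n}. SIGMA j:{..<n}. third_points \<tau> i j)"
    by (auto simp: third_points_def)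
  then show ?thesis
    unfolding card_triangle_indices[symmetric] by simp
qed

lemma ex_triangle_iff: "(\<exists>T. ordinary_triangle points \<tau> T) \<longleftrightarrow> (\<exists>i<n. \<exists>j<n. third_points \<tau> i j \<noteq> {})"
proof -
  have "finite points" by (simp add: points_def)
  then have "finite {T. ordinary_triangle points \<tau> T}"
    by (rule finite_subset[rotated, OF finite_Pow_iff[THEN iffD2]]) (auto simp: ordinary_triangle_def)
  then have "(\<exists>T. ordinary_triangle points \<tau> T) \<longleftrightarrow> card {T. ordinary_triangle points \<tau> T} \<noteq> 0" by simp
  also have "\<dots> \<longleftrightarrow> (\<Sum>i<n. \<Sum>j<n. card (third_points \<tau> i j)) \<noteq> 0" by (simp add: card_all_third_points)
  also have "\<dots> \<longleftrightarrow> (\<exists>i<n. \<exists>j<n. third_points \<tau> i j \<noteq> {})" by auto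
  finally show ?thesis .
qed

end

section \<open>The whole algorithm\<close>

definition triangle_program :: "com \<Rightarrow> com" where
  "triangle_program mm =
    Seq sort_points (Seq load_slopes (Seq insert_all (Seq count_degrees (Seq load_adjacency
      (Seq (shift_com 20 mm) (Seq sum_cells (Seq search report)))))))"

lemma targets_sort_points: "nat_targets sort_points \<subseteq> {PERM, I_VAR, J_VAR, R_VAR}" "real_targets sort_points = {}"
  by (auto simp: sort_points_def rank_loop_def)

lemma targets_load_slopes: "nat_targets load_slopes \<subseteq> {WIDTH, I_VAR, J_VAR}" "real_targets load_slopes \<subseteq> {SLOPE}"
  by (auto simp: load_slopes_def slope_cells_def slope_cell_def)

lemma targets_insert_all:
  "nat_targets insert_all \<subseteq> {NXT, PRV, I_VAR, J_VAR, A_VAR, V_VAR, C_VAR, MODE, LAST, CROSSED}"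
  "real_targets insert_all = {}"
  by (auto simp: insert_all_def insert_line_def insert_line_start_def insert_line_end_def walk_step_def)

lemma targets_count_degrees:
  "nat_targets count_degrees \<subseteq> {LEAD, CNT, I_VAR, A_VAR, V_VAR}" "real_targets count_degrees = {}"
  by (auto simp: count_degrees_def count_line_def count_line_start_def count_step_def)

lemma targets_load_adjacency:
  "nat_targets load_adjacency \<subseteq> {20, I_VAR, J_VAR}" "real_targets load_adjacency \<subseteq> {20, 21}"
  by (auto simp: load_adjacency_def adjacency_cell_def)

lemma targets_sum_cells:
  "nat_targets sum_cells \<subseteq> {1, I_VAR, J_VAR, P_VAR, Q_VAR}" "real_targets sum_cells \<subseteq> {2, DIFF}"
  by (auto simp: sum_cells_def sum_cell_def)

lemma targets_search: "nat_targets search \<subseteq> {I_VAR, R_VAR}" "real_targets search = {}"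
  by (auto simp: search_def search_step_def)

lemma exec_frame:
  assumes "exec c s t s'" "nat_targets c \<subseteq> A" "real_targets c \<subseteq> B"
  shows "a \<notin> A \<Longrightarrow> nmem s' a = nmem s a" "b \<notin> B \<Longrightarrow> rmem s' b = rmem s b"
  using exec_nmem_frame[OF assms(1)] exec_rmem_frame[OF assms(1)] assms(2,3) by blast+

lemma total_time_le:
  fixes n :: nat
  assumes "t1 \<le> 200 * (n + 1) ^ 2" "t2 \<le> 300 * (n + 1) ^ 2" "t3 \<le> 2300 * (n + 1) ^ 2"
    "t4 \<le> 400 * (n + 1) ^ 2" "t5 \<le> 300 * (n + 1) ^ 2" "t6 \<le> T" "t7 \<le> 300 * (n + 1) ^ 2"
    "t8 \<le> 300 * (n + 1)" "t9 \<le> 50"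
  shows "t1 + (t2 + (t3 + (t4 + (t5 + (t6 + (t7 + (t8 + t9))))))) \<le> T + 5000 * (n + 1) ^ 2"
proof -
  define N where "N = (n + 1) ^ 2"
  have le: "n + 1 \<le> N" "1 \<le> N" by (simp_all add: N_def power2_eq_square)
  have "t8 \<le> 300 * N" by (rule order.trans[OF assms(8) mult_le_mono2[OF le(1)]])
  moreover have "t9 \<le> 50 * N" by (rule order.trans[OF assms(9)]) (use le(2) in simp)
  ultimately have "t1 + (t2 + (t3 + (t4 + (t5 + (t6 + (t7 + (t8 + t9))))))) \<le>
      200 * N + (300 * N + (2300 * N + (400 * N + (300 * N + (T + (300 * N + (300 * N + 50 * N)))))))"
    by (intro add_mono assms(1-7)[folded N_def])
  also have "\<dots> \<le> T + 5000 * N" by simp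
  finally show ?thesis by (simp add: N_def)
qed

lemma triangle_program_correct:
  assumes mm: "\<forall>x\<in>matmul_instances. \<exists>t s'. exec mm (matmul_input x) t s' \<and> t \<le> T (fst x) \<and> matmul_output x s'"
    and ps: "distinct ps"
  shows "\<exists>t s'. exec (triangle_program mm) (triangle_input (ps, \<tau>)) t s' \<and>
    t \<le> T (length ps) + 5000 * (length ps + 1) ^ 2 \<and> finding_output (ps, \<tau>) s' \<and> counting_output (ps, \<tau>) s'"
proof -
  define n where "n = length ps"
  define p where "p = (\<lambda>i. ps ! i)"
  define s0 where "s0 = triangle_input (ps, \<tau>)"
  have p_inj: "inj_on p {..<n}" using ps by (auto simp: p_def n_def inj_on_def nth_eq_iff_index_eq)
  have s0: "nmem s0 0 0 = n" "nmem s0 0 1 = \<tau>" "\<And>a. a \<noteq> 0 \<Longrightarrow> nmem s0 a = (\<lambda>_. 0)"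
    "\<And>a. a \<noteq> 0 \<Longrightarrow> a \<noteq> 1 \<Longrightarrow> rmem s0 a = (\<lambda>_. 0)"
    by (auto simp: s0_def triangle_input_def n_def)
  have p0: "points_loaded n p s0"
    by (auto simp: points_loaded_def s0 p_def) (auto simp: s0_def triangle_input_def n_def)
  obtain t1 s1 where e1: "exec sort_points s0 t1 s1" "t1 \<le> 200 * (n + 1) ^ 2" and s1: "points_sorted n p s1"
    by (rule tripleD[OF sort_points_correct[OF p_inj] p0])
  note f1 = exec_frame[OF e1(1) targets_sort_points(1) equalityD1[OF targets_sort_points(2)]]
  define \<pi> where "\<pi> = nmem s1 PERM"
  define q where "q = (\<lambda>i. p (\<pi> i))"
  have bij: "bij_betw \<pi> {..<n} {..<n}" using s1 by (simp add: points_sorted_def \<pi>_def)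
  have \<pi>_less: "\<pi> i < n" if "i < n" for i using bij_betwE[OF bij] that by simp
  interpret sorted_points n q
    using s1 by unfold_locales (auto simp: points_sorted_def q_def \<pi>_def)
  have X: "points = set ps"
  proof -
    have "points = p ` \<pi> ` {..<n}" unfolding points_def by (simp add: q_def image_image)
    also have "\<dots> = p ` {..<n}" using bij by (simp add: bij_betw_def)
    also have "\<dots> = set ps" by (auto simp: p_def n_def set_conv_nth)
    finally show ?thesis .
  qed
  have "coords_loaded s1"
    using s1 \<pi>_less unfolding coords_loaded_def points_sorted_def points_loaded_def
    by (simp add: q_def \<pi>_def)
  then obtain t2 s2 where e2: "exec load_slopes s1 t2 s2" "t2 \<le> 300 * (n + 1) ^ 2" and s2: "slopes_loaded n slope s2"
    by (rule tripleD[OF load_slopes_correct])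
  note f2 = exec_frame[OF e2(1) targets_load_slopes]
  obtain t3 s3 where e3: "exec insert_all s2 t3 s3" "t3 \<le> 2300 * (n + 1) ^ 2" and s3: "lists_state 0 s3"
    by (rule tripleD[OF insert_all_correct s2])
  note f3 = exec_frame[OF e3(1) targets_insert_all(1) equalityD1[OF targets_insert_all(2)]]
  have "nmem s3 CNT = (\<lambda>_. 0)" by (simp add: f3 f2 f1 s0)
  with s3 have "lists_state 0 s3 \<and> nmem s3 CNT = (\<lambda>_. 0)" by simp
  then obtain t4 s4 where e4: "exec count_degrees s3 t4 s4" "t4 \<le> 400 * (n + 1) ^ 2" and s4: "degrees_loaded s4"
    by (rule tripleD[OF count_degrees_correct])
  note f4 = exec_frame[OF e4(1) targets_count_degrees(1) equalityD1[OF targets_count_degrees(2)]]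
  have "prepared \<tau> s4" using s4 s0 by (simp add: prepared_def f4 f3 f2 f1)
  moreover have "upper_part 20 s4 = \<lparr>nmem = (\<lambda>_ _. 0), rmem = (\<lambda>_ _. 0)\<rparr>"
    by (simp add: upper_part_def f4 f3 f2 f1 s0)
  ultimately have "prepared \<tau> s4 \<and> upper_part 20 s4 = \<lparr>nmem = (\<lambda>_ _. 0), rmem = (\<lambda>_ _. 0)\<rparr>" by simp
  then obtain t5 s5 where e5: "exec load_adjacency s4 t5 s5" "t5 \<le> 300 * (n + 1) ^ 2"
    and s5: "prepared \<tau> s5 \<and> upper_part 20 s5 = matmul_input (n, adjacency \<tau>, adjacency \<tau>)"
    by (rule tripleD[OF load_adjacency_correct])
  note f5 = exec_frame[OF e5(1) targets_load_adjacency]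
  have "(n, adjacency \<tau>, adjacency \<tau>) \<in> matmul_instances"
    by (simp add: matmul_instances_def adjacency_def)
  with mm obtain t6 m where m: "exec mm (matmul_input (n, adjacency \<tau>, adjacency \<tau>)) t6 m" "t6 \<le> T n"
    "matmul_output (n, adjacency \<tau>, adjacency \<tau>) m" by fastforce
  obtain s6 where e6: "exec (shift_com 20 mm) s5 t6 s6" and s6: "upper_part 20 s6 = m"
    using exec_shift[OF m(1)] s5 by blast
  have f6: "nmem s6 a = nmem s5 a" "rmem s6 a = rmem s5 a" if "a < 20" for a
    using exec_nmem_frame[OF e6 nat_targets_shift[OF that]] exec_rmem_frame[OF e6 real_targets_shift[OF that]] by auto
  have "product_loaded \<tau> s6"
    unfolding product_loaded_def
  proof (intro conjI allI impI)
    show "prepared \<tau> s6" using s5 prepared_cong[of s6 s5 \<tau>] by (simp add: f6)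
    fix i j assume ij: "i < n" "j < n"
    have "rmem s6 22 (i * n + j) = rmem m 2 (i * n + j)" using s6 by (auto simp: upper_part_def)
    also have "\<dots> = mat n n (\<lambda>(i, j). rmem m 2 (i * n + j)) $$ (i, j)" using ij by simp
    also have "\<dots> = (adjacency \<tau> * adjacency \<tau>) $$ (i, j)" using m(3) by (simp add: matmul_output_def)
    finally show "rmem s6 22 (i * n + j) = real (card {k. k < n \<and> ordinary_pair \<tau> i k \<and> ordinary_pair \<tau> k j})"
      using product_eq[OF ij] by simp
  qed
  moreover have "rmem s6 2 0 = 0" "nmem s6 1 0 = 0" by (simp_all add: f6 f5 f4 f3 f2 f1 s0)
  ultimately have "product_loaded \<tau> s6 \<and> rmem s6 2 0 = 0 \<and> nmem s6 1 0 = 0" by simp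
  then obtain t7 s7 where e7: "exec sum_cells s6 t7 s7" "t7 \<le> 300 * (n + 1) ^ 2" and s7: "summed \<tau> s7"
    by (rule tripleD[OF sum_cells_correct])
  note f7 = exec_frame[OF e7(1) targets_sum_cells]
  obtain t8 s8 where e8: "exec search s7 t8 s8" "t8 \<le> 300 * (n + 1)" and s8: "summed \<tau> s8 \<and>
      (found \<tau> s8 \<longrightarrow> nmem s8 R_VAR 0 \<in> third_points \<tau> (nmem s8 P_VAR 0) (nmem s8 Q_VAR 0))"
    by (rule tripleD[OF search_correct s7])
  note f8 = exec_frame[OF e8(1) targets_search(1) equalityD1[OF targets_search(2)]]
  have perm: "nmem s8 PERM = \<pi>" by (simp add: f8 f7 f6 f5 f4 f3 f2 \<pi>_def)
  obtain t9 where e9: "exec report s8 t9 (run report s8)" "t9 \<le> 50"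
    using exec_loop_free[of report s8] by (auto simp: report_def)
  have "exec (triangle_program mm) s0 (t1 + (t2 + (t3 + (t4 + (t5 + (t6 + (t7 + (t8 + t9)))))))) (run report s8)"
    unfolding triangle_program_def
    by (rule exec.Seq[OF e1(1) exec.Seq[OF e2(1) exec.Seq[OF e3(1) exec.Seq[OF e4(1) exec.Seq[OF e5(1)
      exec.Seq[OF e6 exec.Seq[OF e7(1) exec.Seq[OF e8(1) e9(1)]]]]]]]])
  moreover have "t1 + (t2 + (t3 + (t4 + (t5 + (t6 + (t7 + (t8 + t9))))))) \<le> T n + 5000 * (n + 1) ^ 2"
    by (rule total_time_le[OF e1(2) e2(2) e3(2) e4(2) e5(2) m(2) e7(2) e8(2) e9(2)])
  moreover have "counting_output (ps, \<tau>) (run report s8)"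
    using s8 card_all_third_points[of \<tau>]
    by (simp add: counting_output_def report_def summed_def X)
  moreover have "finding_output (ps, \<tau>) (run report s8)"
  proof (cases "found \<tau> s8")
    case True
    define P where "P = nmem s8 P_VAR 0"
    define Q where "Q = nmem s8 Q_VAR 0"
    define R where "R = nmem s8 R_VAR 0"
    have PQR: "P < n" "Q < n" "R < n" "triangle_indices \<tau> P Q R"
      using True s8 by (auto simp: found_def third_points_def P_def Q_def R_def)
    have out: "nmem (run report s8) 1 0 = 1" "nmem (run report s8) 1 1 = \<pi> P"
      "nmem (run report s8) 1 2 = \<pi> Q" "nmem (run report s8) 1 3 = \<pi> R"
      using True by (simp_all add: report_def found_def perm P_def Q_def R_def)
    have "(\<lambda>m. ps ! nmem (run report s8) 1 m) ` {1, 2, 3} = {q P, q Q, q R}"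
      by (simp only: image_insert image_empty out q_def p_def)
    moreover have tri: "ordinary_triangle (set ps) \<tau> {q P, q Q, q R}"
      using PQR ordinary_triangle_iff[of P Q R \<tau>] by (simp add: X)
    moreover have "\<forall>m\<in>{1, 2, 3}. nmem (run report s8) 1 m < length ps"
      using PQR \<pi>_less by (simp only: ball_simps out n_def[symmetric])
    moreover have ex: "\<exists>T. ordinary_triangle (set ps) \<tau> T" using tri by blast
    ultimately show ?thesis unfolding finding_output_def prod.case if_P[OF ex] using out(1) by metis
  next
    case False
    then have "nmem s8 1 0 = 0" "\<not> (\<exists>T. ordinary_triangle (set ps) \<tau> T)"
      using s8 ex_triangle_iff[of \<tau>] by (auto simp: summed_def X)
    then show ?thesis by (simp add: finding_output_def report_def)
  qed
  ultimately show ?thesis unfolding s0_def n_def by blast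
qed

text \<open>The quadratic overhead is absorbed because the exponent is at least 2.\<close>

lemma triangles_in_matmul_time:
  assumes "matmul_in_time s" "s \<le> s'"
  shows "triangle_finding_in_time s'" "triangle_counting_in_time s'"
proof -
  have "2 \<le> s" using matmul_exponent_ge_2[OF assms(1)] .
  obtain mm T where T: "(\<lambda>n. real (T n)) \<in> O(\<lambda>n. real n powr s)"
    and mm: "\<forall>x\<in>matmul_instances. \<exists>t s'. exec mm (matmul_input x) t s' \<and> t \<le> T (fst x) \<and> matmul_output x s'"
    using assms(1) unfolding matmul_in_time_def solvable_in_time_def by blast
  define U where "U n = T n + 5000 * (n + 1) ^ 2" for n
  have mono: "(\<lambda>n. real n powr r) \<in> O(\<lambda>n. real n powr s')" if "r \<le> s'" for r
    using that by (subst powr_bigo_iff) (auto simp: filterlim_real_sequentially)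
  have "(\<lambda>n. real (T n)) \<in> O(\<lambda>n. real n powr s')"
    using T mono[OF assms(2)] by (rule landau_o.big_trans)
  moreover have "(\<lambda>n. real (5000 * (n + 1) ^ 2)) \<in> O(\<lambda>n. real n powr s')"
    using polynomial_bigo[of 5000 2] mono[of "real 2"] \<open>2 \<le> s\<close> assms(2)
    by (intro landau_o.big_trans[OF polynomial_bigo]) simp
  ultimately have U: "(\<lambda>n. real (U n)) \<in> O(\<lambda>n. real n powr s')"
    unfolding U_def of_nat_add by (rule sum_in_bigo)
  have run: "\<exists>t s'. exec (triangle_program mm) (triangle_input x) t s' \<and>
      t \<le> U ((\<lambda>(ps, \<tau>). length ps) x) \<and> finding_output x s' \<and> counting_output x s'"
    if "x \<in> triangle_instances" for x
  proof -
    obtain ps \<tau> where "x = (ps, \<tau>)" by (cases x)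
    then show ?thesis
      using triangle_program_correct[OF mm, of ps \<tau>] that by (auto simp: triangle_instances_def U_def)
  qed
  show "triangle_finding_in_time s'"
    unfolding triangle_finding_in_time_def solvable_in_time_def using U run by blast
  show "triangle_counting_in_time s'"
    unfolding triangle_counting_in_time_def solvable_in_time_def using U run by blast
qed

theorem theorem5:
  shows "(matmul_in_time omega \<longrightarrow>
           triangle_finding_in_time omega \<and> triangle_counting_in_time omega) \<and>
         (\<forall>\<epsilon>>0. triangle_finding_in_time (omega + \<epsilon>) \<and> triangle_counting_in_time (omega + \<epsilon>))"
proof (intro conjI impI allI)
  show "triangle_finding_in_time omega" "triangle_counting_in_time omega" if "matmul_in_time omega"
    using triangles_in_matmul_time[OF that order_refl] by auto
  fix \<epsilon> :: real assume "\<epsilon> > 0"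
  then have "Inf {s. matmul_in_time s} < omega + \<epsilon>" by (simp add: omega_def)
  then obtain s where "matmul_in_time s" "s \<le> omega + \<epsilon>"
    using cInf_lessD[of "{s. matmul_in_time s}" "omega + \<epsilon>"] matmul_in_time_3 by force
  then show "triangle_finding_in_time (omega + \<epsilon>)" "triangle_counting_in_time (omega + \<epsilon>)"
    using triangles_in_matmul_time by auto
qed

end
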